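(* There is an algorithm which computes, for any $n$ and any polynomial $P \in \mathbb{Z}[y_1, \dots, y_n]$, an integer $N$ and a list of at most $\binom{N+7}{5}$ generators, each of total degree at most five, of an ideal $I_P \subseteq \mathbb{Q}[S, T, D_1, \dots, D_N]$ such that: \begin{itemize} \item $I_P$ is primary to the maximal ideal $\mathfrak{m} = (2S-1,\ 2T-1,\ D_1-1,\ \dots,\ D_N-1)$, and therefore proper and of Krull dimension zero; \item $I_P$ contains no monomial and no binomial; \item $I_P$ contains the quadrinomial $S^2 - T^2 - S + T$; \item every trinomial in $I_P$ is a term times a cleared affine trinomial $\tilde\tau_d$ for some $d \in \mathbb{Z}^N$, and \[ \bigl(\exists\, d \in \mathbb{Z}^N : \tilde\tau_d \in I_P\bigr) \iff \bigl(\exists\, y \in \mathbb{Z}^n : P(y) = 0\bigr). \] \end{itemize}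
   Context: Algorithms are Turing machines that terminate on every input. Polynomials are written in reduced form, as sums of nonzero coefficients times pairwise distinct monomials; the summands are the terms. A monomial, binomial, trinomial, quadrinomial is a polynomial with exactly one, two, three, four terms, respectively. A term is a nonzero scalar times a product of nonnegative powers of the variables. For $v\in\mathbb{Z}^N$ write $D^v = D_1^{v_1}\cdots D_N^{v_N}$, and for $d \in \mathbb{Z}^N$ write $|d| = (|d_1|, \dots, |d_N|) \in \mathbb{N}^N$. The cleared affine trinomial associated with $d\in\mathbb{Z}^N$ is the ordinary polynomial \[ \tilde\tau_d = D^{|d|} - S D^{|d|+d} - T D^{|d|-d} \in \mathbb{Q}[S,T,D_1,\dots,D_N]. \] *)

theory Defs
  imports Complex_Main "HOL-Library.Poly_Mapping" "HOL-Algebra.QuotRing"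
begin

section \<open>Turing machines\<close>

text \<open>
  Deterministic multi-tape machines with two-way infinite tapes. States are \<open>0..num_states\<close>, where
  \<open>0\<close> is initial and \<open>num_states\<close> is the halting state; tape symbols are \<open>0..<num_symbols\<close>, where
  \<open>0\<close> is the blank. Only the finitely many values of \<open>transition\<close> on genuine arguments
  (see \<open>turing_machine\<close>) influence a run.
\<close>

datatype head_move = MoveL | MoveN | MoveR

record tm =
  num_tapes :: nat
  num_symbols :: nat
  num_states :: nat
  transition :: "nat \<Rightarrow> nat list \<Rightarrow> nat \<times> (nat \<times> head_move) list"

text \<open>
  Tape \<open>0\<close> carries the input and tape \<open>1\<close> the output. Words are over a binary alphabet, whose letters
  are the symbols \<open>1\<close> and \<open>2\<close>; so at least two tapes and three symbols are required.
\<close>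

definition turing_machine :: "tm \<Rightarrow> bool" where
  "turing_machine M \<longleftrightarrow> 2 \<le> num_tapes M \<and> 3 \<le> num_symbols M \<and>
     (\<forall>q < num_states M. \<forall>xs. length xs = num_tapes M \<and> set xs \<subseteq> {..<num_symbols M} \<longrightarrow>
        fst (transition M q xs) \<le> num_states M \<and>
        length (snd (transition M q xs)) = num_tapes M \<and>
        fst ` set (snd (transition M q xs)) \<subseteq> {..<num_symbols M})"

type_synonym tape = "(int \<Rightarrow> nat) \<times> int"

type_synonym config = "nat \<times> tape list"

fun move_head :: "head_move \<Rightarrow> int \<Rightarrow> int" where
  "move_head MoveL h = h - 1"
| "move_head MoveN h = h"
| "move_head MoveR h = h + 1"

fun act :: "nat \<times> head_move \<Rightarrow> tape \<Rightarrow> tape" where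
  "act (x, mv) (T, h) = (T(h := x), move_head mv h)"

fun tm_step :: "tm \<Rightarrow> config \<Rightarrow> config" where
  "tm_step M (q, ts) =
     (if q = num_states M then (q, ts)
      else (let (q', as) = transition M q (map (\<lambda>(T, h). T h) ts) in (q', map2 act as ts)))"

definition word_cells :: "bool list \<Rightarrow> int \<Rightarrow> nat" where
  "word_cells w i =
     (if 0 \<le> i \<and> i < int (length w) then (if w ! nat i then 2 else 1) else 0)"

definition initial_config :: "tm \<Rightarrow> bool list \<Rightarrow> config" where
  "initial_config M w =
     (0, (word_cells w, 0) # replicate (num_tapes M - 1) (word_cells [], 0))"

definition halts_with :: "tm \<Rightarrow> bool list \<Rightarrow> bool list \<Rightarrow> bool" where
  "halts_with M w v \<longleftrightarrow>
     (\<exists>t ts. (tm_step M ^^ t) (initial_config M w) = (num_states M, ts) \<and>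
             fst (ts ! 1) = word_cells v)"

text \<open>\<open>f\<close> is a total function on words, so the machine is required to halt on every input.\<close>

definition turing_computable :: "(bool list \<Rightarrow> bool list) \<Rightarrow> bool" where
  "turing_computable f \<longleftrightarrow> (\<exists>M. turing_machine M \<and> (\<forall>w. halts_with M w (f w)))"


section \<open>Polynomials\<close>

text \<open>
  Polynomials in the variables \<open>x\<^sub>0, x\<^sub>1, \<dots>\<close>, as finitely supported maps from exponents to
  coefficients. The support \<open>Poly_Mapping.keys p\<close> is exactly the set of monomials of the reduced form of \<open>p\<close>.
\<close>

type_synonym 'a mpoly = "(nat \<Rightarrow>\<^sub>0 nat) \<Rightarrow>\<^sub>0 'a"

definition mvars :: "'a::zero mpoly \<Rightarrow> nat set" where
  "mvars p = (\<Union>m \<in> Poly_Mapping.keys p. Poly_Mapping.keys m)"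

definition mvar :: "nat \<Rightarrow> 'a::zero_neq_one mpoly" where
  "mvar i = Poly_Mapping.single (Poly_Mapping.single i 1) 1"

definition num_terms :: "'a::zero mpoly \<Rightarrow> nat" where
  "num_terms p = card (Poly_Mapping.keys p)"

definition total_degree :: "'a::zero mpoly \<Rightarrow> nat" where
  "total_degree p = Max (insert 0 ((\<lambda>m. \<Sum>i \<in> Poly_Mapping.keys m. Poly_Mapping.lookup m i) ` Poly_Mapping.keys p))"

definition meval :: "(nat \<Rightarrow> 'a::comm_semiring_1) \<Rightarrow> 'a mpoly \<Rightarrow> 'a" where
  "meval y p = (\<Sum>m \<in> Poly_Mapping.keys p. Poly_Mapping.lookup p m * (\<Prod>i \<in> Poly_Mapping.keys m. y i ^ Poly_Mapping.lookup m i))"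

text \<open>The polynomial ring in the first \<open>k\<close> variables.\<close>

definition mpoly_ring :: "nat \<Rightarrow> 'a::comm_ring_1 mpoly ring" where
  "mpoly_ring k = \<lparr>carrier = {p. mvars p \<subseteq> {..<k}}, mult = (*), one = 1, zero = 0, add = (+)\<rparr>"

lemma mvars_add: "mvars (p + q) \<subseteq> mvars p \<union> mvars q"
  unfolding mvars_def using Poly_Mapping.keys_add[of p q] by blast

lemma mvars_mult: "mvars (p * q) \<subseteq> mvars p \<union> mvars (q :: 'a::comm_ring_1 mpoly)"
proof
  fix i assume "i \<in> mvars (p * q)"
  then obtain m where m: "m \<in> Poly_Mapping.keys (p * q)" "i \<in> Poly_Mapping.keys m" by (auto simp: mvars_def)
  then obtain a b where "m = a + b" "a \<in> Poly_Mapping.keys p" "b \<in> Poly_Mapping.keys q"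
    using keys_mult[of p q] by blast
  with m show "i \<in> mvars p \<union> mvars q"
    using Poly_Mapping.keys_add[of a b] by (auto simp: mvars_def)
qed

lemma cring_mpoly_ring: "cring (mpoly_ring k :: 'a::comm_ring_1 mpoly ring)"
proof -
  let ?C = "{p :: 'a mpoly. mvars p \<subseteq> {..<k}}"
  have add: "p + q \<in> ?C" and mult: "p * q \<in> ?C" if "p \<in> ?C" "q \<in> ?C" for p q
    using that mvars_add[of p q] mvars_mult[of p q] by auto
  have zero: "0 \<in> ?C" and one: "1 \<in> ?C"
    by (auto simp: mvars_def)
  have uminus: "- p \<in> ?C" if "p \<in> ?C" for p
    using that by (simp add: mvars_def)
  show ?thesis
  proof (rule cringI)
    show "abelian_group (mpoly_ring k :: 'a mpoly ring)"
    proof (rule abelian_groupI)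
      fix x :: "'a mpoly" assume "x \<in> carrier (mpoly_ring k)"
      then show "\<exists>y \<in> carrier (mpoly_ring k). y \<oplus>\<^bsub>mpoly_ring k\<^esub> x = \<zero>\<^bsub>mpoly_ring k\<^esub>"
        using uminus by (intro bexI[of _ "- x"]) (simp_all add: mpoly_ring_def)
    qed (use add zero in \<open>simp_all add: mpoly_ring_def ac_simps\<close>)
    show "comm_monoid (mpoly_ring k :: 'a mpoly ring)"
      by (rule comm_monoidI) (use mult one in \<open>simp_all add: mpoly_ring_def ac_simps\<close>)
  qed (simp add: mpoly_ring_def distrib_right)
qed


section \<open>Primary ideals and Krull dimension\<close>

definition radical :: "('a, 'b) ring_scheme \<Rightarrow> 'a set \<Rightarrow> 'a set" where
  "radical R I = {a \<in> carrier R. \<exists>k::nat. a [^]\<^bsub>R\<^esub> k \<in> I}"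

definition primary_ideal :: "('a, 'b) ring_scheme \<Rightarrow> 'a set \<Rightarrow> bool" where
  "primary_ideal R I \<longleftrightarrow> ideal I R \<and> I \<noteq> carrier R \<and>
     (\<forall>a \<in> carrier R. \<forall>b \<in> carrier R. a \<otimes>\<^bsub>R\<^esub> b \<in> I \<longrightarrow> a \<in> I \<or> b \<in> radical R I)"

definition primary_to :: "('a, 'b) ring_scheme \<Rightarrow> 'a set \<Rightarrow> 'a set \<Rightarrow> bool" where
  "primary_to R I \<mm> \<longleftrightarrow> primary_ideal R I \<and> radical R I = \<mm>"

definition prime_chain :: "('a, 'b) ring_scheme \<Rightarrow> nat \<Rightarrow> (nat \<Rightarrow> 'a set) \<Rightarrow> bool" where
  "prime_chain R l Q \<longleftrightarrow> (\<forall>i \<le> l. primeideal (Q i) R) \<and> (\<forall>i < l. Q i \<subset> Q (Suc i))"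

text \<open>This is false for the zero ring, for every \<open>d\<close>.\<close>

definition has_krull_dim :: "('a, 'b) ring_scheme \<Rightarrow> nat \<Rightarrow> bool" where
  "has_krull_dim R d \<longleftrightarrow> (\<exists>Q. prime_chain R d Q) \<and> (\<forall>l Q. prime_chain R l Q \<longrightarrow> l \<le> d)"


section \<open>The ring of the constructed ideals\<close>

text \<open>
  In \<open>\<rat>[S, T, D\<^sub>1, \<dots>, D\<^sub>N]\<close> the variables \<open>S\<close>, \<open>T\<close> are numbers \<open>0\<close> and \<open>1\<close>; \<open>D\<close> is indexed from
  \<open>0\<close>, so that \<open>D i\<close> is variable \<open>i + 2\<close> and stands for \<open>D\<^sub>i\<^sub>+\<^sub>1\<close>.
\<close>

abbreviation STD_ring :: "nat \<Rightarrow> rat mpoly ring" where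
  "STD_ring N \<equiv> mpoly_ring (N + 2)"

definition varS :: "rat mpoly" where "varS = mvar 0"
definition varT :: "rat mpoly" where "varT = mvar 1"
definition varD :: "nat \<Rightarrow> rat mpoly" where "varD i = mvar (i + 2)"

text \<open>
  \<open>\<int>\<^sup>N\<close> is rendered as the integer lists of length \<open>N\<close>. The exponents \<open>|d\<^sub>i| \<plusminus> d\<^sub>i\<close> are nonnegative,
  so \<open>nat\<close> loses nothing.
\<close>

definition affine_trinomial :: "int list \<Rightarrow> rat mpoly" where
  "affine_trinomial d =
     (\<Prod>i < length d. varD i ^ nat \<bar>d ! i\<bar>)
     - varS * (\<Prod>i < length d. varD i ^ nat (\<bar>d ! i\<bar> + d ! i))
     - varT * (\<Prod>i < length d. varD i ^ nat (\<bar>d ! i\<bar> - d ! i))"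

definition point_ideal :: "nat \<Rightarrow> rat mpoly set" where
  "point_ideal N = genideal (STD_ring N)
     ({2 * varS - 1, 2 * varT - 1} \<union> (\<lambda>i. varD i - 1) ` {..<N})"


section \<open>Encodings as words\<close>

text \<open>
  Numbers are written in unary and terminated, lists are preceded by their length. The reduced
  form of a polynomial is the list of its terms in increasing order of exponents, with respect
  to the lexicographic order that \<^theory>\<open>HOL-Library.Poly_Mapping\<close> provides; each term is
  written as its coefficient followed by its \<open>k\<close> exponents.
\<close>

definition code_nat :: "nat \<Rightarrow> bool list" where
  "code_nat a = replicate a True @ [False]"

definition code_int :: "int \<Rightarrow> bool list" where
  "code_int z = (z < 0) # code_nat (nat \<bar>z\<bar>)"

definition code_rat :: "rat \<Rightarrow> bool list" where
  "code_rat r = code_int (fst (quotient_of r)) @ code_int (snd (quotient_of r))"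

definition code_list :: "('a \<Rightarrow> bool list) \<Rightarrow> 'a list \<Rightarrow> bool list" where
  "code_list c xs = code_nat (length xs) @ concat (map c xs)"

definition code_mpoly :: "('a::zero \<Rightarrow> bool list) \<Rightarrow> nat \<Rightarrow> 'a mpoly \<Rightarrow> bool list" where
  "code_mpoly c k p =
     code_list (\<lambda>m. c (Poly_Mapping.lookup p m) @ concat (map (\<lambda>i. code_nat (Poly_Mapping.lookup m i)) [0..<k]))
       (sorted_list_of_set (Poly_Mapping.keys p))"

definition code_input :: "nat \<Rightarrow> int mpoly \<Rightarrow> bool list" where
  "code_input n P = code_nat n @ code_mpoly code_int n P"

definition code_output :: "nat \<Rightarrow> rat mpoly list \<Rightarrow> bool list" where
  "code_output N gens = code_nat N @ code_list (code_mpoly code_rat (N + 2)) gens"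

text \<open>Both encodings are uniquely readable.\<close>

lemma code_nat_inj: "code_nat a @ u = code_nat b @ v \<Longrightarrow> a = b \<and> u = v"
proof (induction a arbitrary: b)
  case 0
  then show ?case by (cases b) (auto simp: code_nat_def)
next
  case (Suc a)
  then show ?case by (cases b) (auto simp: code_nat_def)
qed

lemma code_int_inj: "code_int a @ u = code_int b @ v \<Longrightarrow> a = b \<and> u = v"
  using code_nat_inj[of "nat \<bar>a\<bar>" u "nat \<bar>b\<bar>" v] by (auto simp: code_int_def abs_if split: if_splits)

lemma code_rat_inj:
  assumes "code_rat a @ u = code_rat b @ v"
  shows "a = b \<and> u = v"
proof -
  have "fst (quotient_of a) = fst (quotient_of b) \<and>
        code_int (snd (quotient_of a)) @ u = code_int (snd (quotient_of b)) @ v"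
    using code_int_inj[OF assms[unfolded code_rat_def append_assoc]] .
  moreover from this have "snd (quotient_of a) = snd (quotient_of b) \<and> u = v"
    using code_int_inj by blast
  ultimately show ?thesis
    by (metis prod.collapse quotient_of_inject)
qed

lemma concat_code_inj:
  assumes "concat (map c xs) @ u = concat (map c' ys) @ v" "length xs = length ys"
    and "\<And>x y u v. x \<in> set xs \<Longrightarrow> y \<in> set ys \<Longrightarrow> c x @ u = c' y @ v \<Longrightarrow> g x = h y \<and> u = v"
  shows "map g xs = map h ys \<and> u = v"
  using assms(2,1,3)
proof (induction xs ys rule: list_induct2)
  case (Cons x xs y ys)
  have "g x = h y \<and> concat (map c xs) @ u = concat (map c' ys) @ v"
    using Cons.prems(1) by (intro Cons.prems(2)) auto
  moreover from this have "map g xs = map h ys \<and> u = v"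
    using Cons.prems(2) by (intro Cons.IH) auto
  ultimately show ?case by simp
qed simp

lemma code_list_inj:
  assumes "code_list c xs @ u = code_list c' ys @ v"
    and "\<And>x y u v. x \<in> set xs \<Longrightarrow> y \<in> set ys \<Longrightarrow> c x @ u = c' y @ v \<Longrightarrow> g x = h y \<and> u = v"
  shows "map g xs = map h ys \<and> u = v"
proof -
  have "length xs = length ys \<and> concat (map c xs) @ u = concat (map c' ys) @ v"
    using code_nat_inj[OF assms(1)[unfolded code_list_def append_assoc]] .
  with assms(2) show ?thesis by (intro concat_code_inj) auto
qed

lemma code_mpoly_inj:
  assumes eq: "code_mpoly c k p @ u = code_mpoly c k q @ v"
    and c: "\<And>a b u v. c a @ u = c b @ v \<Longrightarrow> a = b \<and> u = v"
    and vars: "mvars p \<subseteq> {..<k}" "mvars q \<subseteq> {..<k}"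
  shows "p = q \<and> u = v"
proof -
  let ?ms = "\<lambda>p. sorted_list_of_set (Poly_Mapping.keys p)"
  have "map (\<lambda>m. (m, Poly_Mapping.lookup p m)) (?ms p) = map (\<lambda>m. (m, Poly_Mapping.lookup q m)) (?ms q) \<and> u = v"
  proof (rule code_list_inj[OF eq[unfolded code_mpoly_def]])
    fix m m' u v
    assume m: "m \<in> set (?ms p)" "m' \<in> set (?ms q)"
      and e: "(c (Poly_Mapping.lookup p m) @ concat (map (\<lambda>i. code_nat (Poly_Mapping.lookup m i)) [0..<k])) @ u =
              (c (Poly_Mapping.lookup q m') @ concat (map (\<lambda>i. code_nat (Poly_Mapping.lookup m' i)) [0..<k])) @ v"
    have 1: "Poly_Mapping.lookup p m = Poly_Mapping.lookup q m' \<and>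
        concat (map (\<lambda>i. code_nat (Poly_Mapping.lookup m i)) [0..<k]) @ u =
        concat (map (\<lambda>i. code_nat (Poly_Mapping.lookup m' i)) [0..<k]) @ v"
      using c[OF e[unfolded append_assoc]] .
    have "concat (map code_nat (map (Poly_Mapping.lookup m) [0..<k])) @ u =
          concat (map code_nat (map (Poly_Mapping.lookup m') [0..<k])) @ v"
      using 1 by (simp add: comp_def)
    then have 2: "map id (map (Poly_Mapping.lookup m) [0..<k]) = map id (map (Poly_Mapping.lookup m') [0..<k]) \<and> u = v"
      by (rule concat_code_inj) (auto dest: code_nat_inj)
    have "Poly_Mapping.lookup m i = Poly_Mapping.lookup m' i" for i
    proof (cases "i < k")
      case False
      then have "i \<notin> Poly_Mapping.keys m" "i \<notin> Poly_Mapping.keys m'" using m vars by (auto simp: mvars_def)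
      then show ?thesis by (simp add: in_keys_iff)
    qed (use 2 in auto)
    then show "(m, Poly_Mapping.lookup p m) = (m', Poly_Mapping.lookup q m') \<and> u = v"
      using 1 2 by (simp add: poly_mapping_eqI)
  qed
  then have "u = v" and
    "set (map (\<lambda>m. (m, Poly_Mapping.lookup p m)) (?ms p)) =
     set (map (\<lambda>m. (m, Poly_Mapping.lookup q m)) (?ms q))"
    by simp_all
  then have graph: "(\<lambda>m. (m, Poly_Mapping.lookup p m)) ` Poly_Mapping.keys p =
                    (\<lambda>m. (m, Poly_Mapping.lookup q m)) ` Poly_Mapping.keys q"
    by simp
  have "Poly_Mapping.lookup p m = Poly_Mapping.lookup q m" for m
  proof -
    have "c \<noteq> 0 \<and> Poly_Mapping.lookup p m = c \<longleftrightarrow> c \<noteq> 0 \<and> Poly_Mapping.lookup q m = c" for c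
      using arg_cong[OF graph, of "\<lambda>A. (m, c) \<in> A"] by (auto simp: in_keys_iff image_iff)
    then show ?thesis by metis
  qed
  then show ?thesis using \<open>u = v\<close> by (simp add: poly_mapping_eqI)
qed

lemma code_input_inj:
  assumes "code_input n P = code_input n' P'"
    and "P \<in> carrier (mpoly_ring n)" "P' \<in> carrier (mpoly_ring n')"
  shows "n = n' \<and> P = P'"
proof -
  have "n = n' \<and> code_mpoly code_int n P = code_mpoly code_int n' P'"
    using code_nat_inj[OF assms(1)[unfolded code_input_def]] .
  then show ?thesis
    using code_mpoly_inj[of code_int n P "[]" P' "[]"] code_int_inj assms(2,3)
    by (auto simp: mpoly_ring_def)
qed

lemma code_output_inj:
  assumes "code_output N gs = code_output N' gs'"
    and "set gs \<subseteq> carrier (STD_ring N)" "set gs' \<subseteq> carrier (STD_ring N')"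
  shows "N = N' \<and> gs = gs'"
proof -
  have 1: "N = N' \<and> code_list (code_mpoly code_rat (N + 2)) gs =
                   code_list (code_mpoly code_rat (N' + 2)) gs'"
    using code_nat_inj[OF assms(1)[unfolded code_output_def]] .
  then have "code_list (code_mpoly code_rat (N + 2)) gs @ [] =
             code_list (code_mpoly code_rat (N + 2)) gs' @ []" by metis
  then have "map id gs = map id gs' \<and> [] = ([] :: bool list)"
  proof (rule code_list_inj)
    fix p q u v
    assume "p \<in> set gs" "q \<in> set gs'"
      "code_mpoly code_rat (N + 2) p @ u = code_mpoly code_rat (N + 2) q @ v"
    then show "id p = id q \<and> u = v"
      using code_mpoly_inj[of code_rat "N + 2" p u q v] code_rat_inj assms(2,3) 1
      by (auto simp: mpoly_ring_def subset_iff)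
  qed
  with 1 show ?thesis by simp
qed

end

theory Submission
  imports Defs "HOL-Library.Nat_Bijection" "HOL-Computational_Algebra.Primes"
begin

text \<open>
  Put \<open>u = S + T - 1\<close>, \<open>v = S - T\<close> and \<open>x\<^sub>i = D\<^sub>i - 1\<close>. Modulo \<open>v\<^sup>5\<close>, the cubic monomials other than \<open>v\<^sup>3\<close>, and the multiples of \<open>u\<close> by
  the maximal ideal, the trinomial of \<open>d\<close> is a unit times an element of the span of \<open>u\<close>, \<open>v x\<^sub>i\<close>, \<open>x\<^sub>i x\<^sub>j\<close>,
  and its coordinates there are the products of the entries of \<open>(1, d)\<close>. So a linear functional on this span
  is a quadratic equation for \<open>d\<close>, and the common kernel of the functionals of a system of equations is an ideal that contains the
  trinomial of \<open>d\<close> if and only if \<open>d\<close> solves the system.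

  Conversely let a combination of \<open>S\<^sup>p T\<^sup>q D\<^sup>e\<close> for three triples \<open>(p, q, e)\<close> be in the ideal. The coefficients of \<open>v, \<dots>, v\<^sup>4\<close> leave two
  possibilities for the \<open>(p, q)\<close>: those of the trinomials of \<open>d\<close>, and a constant \<open>(p, q)\<close>, in which case
  differences of the \<open>e\<close> are a common zero of the leading forms of the equations. Hence the equations must not have a nontrivial
  one. This is achieved by attaching to every unknown integer \<open>19\<close> more, such that all are coordinates of a solution of
  an equation over \<open>\<int>[\<phi>]\<close>, \<open>\<phi>\<close> the golden ratio, that is definite under one of the real embeddings and solvable for every
  value of the original unknown.

  Each equation is extended by a variable of its own, with the equation that its square be \<open>0\<close>. The product of this
  variable and \<open>v\<close> is a pivot for the functional, whence explicit generators of the kernel. They are primitive recursive in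
  the given polynomial, and primitive recursive functions are evaluated by Turing machines that use their tapes as counters.
\<close>

section \<open>Structured programs for Turing machines\<close>

text \<open>Two demands collide. Constant \<open>(p, q)\<close> must be excluded by leading forms
  without a nontrivial common integer zero; but if they had none over the reals, the solution set
  would be bounded, and only finitely many integers could be represented. Over
  \<open>\<int>[\<phi>]\<close> the demands are separated: definiteness under one embedding excludes
  zeros of the leading form, while the other embedding leaves room for infinitely many solutions.
  Powers up to \<open>v^4\<close> are kept because those up to \<open>v^3\<close> admit other
  exponents: with \<open>p - q = 3, -3\<close> and \<open>p + q = 9\<close> relative to the third
  term, all coefficients below \<open>v^4\<close> can vanish. The fourth gives a norm equation with
  six solutions. Hence the generator \<open>v^5\<close>; all others have degree at most three. In
  the directions other than \<open>v\<close> second order suffices, and that layer is annihilated by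
  the maximal ideal, so that a linear condition on it, however chosen, yields an ideal.\<close>

type_synonym store = "nat \<Rightarrow> tape"

text \<open>\<open>While r x c\<close> repeats until tape \<open>r\<close> shows \<open>x\<close>,
  which suits counters: zero is recognised by the marker under the head. A \<open>Do\<close> without
  a symbol rewrites the scanned one.\<close>

datatype com =
    Do nat "nat option" head_move
  | Seq com com  (infixr \<open>;;\<close> 60)
  | If nat nat com com
  | While nat nat com

fun symbol :: "tape \<Rightarrow> nat" where
  "symbol (T, h) = T h"

fun do_tape :: "nat option \<Rightarrow> head_move \<Rightarrow> tape \<Rightarrow> tape" where
  "do_tape w mv X = act (case w of None \<Rightarrow> symbol X | Some y \<Rightarrow> y, mv) X"

inductive exec :: "com \<Rightarrow> store \<Rightarrow> store \<Rightarrow> bool" where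
  exec_Do: "exec (Do r w mv) s (s(r := do_tape w mv (s r)))"
| exec_Seq: "exec c s s' \<Longrightarrow> exec d s' s'' \<Longrightarrow> exec (c ;; d) s s''"
| exec_IfTrue: "symbol (s r) = x \<Longrightarrow> exec c s t \<Longrightarrow> exec (If r x c d) s t"
| exec_IfFalse: "symbol (s r) \<noteq> x \<Longrightarrow> exec d s t \<Longrightarrow> exec (If r x c d) s t"
| exec_WhileEnd: "symbol (s r) = x \<Longrightarrow> exec (While r x c) s s"
| exec_WhileStep: "symbol (s r) \<noteq> x \<Longrightarrow> exec c s s' \<Longrightarrow> exec (While r x c) s' s'' \<Longrightarrow>
    exec (While r x c) s s''"

primrec wf_com :: "nat \<Rightarrow> com \<Rightarrow> bool" where
  "wf_com k (Do r w mv) \<longleftrightarrow> r < k \<and> (\<forall>y. w = Some y \<longrightarrow> y < 3)"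
| "wf_com k (c ;; d) \<longleftrightarrow> wf_com k c \<and> wf_com k d"
| "wf_com k (If r x c d) \<longleftrightarrow> r < k \<and> wf_com k c \<and> wf_com k d"
| "wf_com k (While r x c) \<longleftrightarrow> r < k \<and> wf_com k c"

lemma wf_com_mono: "wf_com k c \<Longrightarrow> k \<le> k' \<Longrightarrow> wf_com k' c"
  by (induction c) auto

section \<open>Jump code and the correctness of compilation\<close>

datatype instr = IDo nat "nat option" head_move | ITest nat nat nat nat

primrec code_size :: "com \<Rightarrow> nat" where
  "code_size (Do r w mv) = 1"
| "code_size (c ;; d) = code_size c + code_size d"
| "code_size (If r x c d) = code_size c + code_size d + 2"
| "code_size (While r x c) = code_size c + 2"

text \<open>The second argument is the address of the first instruction; all jumps are absolute.\<close>

primrec compile :: "com \<Rightarrow> nat \<Rightarrow> instr list" where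
  "compile (Do r w mv) a = [IDo r w mv]"
| "compile (c ;; d) a = compile c a @ compile d (a + code_size c)"
| "compile (If r x c d) a =
     ITest r x (a + 1) (a + code_size c + 2) # compile c (a + 1) @
     ITest r 0 (a + code_size c + code_size d + 2) (a + code_size c + code_size d + 2) #
     compile d (a + code_size c + 2)"
| "compile (While r x c) a =
     ITest r x (a + code_size c + 2) (a + 1) # compile c (a + 1) @ [ITest r 0 a a]"

lemma length_compile [simp]: "length (compile c a) = code_size c"
  by (induction c arbitrary: a) auto

fun wf_instr :: "nat \<Rightarrow> instr \<Rightarrow> bool" where
  "wf_instr k (IDo r w mv) \<longleftrightarrow> r < k \<and> (\<forall>y. w = Some y \<longrightarrow> y < 3)"
| "wf_instr k (ITest r x a b) \<longleftrightarrow> r < k"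

lemma wf_compile: "wf_com k c \<Longrightarrow> i \<in> set (compile c a) \<Longrightarrow> wf_instr k i"
  by (induction c arbitrary: a) auto

text \<open>Address \<open>length P\<close> means halting. Jumps are clipped to it, so every list of
  instructions yields a legal transition function; compiled code at its own address never jumps
  further. A test with two equal targets serves as an unconditional jump.\<close>

fun instr_step :: "instr list \<Rightarrow> nat \<times> store \<Rightarrow> nat \<times> store" where
  "instr_step P (q, s) =
     (if q < length P then
        (case P ! q of
           IDo r w mv \<Rightarrow> (Suc q, s(r := do_tape w mv (s r)))
         | ITest r x a b \<Rightarrow> (min (length P) (if symbol (s r) = x then a else b), s))
      else (q, s))"

definition reaches :: "instr list \<Rightarrow> nat \<times> store \<Rightarrow> nat \<times> store \<Rightarrow> bool" where
  "reaches P c d \<longleftrightarrow> (\<exists>t. (instr_step P ^^ t) c = d)"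

lemma reaches_refl: "reaches P c c"
  unfolding reaches_def by (rule exI[of _ 0]) simp

lemma reaches_step: "instr_step P c = c' \<Longrightarrow> reaches P c' d \<Longrightarrow> reaches P c d"
  unfolding reaches_def by (metis comp_apply funpow_Suc_right)

lemma reaches_trans: "reaches P c d \<Longrightarrow> reaches P d e \<Longrightarrow> reaches P c e"
  unfolding reaches_def by (metis comp_apply funpow_add)

lemma reaches_test:
  assumes "P = us @ ITest r x a b # vs" "q = length us"
    and "(if symbol (s r) = x then a else b) = q'" "q' \<le> length P"
  shows "reaches P (q, s) (q', s)"
  using assms by (intro reaches_step[OF _ reaches_refl]) (auto simp: min_def)

text \<open>Induction runs over the execution, not the command, so the loop case has a hypothesis
  for the remaining iterations. Arbitrary surrounding code makes the absolute addresses fit in every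
  subprogram.\<close>

lemma reaches_compile:
  assumes "exec c s t" "P = us @ compile c (length us) @ vs"
  shows "reaches P (length us, s) (length us + code_size c, t)"
  using assms
proof (induction arbitrary: us vs rule: exec.induct)
  case (exec_Do r w mv s)
  then show ?case by (intro reaches_step[OF _ reaches_refl]) (simp add: fun_eq_iff)
next
  case (exec_Seq c s s' d s'')
  have "reaches P (length us, s) (length us + code_size c, s')"
    using exec_Seq.prems by (intro exec_Seq.IH(1)) auto
  moreover have "reaches P (length us + code_size c, s') (length us + code_size c + code_size d, s'')"
    using exec_Seq.IH(2)[of "us @ compile c (length us)" vs] exec_Seq.prems by simp
  ultimately have "reaches P (length us, s) (length us + code_size c + code_size d, s'')"
    by (rule reaches_trans)
  then show ?case by (simp add: add.assoc)
next
  case (exec_IfTrue s r x c t d)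
  let ?a = "length us" and ?e = "length us + code_size c + code_size d + 2"
  have "reaches P (?a, s) (?a + 1, s)"
    using exec_IfTrue.prems exec_IfTrue.hyps by (intro reaches_test[where us=us]) auto
  moreover have "reaches P (?a + 1, s) (?a + 1 + code_size c, t)"
    using exec_IfTrue.IH[of "us @ [ITest r x (?a + 1) (?a + code_size c + 2)]"] exec_IfTrue.prems by simp
  moreover have "reaches P (?a + 1 + code_size c, t) (?e, t)"
    using exec_IfTrue.prems
    by (intro reaches_test[where us="us @ ITest r x (?a + 1) (?a + code_size c + 2) # compile c (?a + 1)"]) auto
  ultimately have "reaches P (?a, s) (?e, t)"
    using reaches_trans by blast
  then show ?case by (simp add: add.assoc)
next
  case (exec_IfFalse s r x d t c)
  let ?a = "length us"
  have "reaches P (?a, s) (?a + code_size c + 2, s)"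
    using exec_IfFalse.prems exec_IfFalse.hyps by (intro reaches_test[where us=us]) auto
  moreover have "reaches P (?a + code_size c + 2, s) (?a + code_size c + 2 + code_size d, t)"
    using exec_IfFalse.IH[of "us @ ITest r x (?a + 1) (?a + code_size c + 2) # compile c (?a + 1) @
       [ITest r 0 (?a + code_size c + code_size d + 2) (?a + code_size c + code_size d + 2)]"] exec_IfFalse.prems
    by (simp add: ac_simps)
  ultimately have "reaches P (?a, s) (?a + code_size c + 2 + code_size d, t)"
    by (rule reaches_trans)
  then show ?case by (simp add: ac_simps)
next
  case (exec_WhileEnd s r x c)
  then show ?case by (intro reaches_test[where us=us]) auto
next
  case (exec_WhileStep s r x c s' s'')
  let ?a = "length us"
  have "reaches P (?a, s) (?a + 1, s)"
    using exec_WhileStep.prems exec_WhileStep.hyps by (intro reaches_test[where us=us]) auto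
  moreover have "reaches P (?a + 1, s) (?a + 1 + code_size c, s')"
    using exec_WhileStep.IH(1)[of "us @ [ITest r x (?a + code_size c + 2) (?a + 1)]"] exec_WhileStep.prems by simp
  moreover have "reaches P (?a + 1 + code_size c, s') (?a, s')"
    using exec_WhileStep.prems
    by (intro reaches_test[where us="us @ ITest r x (?a + code_size c + 2) (?a + 1) # compile c (?a + 1)"]) auto
  moreover have "reaches P (?a, s') (?a + code_size (While r x c), s'')"
    using exec_WhileStep.prems by (intro exec_WhileStep.IH(2))
  ultimately show ?case using reaches_trans by blast
qed

section \<open>Jump code as a multi-tape Turing machine\<close>

definition machine :: "nat \<Rightarrow> instr list \<Rightarrow> tm" where
  "machine k P = \<lparr>num_tapes = k, num_symbols = 3, num_states = length P,
     transition = (\<lambda>q xs. case P ! q of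
         IDo r w mv \<Rightarrow> (Suc q, map (\<lambda>i. if i = r then (case w of None \<Rightarrow> xs ! i | Some y \<Rightarrow> y, mv)
                                        else (xs ! i, MoveN)) [0..<k])
       | ITest r x a b \<Rightarrow> (min (length P) (if xs ! r = x then a else b), map (\<lambda>i. (xs ! i, MoveN)) [0..<k]))\<rparr>"

lemma machine_simps [simp]: "num_tapes (machine k P) = k" "num_states (machine k P) = length P"
  by (simp_all add: machine_def)

lemma turing_machine_machine:
  assumes "2 \<le> k" "\<And>i. i \<in> set P \<Longrightarrow> wf_instr k i"
  shows "turing_machine (machine k P)"
proof -
  have "fst (transition (machine k P) q xs) \<le> length P \<and>
        length (snd (transition (machine k P) q xs)) = k \<and>
        fst ` set (snd (transition (machine k P) q xs)) \<subseteq> {..<3}"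
    if "q < length P" "length xs = k" "set xs \<subseteq> {..<3}" for q xs
  proof -
    have "xs ! i < 3" if "i < k" for i
      using that \<open>length xs = k\<close> \<open>set xs \<subseteq> {..<3}\<close> by (metis lessThan_iff nth_mem subsetD)
    moreover have "wf_instr k (P ! q)" using that(1) assms(2) by simp
    ultimately show ?thesis
      using that(1) by (cases "P ! q") (auto simp: machine_def split: option.split)
  qed
  then show ?thesis using assms(1) by (auto simp: turing_machine_def machine_def)
qed

lemma act_symbol [simp]: "act (symbol X, MoveN) X = X"
  by (cases X) simp

lemma symbol_case: "(\<lambda>(T, h). T h) = symbol"
  by (auto simp: fun_eq_iff)

lemma tm_step_machine:
  assumes "\<And>i. i \<in> set P \<Longrightarrow> wf_instr k i" and that: "q \<le> length P"
  shows "tm_step (machine k P) (q, map s [0..<k]) =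
    (let (q', s') = instr_step P (q, s) in (q', map s' [0..<k]))"
proof (cases "q = length P")
  case True
  then show ?thesis by (simp add: machine_def)
next
  case False
  then have q: "q < length P" using that by simp
  then have wf: "wf_instr k (P ! q)" using assms by simp
  show ?thesis
  proof (cases "P ! q")
    case (IDo r w mv)
    show ?thesis
      using q IDo wf
      by (auto simp: machine_def symbol_case list_eq_iff_nth_eq split: option.split)
  next
    case (ITest r x a b)
    show ?thesis
      using q ITest wf by (auto simp: machine_def symbol_case list_eq_iff_nth_eq)
  qed
qed

lemma instr_step_bound: "q \<le> length P \<Longrightarrow> fst (instr_step P (q, s)) \<le> length P"
  by (auto split: instr.split)

lemma tm_steps_machine:
  assumes "\<And>i. i \<in> set P \<Longrightarrow> wf_instr k i" "q \<le> length P"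
  shows "(tm_step (machine k P) ^^ t) (q, map s [0..<k]) =
      (let (q', s') = (instr_step P ^^ t) (q, s) in (q', map s' [0..<k])) \<and>
    fst ((instr_step P ^^ t) (q, s)) \<le> length P"
proof (induction t)
  case 0
  then show ?case using assms(2) by simp
next
  case (Suc t)
  obtain q' s' where qs: "(instr_step P ^^ t) (q, s) = (q', s')" by fastforce
  with Suc have le: "q' \<le> length P" by simp
  have "tm_step (machine k P) (q', map s' [0..<k]) =
    (let (q', s') = instr_step P (q', s') in (q', map s' [0..<k]))"
    using tm_step_machine[OF assms(1) le] .
  moreover have "(tm_step (machine k P) ^^ t) (q, map s [0..<k]) = (q', map s' [0..<k])"
    using Suc qs by simp
  moreover have "fst (instr_step P (q', s')) \<le> length P"
    using instr_step_bound[OF le] .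
  ultimately show ?case by (simp only: funpow.simps comp_apply qs simp_thms)
qed

definition initial_store :: "bool list \<Rightarrow> store" where
  "initial_store w i = (word_cells (if i = 0 then w else []), 0)"

theorem turing_computableI:
  assumes "wf_com k c" "2 \<le> k"
    and "\<And>w. \<exists>s. exec c (initial_store w) s \<and> fst (s 1) = word_cells (f w)"
  shows "turing_computable f"
  unfolding turing_computable_def
proof (intro exI conjI allI)
  let ?P = "compile c 0"
  have wf: "\<And>i. i \<in> set ?P \<Longrightarrow> wf_instr k i" using wf_compile[OF assms(1)] .
  show "turing_machine (machine k ?P)"
    using turing_machine_machine[OF assms(2) wf] .
  fix w
  obtain s where s: "exec c (initial_store w) s" "fst (s 1) = word_cells (f w)" using assms(3) by blast
  from reaches_compile[OF s(1), of ?P "[]" "[]"] obtain t where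
    t: "(instr_step ?P ^^ t) (0, initial_store w) = (code_size c, s)" by (auto simp: reaches_def)
  have "initial_config (machine k ?P) w = (0, map (initial_store w) [0..<k])"
    using assms(2) by (auto simp: initial_config_def initial_store_def list_eq_iff_nth_eq nth_Cons')
  moreover have "(tm_step (machine k ?P) ^^ t) (0, map (initial_store w) [0..<k]) = (code_size c, map s [0..<k])"
    using tm_steps_machine[where P="?P" and q=0 and t=t and s="initial_store w", OF wf] unfolding t by simp
  moreover have "fst (map s [0..<k] ! 1) = word_cells (f w)"
    using s(2) assms(2) by simp
  ultimately show "halts_with (machine k ?P) w (f w)"
    unfolding halts_with_def machine_simps length_compile by metis
qed

section \<open>Counters and primitive recursive functions\<close>

text \<open>A counter is the head position on a tape whose only nonblank cell is cell \<open>0\<close>.\<close>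

definition ctr :: "nat \<Rightarrow> tape" where
  "ctr v = (\<lambda>i. if i = 0 then 1 else 0, int v)"

text \<open>Counters written over a fixed \<open>s\<close> build the frame condition into every
  statement about executions: tapes outside the block are literally those of
  \<open>s\<close>.\<close>

definition store_ctrs :: "nat \<Rightarrow> nat list \<Rightarrow> store \<Rightarrow> store" where
  "store_ctrs b vs s = (\<lambda>r. if b \<le> r \<and> r < b + length vs then ctr (vs ! (r - b)) else s r)"

lemma symbol_ctr [simp]: "symbol (ctr v) = (if v = 0 then 1 else 0)"
  by (simp add: ctr_def)

lemma store_ctrs_nth [simp]: "i < length vs \<Longrightarrow> store_ctrs b vs s (b + i) = ctr (vs ! i)"
  by (simp add: store_ctrs_def)

lemma store_ctrs_append: "store_ctrs b (us @ vs) s = store_ctrs b us (store_ctrs (b + length us) vs s)"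
  by (auto simp: store_ctrs_def fun_eq_iff nth_append add.assoc intro!: arg_cong[of _ _ ctr] arg_cong2[of _ _ _ _ nth])

lemma store_ctrs_swap: "b + length us \<le> c \<Longrightarrow>
   store_ctrs b us (store_ctrs c vs s) = store_ctrs c vs (store_ctrs b us s)"
  by (auto simp: store_ctrs_def fun_eq_iff)

abbreviation inc :: "nat \<Rightarrow> com" where "inc r \<equiv> Do r None MoveR"
abbreviation dec :: "nat \<Rightarrow> com" where "dec r \<equiv> Do r None MoveL"
abbreviation loop :: "nat \<Rightarrow> com \<Rightarrow> com" where "loop r c \<equiv> While r (Suc 0) c"

lemma exec_inc:
  assumes "i < length vs" "r = b + i" "vs' = vs[i := Suc (vs ! i)]"
  shows "exec (inc r) (store_ctrs b vs s) (store_ctrs b vs' s)"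
proof -
  have "(store_ctrs b vs s)(r := do_tape None MoveR (store_ctrs b vs s r)) = store_ctrs b vs' s"
    using assms by (auto simp: fun_eq_iff store_ctrs_def ctr_def nth_list_update)
  then show ?thesis using exec_Do by metis
qed

lemma exec_dec:
  assumes "i < length vs" "r = b + i" "vs ! i = Suc x" "vs' = vs[i := x]"
  shows "exec (dec r) (store_ctrs b vs s) (store_ctrs b vs' s)"
proof -
  have "(store_ctrs b vs s)(r := do_tape None MoveL (store_ctrs b vs s r)) = store_ctrs b vs' s"
    using assms by (auto simp: fun_eq_iff store_ctrs_def ctr_def nth_list_update)
  then show ?thesis using exec_Do by metis
qed

lemmas exec_inc' = exec_inc[OF _ _ refl]
lemmas exec_dec' = exec_dec[OF _ _ _ refl]

lemma exec_cong: "exec c s t \<Longrightarrow> t = t' \<Longrightarrow> exec c s t'"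
  by simp

lemma exec_loop_end:
  "i < length vs \<Longrightarrow> r = b + i \<Longrightarrow> vs ! i = 0 \<Longrightarrow> exec (loop r c) (store_ctrs b vs s) (store_ctrs b vs s)"
  by (rule exec_WhileEnd) simp

lemma exec_loop_step:
  "i < length vs \<Longrightarrow> r = b + i \<Longrightarrow> vs ! i \<noteq> 0 \<Longrightarrow> exec c (store_ctrs b vs s) s' \<Longrightarrow>
    exec (loop r c) s' s'' \<Longrightarrow> exec (loop r c) (store_ctrs b vs s) s''"
  by (rule exec_WhileStep) simp_all

lemma exec_if_zero:
  "i < length vs \<Longrightarrow> r = b + i \<Longrightarrow> vs ! i = 0 \<Longrightarrow> exec c (store_ctrs b vs s) t \<Longrightarrow>
   exec (If r (Suc 0) c d) (store_ctrs b vs s) t"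
  by (rule exec_IfTrue) simp_all

lemma exec_if_nonzero:
  "i < length vs \<Longrightarrow> r = b + i \<Longrightarrow> vs ! i \<noteq> 0 \<Longrightarrow> exec d (store_ctrs b vs s) t \<Longrightarrow>
   exec (If r (Suc 0) c d) (store_ctrs b vs s) t"
  by (rule exec_IfFalse) simp_all

definition clear :: "nat \<Rightarrow> com" where
  "clear r = loop r (dec r)"

definition move :: "nat \<Rightarrow> nat \<Rightarrow> com" where
  "move r r' = loop r (dec r ;; inc r')"

text \<open>Copying destroys the source. Two copies are made, so that one can be moved back when the
  original is still needed.\<close>

definition move2 :: "nat \<Rightarrow> nat \<Rightarrow> nat \<Rightarrow> com" where
  "move2 r r' r'' = loop r (dec r ;; inc r' ;; inc r'')"

lemma exec_clear:
  assumes "i < length vs" "r = b + i" "vs' = vs[i := 0]"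
  shows "exec (clear r) (store_ctrs b vs s) (store_ctrs b vs' s)"
proof -
  have "exec (clear r) (store_ctrs b (vs[i := x]) s) (store_ctrs b vs' s)" for x
  proof (induction x)
    case 0
    show ?case using assms unfolding clear_def by (auto intro!: exec_loop_end[where i=i])
  next
    case (Suc x)
    show ?case unfolding clear_def
      by (rule exec_loop_step[where i=i, OF _ _ _ exec_dec[where i=i and x=x] Suc[unfolded clear_def]])
        (use assms in simp_all)
  qed
  from this[of "vs ! i"] show ?thesis by simp
qed

lemma exec_move:
  assumes "i < length vs" "j < length vs" "i \<noteq> j" "r = b + i" "r' = b + j"
    and "vs' = vs[i := 0, j := vs ! i + vs ! j]"
  shows "exec (move r r') (store_ctrs b vs s) (store_ctrs b vs' s)"
proof -
  have "exec (move r r') (store_ctrs b (vs[i := x, j := y]) s) (store_ctrs b (vs[i := 0, j := x + y]) s)" for x y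
  proof (induction x arbitrary: y)
    case 0
    show ?case using assms unfolding move_def by (auto intro!: exec_loop_end[where i=i])
  next
    case (Suc x)
    have "exec (dec r ;; inc r') (store_ctrs b (vs[i := Suc x, j := y]) s) (store_ctrs b (vs[i := x, j := Suc y]) s)"
      by (rule exec_cong[OF exec_Seq[OF exec_dec'[where i=i and x=x] exec_inc'[where i=j]]])
        (use assms in \<open>simp_all add: list_update_swap\<close>)
    from exec_loop_step[where i=i, OF _ _ _ this] Suc[of "Suc y"] show ?case
      using assms unfolding move_def by simp
  qed
  from this[of "vs ! i" "vs ! j"] assms(6) show ?thesis by simp
qed

lemma exec_move2:
  assumes "i < length vs" "j < length vs" "l < length vs" "i \<noteq> j" "i \<noteq> l" "j \<noteq> l"
    and "r = b + i" "r' = b + j" "r'' = b + l"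
    and "vs' = vs[i := 0, j := vs ! i + vs ! j, l := vs ! i + vs ! l]"
  shows "exec (move2 r r' r'') (store_ctrs b vs s) (store_ctrs b vs' s)"
proof -
  have "exec (move2 r r' r'') (store_ctrs b (vs[i := x, j := y, l := z]) s)
          (store_ctrs b (vs[i := 0, j := x + y, l := x + z]) s)" for x y z
  proof (induction x arbitrary: y z)
    case 0
    show ?case using assms unfolding move2_def by (auto intro!: exec_loop_end[where i=i])
  next
    case (Suc x)
    have "exec (dec r ;; inc r' ;; inc r'') (store_ctrs b (vs[i := Suc x, j := y, l := z]) s)
            (store_ctrs b (vs[i := x, j := Suc y, l := Suc z]) s)"
      by (rule exec_cong[OF exec_Seq[OF exec_dec'[where i=i and x=x] exec_Seq[OF exec_inc'[where i=j] exec_inc'[where i=l]]]])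
        (use assms in \<open>simp_all add: list_update_swap[of j l] list_update_swap[of i l] list_update_swap[of i j]\<close>)
    from exec_loop_step[where i=i, OF _ _ _ this] Suc[of "Suc y" "Suc z"] show ?case
      using assms unfolding move2_def by simp
  qed
  from this[of "vs ! i" "vs ! j" "vs ! l"] assms(10) show ?thesis by simp
qed

lemmas exec_clear' = exec_clear[OF _ _ refl]
lemmas exec_move' = exec_move[OF _ _ _ _ _ refl]
lemmas exec_move2' = exec_move2[OF _ _ _ _ _ _ _ _ _ refl]

text \<open>Scratch counters are zero on entry and on exit, so successive programs can share them;
  the free base \<open>b\<close> lets a program act at any position of a larger block.\<close>

definition computes :: "(nat \<Rightarrow> com) \<Rightarrow> nat \<Rightarrow> (nat \<Rightarrow> nat) \<Rightarrow> bool" where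
  "computes c k f \<longleftrightarrow> (\<forall>b. wf_com (Suc (b + k)) (c b) \<and>
     (\<forall>x s. exec (c b) (store_ctrs b (x # replicate k 0) s) (store_ctrs b (f x # replicate k 0) s)))"

lemma computes_at:
  assumes "computes c k f" "k \<le> j" "r = b + length us"
  shows "exec (c r) (store_ctrs b (us @ x # replicate j 0) s) (store_ctrs b (us @ f x # replicate j 0) s)"
proof -
  have "store_ctrs b (us @ y # replicate j 0) s =
      store_ctrs r (y # replicate k 0) (store_ctrs b us (store_ctrs (r + Suc k) (replicate (j - k) 0) s))" for y
  proof -
    have "us @ y # replicate j 0 = us @ (y # replicate k 0) @ replicate (j - k) (0::nat)"
      using assms(2) replicate_add[of k "j - k" "0::nat"] by simp
    then show ?thesis
      by (simp only: store_ctrs_append assms(3)) (subst store_ctrs_swap, simp_all)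
  qed
  then show ?thesis using assms(1) unfolding computes_def by simp
qed

lemma computes_wf: "computes c k f \<Longrightarrow> b + k < m \<Longrightarrow> wf_com m (c b)"
  unfolding computes_def using wf_com_mono Suc_leI by blast

definition decode_com :: "nat \<Rightarrow> com" where
  "decode_com b = loop b (dec b ;;
     If (b + 2) (Suc 0) (move (b + 1) (b + 2) ;; inc (b + 2)) (dec (b + 2) ;; inc (b + 1)))"

text \<open>The first loop adds \<open>p\<close> to the result and to \<open>q\<close>; the second
  adds \<open>n + (n - 1) + \<dots> + 1\<close> for \<open>n = p + q\<close>, the triangular number
  in Cantor's pairing.\<close>

definition encode_com :: "nat \<Rightarrow> com" where
  "encode_com b = loop (b + 1) (dec (b + 1) ;; inc (b + 2) ;; inc b) ;;
     loop (b + 2) (move2 (b + 2) (b + 3) b ;; move (b + 3) (b + 2) ;; dec (b + 2))"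

text \<open>Cantor's enumeration walks along antidiagonals and starts the next one when the second
  component is exhausted. Decoding is counting along this walk, without search or division.\<close>

lemma prod_decode_Suc:
  "prod_decode (Suc n) = (case prod_decode n of (p, q) \<Rightarrow> if q = 0 then (0, Suc p) else (Suc p, q - 1))"
proof -
  obtain p q where pq: "prod_decode n = (p, q)" by fastforce
  then have "n = prod_encode (p, q)" by (metis prod_decode_inverse)
  then have "Suc n = prod_encode (if q = 0 then (0, Suc p) else (Suc p, q - 1))"
    by (auto simp: prod_encode_def gr0_conv_Suc)
  then show ?thesis by (simp only: pq prod_encode_inverse prod.case)
qed

lemma exec_decode_com:
  assumes "prod_decode x = (p, q)"
  shows "exec (decode_com b) (store_ctrs b (x # 0 # 0 # vs) s) (store_ctrs b (0 # p # q # vs) s)"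
proof -
  have "exec (decode_com b) (store_ctrs b (x # fst (prod_decode m) # snd (prod_decode m) # vs) s)
     (store_ctrs b (0 # fst (prod_decode (m + x)) # snd (prod_decode (m + x)) # vs) s)" for m
  proof (induction x arbitrary: m)
    case 0
    show ?case unfolding decode_com_def by (auto intro!: exec_loop_end[where i=0])
  next
    case (Suc x)
    obtain p q where pq: "prod_decode m = (p, q)" by fastforce
    have body: "exec (dec b ;; If (b + 2) (Suc 0) (move (b + 1) (b + 2) ;; inc (b + 2)) (dec (b + 2) ;; inc (b + 1)))
       (store_ctrs b (Suc x # p # q # vs) s)
       (store_ctrs b (x # fst (prod_decode (Suc m)) # snd (prod_decode (Suc m)) # vs) s)"
    proof (cases q)
      case 0
      show ?thesis
        by (rule exec_cong[OF exec_Seq[OF exec_dec'[where i=0 and x=x] exec_if_zero[where i=2, OF _ _ _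
              exec_Seq[OF exec_move'[where i=1 and j=2] exec_inc'[where i=2]]]]])
          (simp_all add: pq 0 prod_decode_Suc numeral_2_eq_2)
    next
      case (Suc q')
      show ?thesis
        by (rule exec_cong[OF exec_Seq[OF exec_dec'[where i=0 and x=x] exec_if_nonzero[where i=2, OF _ _ _
              exec_Seq[OF exec_dec'[where i=2 and x=q'] exec_inc'[where i=1]]]]])
          (simp_all add: pq Suc prod_decode_Suc numeral_2_eq_2)
    qed
    from exec_loop_step[where i=0, OF _ _ _ body] Suc[of "Suc m"] show ?case
      unfolding decode_com_def by (simp add: pq)
  qed
  from this[of 0] assms show ?thesis by (simp add: prod_decode_def prod_decode_aux.simps)
qed

lemma exec_encode_com:
  "exec (encode_com b) (store_ctrs b (0 # p # q # 0 # vs) s)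
     (store_ctrs b (prod_encode (p, q) # 0 # 0 # 0 # vs) s)"
proof -
  have 1: "exec (loop (b + 1) (dec (b + 1) ;; inc (b + 2) ;; inc b)) (store_ctrs b (m # p # q # 0 # vs) s)
      (store_ctrs b ((m + p) # 0 # (p + q) # 0 # vs) s)" for m
  proof (induction p arbitrary: m q)
    case 0
    show ?case by (auto intro!: exec_loop_end[where i=1])
  next
    case (Suc p)
    have body: "exec (dec (b + 1) ;; inc (b + 2) ;; inc b) (store_ctrs b (m # Suc p # q # 0 # vs) s)
      (store_ctrs b (Suc m # p # Suc q # 0 # vs) s)"
      by (rule exec_cong[OF exec_Seq[OF exec_dec'[where i=1 and x=p] exec_Seq[OF exec_inc'[where i=2] exec_inc'[where i=0]]]])
        (simp_all add: numeral_2_eq_2)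
    from exec_loop_step[where i=1, OF _ _ _ body] Suc[of "Suc m" "Suc q"] show ?case by simp
  qed
  have 2: "exec (loop (b + 2) (move2 (b + 2) (b + 3) b ;; move (b + 3) (b + 2) ;; dec (b + 2)))
     (store_ctrs b (m # 0 # n # 0 # vs) s) (store_ctrs b ((m + triangle n) # 0 # 0 # 0 # vs) s)" for m n
  proof (induction n arbitrary: m)
    case 0
    show ?case by (auto intro!: exec_loop_end[where i=2])
  next
    case (Suc n)
    have body: "exec (move2 (b + 2) (b + 3) b ;; move (b + 3) (b + 2) ;; dec (b + 2))
      (store_ctrs b (m # 0 # Suc n # 0 # vs) s) (store_ctrs b ((m + Suc n) # 0 # n # 0 # vs) s)"
      by (rule exec_cong[OF exec_Seq[OF exec_move2'[where i=2 and j=3 and l=0]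
            exec_Seq[OF exec_move'[where i=3 and j=2] exec_dec'[where i=2 and x=n]]]])
        (simp_all add: numeral_2_eq_2 numeral_3_eq_3 add.commute)
    from exec_loop_step[where i=2, OF _ _ _ body] Suc[of "m + Suc n"] show ?case
      by (simp add: ac_simps)
  qed
  show ?thesis
    unfolding encode_com_def prod_encode_def
    using exec_Seq[OF 1[of 0, unfolded add_0] 2[of p "p + q"]] by (simp add: add.commute)
qed

text \<open>The primitive recursive functions of one argument: pairing replaces further arguments,
  and iteration replaces recursion, because a loop index can be carried along in a pair.\<close>

inductive pr :: "(nat \<Rightarrow> nat) \<Rightarrow> bool" where
  pr_id: "pr (\<lambda>x. x)"
| pr_zero: "pr (\<lambda>x. 0)"
| pr_Suc: "pr Suc"
| pr_fst: "pr (\<lambda>x. fst (prod_decode x))"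
| pr_snd: "pr (\<lambda>x. snd (prod_decode x))"
| pr_pair: "pr f \<Longrightarrow> pr g \<Longrightarrow> pr (\<lambda>x. prod_encode (f x, g x))"
| pr_comp: "pr f \<Longrightarrow> pr g \<Longrightarrow> pr (\<lambda>x. f (g x))"
| pr_iter: "pr f \<Longrightarrow> pr (\<lambda>x. (f ^^ fst (prod_decode x)) (snd (prod_decode x)))"

lemmas wf_simps = clear_def move_def move2_def encode_com_def decode_com_def

lemma pr_computes: "pr f \<Longrightarrow> \<exists>c k. computes c k f"
proof (induction rule: pr.induct)
  case pr_id
  have "computes (\<lambda>b. inc b ;; dec b) 0 (\<lambda>x. x)"
    unfolding computes_def
    by (auto intro!: exec_cong[OF exec_Seq[OF exec_inc'[where i=0] exec_dec'[where i=0]]])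
  then show ?case by blast
next
  case pr_zero
  have "computes clear 0 (\<lambda>x. 0)"
    unfolding computes_def by (auto simp: clear_def[of b for b] intro!: exec_clear[where i=0, unfolded clear_def])
  then show ?case by blast
next
  case pr_Suc
  have "computes inc 0 Suc"
    unfolding computes_def by (auto intro!: exec_inc[where i=0])
  then show ?case by blast
next
  case pr_fst
  have "computes (\<lambda>b. decode_com b ;; clear (b + 2) ;; move (b + 1) b) 2 (\<lambda>x. fst (prod_decode x))"
    unfolding computes_def
  proof (intro allI conjI)
    fix b x s
    obtain p q where "prod_decode x = (p, q)" by fastforce
    then show "exec (decode_com b ;; clear (b + 2) ;; move (b + 1) b) (store_ctrs b (x # replicate 2 0) s)
      (store_ctrs b (fst (prod_decode x) # replicate 2 0) s)"
      using exec_Seq[OF exec_decode_com[of x p q b "[]" s] exec_Seq[OF exec_clear'[where i=2 and vs="[0, p, q]"]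
        exec_move'[where i=1 and j=0]]] by (simp add: numeral_2_eq_2)
  qed (simp add: wf_simps)
  then show ?case by blast
next
  case pr_snd
  have "computes (\<lambda>b. decode_com b ;; clear (b + 1) ;; move (b + 2) b) 2 (\<lambda>x. snd (prod_decode x))"
    unfolding computes_def
  proof (intro allI conjI)
    fix b x s
    obtain p q where "prod_decode x = (p, q)" by fastforce
    then show "exec (decode_com b ;; clear (b + 1) ;; move (b + 2) b) (store_ctrs b (x # replicate 2 0) s)
      (store_ctrs b (snd (prod_decode x) # replicate 2 0) s)"
      using exec_Seq[OF exec_decode_com[of x p q b "[]" s] exec_Seq[OF exec_clear'[where i=1 and vs="[0, p, q]"]
        exec_move'[where i=2 and j=0]]] by (simp add: numeral_2_eq_2)
  qed (simp add: wf_simps)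
  then show ?case by blast
next
  case (pr_pair f g)
  then obtain c k d l where cd: "computes c k f" "computes d l g" by blast
  let ?m = "k + l"
  let ?c = "\<lambda>b. move2 b (b + 1) (b + 2) ;; d (b + 2) ;; move (b + 2) b ;; c (b + 1) ;; move b (b + 2) ;; encode_com b"
  have "computes ?c (?m + 3) (\<lambda>x. prod_encode (f x, g x))"
    unfolding computes_def
  proof (intro allI conjI)
    fix b x s
    let ?R = "\<lambda>vs. store_ctrs b (vs @ replicate (Suc ?m) 0) s"
    have "exec (move2 b (b + 1) (b + 2)) (?R [x, 0, 0]) (?R [0, x, x])"
      by (rule exec_move2[where i=0 and j=1 and l=2]) (simp_all add: numeral_2_eq_2)
    moreover have "exec (d (b + 2)) (?R [0, x, x]) (?R [0, x, g x])"
      using computes_at[OF cd(2), of "Suc ?m" _ b "[0, x]" x s] by simp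
    moreover have "exec (move (b + 2) b) (?R [0, x, g x]) (?R [g x, x, 0])"
      by (rule exec_move[where i=2 and j=0]) (simp_all add: numeral_2_eq_2)
    moreover have "exec (c (b + 1)) (?R [g x, x, 0]) (?R [g x, f x, 0])"
      using computes_at[OF cd(1), of "Suc (Suc ?m)" _ b "[g x]" x s] by simp
    moreover have "exec (move b (b + 2)) (?R [g x, f x, 0]) (?R [0, f x, g x])"
      by (rule exec_move[where i=0 and j=2]) (simp_all add: numeral_2_eq_2)
    moreover have "exec (encode_com b) (?R [0, f x, g x]) (?R [prod_encode (f x, g x), 0, 0])"
      using exec_encode_com[of b "f x" "g x" "replicate ?m 0" s] by simp
    ultimately have "exec (?c b) (?R [x, 0, 0]) (?R [prod_encode (f x, g x), 0, 0])"
      by (intro exec_Seq)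
    then show "exec (?c b) (store_ctrs b (x # replicate (?m + 3) 0) s)
        (store_ctrs b (prod_encode (f x, g x) # replicate (?m + 3) 0) s)"
      by (simp add: numeral_3_eq_3)
  next
    fix b
    show "wf_com (Suc (b + (?m + 3))) (?c b)"
      using computes_wf[OF cd(1), of "b + 1"] computes_wf[OF cd(2), of "b + 2"] by (simp add: wf_simps)
  qed
  then show ?case by blast
next
  case (pr_comp f g)
  then obtain c k d l where cd: "computes c k f" "computes d l g" by blast
  have "computes (\<lambda>b. d b ;; c b) (k + l) (\<lambda>x. f (g x))"
    unfolding computes_def
  proof (intro allI conjI)
    fix b x s
    show "exec (d b ;; c b) (store_ctrs b (x # replicate (k + l) 0) s) (store_ctrs b (f (g x) # replicate (k + l) 0) s)"
      using exec_Seq[OF computes_at[OF cd(2), of "k + l" b b "[]" x s] computes_at[OF cd(1), of "k + l" b b "[]" "g x" s]]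
      by simp
  next
    fix b
    show "wf_com (Suc (b + (k + l))) (d b ;; c b)"
      using computes_wf[OF cd(1), of b] computes_wf[OF cd(2), of b] by simp
  qed
  then show ?case by blast
next
  case (pr_iter f)
  then obtain c k where c: "computes c k f" by blast
  let ?c = "\<lambda>b. decode_com b ;; loop (b + 1) (dec (b + 1) ;; c (b + 2)) ;; move (b + 2) b"
  have "computes ?c (k + 2) (\<lambda>x. (f ^^ fst (prod_decode x)) (snd (prod_decode x)))"
    unfolding computes_def
  proof (intro allI conjI)
    fix b x s
    obtain p q where pq: "prod_decode x = (p, q)" by fastforce
    let ?R = "\<lambda>vs. store_ctrs b (vs @ replicate k 0) s"
    have "exec (decode_com b) (?R [x, 0, 0]) (?R [0, p, q])"
      using exec_decode_com[OF pq, of b "replicate k 0" s] by simp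
    moreover have "exec (loop (b + 1) (dec (b + 1) ;; c (b + 2))) (?R [0, p, q]) (?R [0, 0, (f ^^ p) q])"
    proof (induction p arbitrary: q)
      case 0
      show ?case by (auto intro!: exec_loop_end[where i=1])
    next
      case (Suc p)
      have "exec (dec (b + 1)) (?R [0, Suc p, q]) (?R [0, p, q])"
        by (rule exec_dec[where i=1 and x=p]) simp_all
      moreover have "exec (c (b + 2)) (?R [0, p, q]) (?R [0, p, f q])"
        using computes_at[OF c, of k _ b "[0, p]" q s] by simp
      ultimately have body: "exec (dec (b + 1) ;; c (b + 2)) (?R [0, Suc p, q]) (?R [0, p, f q])"
        by (rule exec_Seq)
      show ?case
        by (rule exec_loop_step[where i=1, OF _ _ _ body]) (use Suc[of "f q"] in \<open>simp_all add: funpow_swap1\<close>)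
    qed
    moreover have "exec (move (b + 2) b) (?R [0, 0, (f ^^ p) q]) (?R [(f ^^ p) q, 0, 0])"
      by (rule exec_move[where i=2 and j=0]) (simp_all add: numeral_2_eq_2)
    ultimately have "exec (?c b) (?R [x, 0, 0]) (?R [(f ^^ p) q, 0, 0])"
      by (intro exec_Seq)
    then show "exec (?c b) (store_ctrs b (x # replicate (k + 2) 0) s)
        (store_ctrs b ((f ^^ fst (prod_decode x)) (snd (prod_decode x)) # replicate (k + 2) 0) s)"
      by (simp add: pq numeral_2_eq_2)
  next
    fix b
    show "wf_com (Suc (b + (k + 2))) (?c b)"
      using computes_wf[OF c, of "b + 2"] by (simp add: wf_simps)
  qed
  then show ?case by blast
qed

section \<open>Arithmetic by iteration\<close>

lemma pr_const: "pr (\<lambda>x. n)"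
  by (induction n) (use pr_zero pr_comp[OF pr_Suc] in auto)

lemma pr_iterate:
  assumes "pr f" "pr n" "pr a"
  shows "pr (\<lambda>x. (f ^^ n x) (a x))"
  using pr_comp[OF pr_iter[OF assms(1)] pr_pair[OF assms(2,3)]] by simp

text \<open>Kleene's predecessor: iterate \<open>(p, q) \<mapsto> (q, q + 1)\<close> from
  \<open>(0, 0)\<close>; the first component lags one step behind.\<close>

lemma pr_pred: "pr (\<lambda>x. x - 1)"
proof -
  let ?f = "\<lambda>z. prod_encode (snd (prod_decode z), Suc (snd (prod_decode z)))"
  have pf: "pr ?f" by (intro pr_pair pr_comp[OF pr_Suc] pr_snd)
  have "pr (\<lambda>x. fst (prod_decode ((?f ^^ x) (prod_encode (0, 0)))))"
    by (intro pr_comp[OF pr_fst] pr_iterate[OF pf] pr_id pr_const)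
  moreover have "(?f ^^ x) (prod_encode (0, 0)) = prod_encode (x - 1, x)" for x
    by (induction x) auto
  ultimately show ?thesis by simp
qed

text \<open>The step \<open>(a, b) \<mapsto> (b, b)\<close> is iterated \<open>c x\<close> times:
  zero iterations keep \<open>a\<close>, any positive number yields \<open>b\<close>.\<close>

lemma pr_if:
  assumes "pr c" "pr f" "pr g"
  shows "pr (\<lambda>x. if c x = 0 then f x else g x)"
proof -
  let ?f = "\<lambda>z. prod_encode (snd (prod_decode z), snd (prod_decode z))"
  have pf: "pr ?f" by (intro pr_pair pr_snd)
  have "pr (\<lambda>x. fst (prod_decode ((?f ^^ c x) (prod_encode (f x, g x)))))"
    by (intro pr_comp[OF pr_fst] pr_iterate[OF pf] assms pr_pair)
  moreover have "fst (prod_decode ((?f ^^ n) (prod_encode (a, b)))) = (if n = 0 then a else b)" for n a b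
  proof (cases n)
    case (Suc m)
    have "(?f ^^ Suc m) (prod_encode (a, b)) = prod_encode (b, b)" for m
      by (induction m) auto
    with Suc show ?thesis by (simp del: funpow.simps)
  qed simp
  ultimately show ?thesis by simp
qed

lemma pr_plus:
  assumes "pr f" "pr g" shows "pr (\<lambda>x. f x + g x)"
proof -
  have "(Suc ^^ n) m = n + m" for n m by (induction n) auto
  then show ?thesis using pr_iterate[OF pr_Suc assms] by simp
qed

lemma pr_minus:
  assumes "pr f" "pr g" shows "pr (\<lambda>x. f x - g x)"
proof -
  have "((\<lambda>x. x - 1) ^^ n) m = m - n" for n m :: nat by (induction n) auto
  then show ?thesis using pr_iterate[OF pr_pred assms(2,1)] by simp
qed

lemma pr_times:
  assumes "pr f" "pr g" shows "pr (\<lambda>x. f x * g x)"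
proof -
  let ?f = "\<lambda>z. prod_encode (fst (prod_decode z), fst (prod_decode z) + snd (prod_decode z))"
  have pf: "pr ?f" by (intro pr_pair pr_plus pr_fst pr_snd)
  have "pr (\<lambda>x. snd (prod_decode ((?f ^^ f x) (prod_encode (g x, 0)))))"
    by (intro pr_comp[OF pr_snd] pr_iterate[OF pf] assms pr_pair pr_const)
  moreover have "(?f ^^ n) (prod_encode (m, 0)) = prod_encode (m, n * m)" for n m
    by (induction n) auto
  ultimately show ?thesis by simp
qed


subsection \<open>Input and output\<close>

abbreviation bits_encode :: "bool list \<Rightarrow> nat" where
  "bits_encode w \<equiv> list_encode (map of_bool w)"

text \<open>Tapes \<open>0\<close> and \<open>1\<close> belong to input and output. A blank work
  tape becomes a counter of value zero once cell \<open>0\<close> is marked.\<close>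

primrec init_com :: "nat \<Rightarrow> com" where
  "init_com 0 = Do 0 None MoveN"
| "init_com (Suc k) = init_com k ;; Do (2 + k) (Some 1) MoveN"

lemma wf_init_com: "2 + k \<le> m \<Longrightarrow> wf_com m (init_com k)"
  by (induction k) auto

lemma exec_init_com: "exec (init_com k) (initial_store w) (store_ctrs 2 (replicate k 0) (initial_store w))"
proof (induction k)
  case 0
  have "(initial_store w)(0 := do_tape None MoveN (initial_store w 0)) = store_ctrs 2 [] (initial_store w)"
    by (auto simp add: store_ctrs_def fun_eq_iff)
  then show ?case using exec_Do by (metis init_com.simps(1) replicate_0)
next
  case (Suc k)
  let ?s = "store_ctrs 2 (replicate k 0) (initial_store w)"
  have "?s(2 + k := do_tape (Some 1) MoveN (?s (2 + k))) = store_ctrs 2 (replicate (Suc k) 0) (initial_store w)"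
    by (auto simp: store_ctrs_def fun_eq_iff initial_store_def ctr_def word_cells_def nth_Cons' simp flip: replicate_Suc)
  then have "exec (Do (2 + k) (Some 1) MoveN) ?s (store_ctrs 2 (replicate (Suc k) 0) (initial_store w))"
    using exec_Do by metis
  with Suc show ?case unfolding init_com.simps by (rule exec_Seq)
qed

text \<open>Pushing letters onto a list code while reading from left to right reverses the word;
  hence the \<open>rev w\<close> that the primitive recursive function receives.\<close>

definition read_com :: "com \<Rightarrow> com \<Rightarrow> com" where
  "read_com c0 c1 = While 0 0 (If 0 2 c1 c0 ;; Do 0 None MoveR)"

lemma exec_read_com:
  assumes c: "\<And>i x s. exec (c i) (store_ctrs 2 (x # z) s) (store_ctrs 2 (Suc (prod_encode (of_bool i, x)) # z) s)"
  shows "exec (read_com (c False) (c True)) (store_ctrs 2 (0 # z) (initial_store w))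
           (store_ctrs 2 (bits_encode (rev w) # z) ((initial_store w)(0 := (word_cells w, int (length w)))))"
proof -
  let ?T = "\<lambda>i. (initial_store w)(0 := (word_cells w, int i))"
  have "exec (read_com (c False) (c True)) (store_ctrs 2 (bits_encode (rev u) # z) (?T (length u)))
           (store_ctrs 2 (bits_encode (rev w) # z) (?T (length w)))" if "u @ v = w" for u v
    using that
  proof (induction v arbitrary: u)
    case Nil
    have "symbol (store_ctrs 2 (bits_encode (rev w) # z) (?T (length w)) 0) = 0"
      by (simp add: store_ctrs_def word_cells_def)
    moreover have "u = w" using Nil by simp
    ultimately show ?case unfolding read_com_def by (auto intro: exec_WhileEnd simp del: fun_upd_apply)
  next
    case (Cons b v)
    let ?s = "store_ctrs 2 (bits_encode (rev u) # z) (?T (length u))"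
    let ?s' = "store_ctrs 2 (bits_encode (rev (u @ [b])) # z) (?T (length u))"
    have sym: "symbol (?s 0) = (if b then 2 else 1)"
      using Cons.prems by (auto simp: store_ctrs_def word_cells_def)
    have *: "exec (c b) ?s ?s'"
      using c[of b "bits_encode (rev u)"] by simp
    have 1: "exec (If 0 2 (c True) (c False)) ?s ?s'"
    proof (cases b)
      case True
      then show ?thesis using sym * by (intro exec_IfTrue) auto
    next
      case False
      then show ?thesis using sym * by (intro exec_IfFalse) auto
    qed
    have "?s'(0 := do_tape None MoveR (?s' 0)) =
        store_ctrs 2 (bits_encode (rev (u @ [b])) # z) (?T (length (u @ [b])))"
      by (auto simp: store_ctrs_def fun_eq_iff)
    then have 2: "exec (Do 0 None MoveR) ?s' (store_ctrs 2 (bits_encode (rev (u @ [b])) # z) (?T (length (u @ [b]))))"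
      using exec_Do by metis
    have "exec (read_com (c False) (c True))
        (store_ctrs 2 (bits_encode (rev (u @ [b])) # z) (?T (length (u @ [b]))))
        (store_ctrs 2 (bits_encode (rev w) # z) (?T (length w)))"
      using Cons.IH[of "u @ [b]"] Cons.prems by (simp only: append_assoc append_Cons append_Nil)
    from exec_WhileStep[OF _ exec_Seq[OF 1 2] this[unfolded read_com_def]] sym show ?case
      unfolding read_com_def by (simp del: fun_upd_apply split: if_splits)
  qed
  moreover have "?T 0 = initial_store w"
    by (auto simp: initial_store_def fun_eq_iff)
  ultimately show ?thesis by (metis append_Nil list.map(1) list.size(3) list_encode.simps(1) of_nat_0 rev.simps(1))
qed

text \<open>Letters are popped off the list code in counter \<open>2\<close> until it is
  \<open>0\<close>, the code of the empty list. Counter \<open>3\<close> holds a copy for extracting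
  the head; counter \<open>4\<close> only carries the original back.\<close>

definition write_com :: "com \<Rightarrow> com \<Rightarrow> com" where
  "write_com chd ctl = loop 2 (move2 2 3 4 ;; move 4 2 ;; chd ;;
     If 3 (Suc 0) (Do 1 (Some 1) MoveR) (Do 1 (Some 2) MoveR ;; dec 3) ;; ctl)"

lemma word_cells_snoc: "word_cells (u @ [b]) = (word_cells u)(int (length u) := if b then 2 else 1)"
  by (auto simp: word_cells_def fun_eq_iff nth_append)

lemma exec_write_com:
  assumes chd: "\<And>x y s. exec chd (store_ctrs 2 (y # x # 0 # z) s) (store_ctrs 2 (y # fst (prod_decode (x - 1)) # 0 # z) s)"
    and ctl: "\<And>x s. exec ctl (store_ctrs 2 (x # 0 # 0 # z) s) (store_ctrs 2 (snd (prod_decode (x - 1)) # 0 # 0 # z) s)"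
  shows "exec (write_com chd ctl) (store_ctrs 2 (bits_encode v # 0 # 0 # z) (s(1 := (word_cells u, int (length u)))))
           (store_ctrs 2 (0 # 0 # 0 # z) (s(1 := (word_cells (u @ v), int (length (u @ v))))))"
proof (induction v arbitrary: u)
  case Nil
  show ?case unfolding write_com_def using exec_loop_end[of 0] by simp
next
  case (Cons b v)
  let ?T = "\<lambda>u. s(1 := (word_cells u, int (length u)))"
  let ?R = "\<lambda>vs u. store_ctrs 2 (vs @ z) (?T u)"
  let ?x = "bits_encode (b # v)"
  have "exec (move2 2 3 4) (?R [?x, 0, 0] u) (?R [0, ?x, ?x] u)"
    by (rule exec_move2[where i=0 and j=1 and l=2]) (simp_all add: numeral_2_eq_2)
  moreover have "exec (move 4 2) (?R [0, ?x, ?x] u) (?R [?x, ?x, 0] u)"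
    by (rule exec_move[where i=2 and j=0]) (simp_all add: numeral_2_eq_2)
  moreover have "exec chd (?R [?x, ?x, 0] u) (?R [?x, of_bool b, 0] u)"
    using chd[of ?x ?x "?T u"] by simp
  moreover have "exec (If 3 (Suc 0) (Do 1 (Some 1) MoveR) (Do 1 (Some 2) MoveR ;; dec 3))
     (?R [?x, of_bool b, 0] u) (?R [?x, 0, 0] (u @ [b]))"
  proof -
    have wr: "exec (Do 1 (Some (if b then 2 else 1)) MoveR) (?R vs u) (?R vs (u @ [b]))" for vs
    proof -
      have "(?R vs u)(1 := do_tape (Some (if b then 2 else 1)) MoveR (?R vs u 1)) = ?R vs (u @ [b])"
        by (auto simp: store_ctrs_def fun_eq_iff word_cells_snoc)
      then show ?thesis using exec_Do by metis
    qed
    show ?thesis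
    proof (cases b)
      case True
      have "exec (dec 3) (?R [?x, 1, 0] (u @ [b])) (?R [?x, 0, 0] (u @ [b]))"
        by (rule exec_dec[where i=1 and x=0]) simp_all
      from exec_Seq[OF wr this] show ?thesis
        using True by (intro exec_if_nonzero[where i=1]) simp_all
    next
      case False
      show ?thesis
        using False wr[of "[?x, 0, 0]"] by (intro exec_if_zero[where i=1]) simp_all
    qed
  qed
  moreover have "exec ctl (?R [?x, 0, 0] (u @ [b])) (?R [bits_encode v, 0, 0] (u @ [b]))"
    using ctl[of ?x "?T (u @ [b])"] by simp
  ultimately have body: "exec (move2 2 3 4 ;; move 4 2 ;; chd ;;
     If 3 (Suc 0) (Do 1 (Some 1) MoveR) (Do 1 (Some 2) MoveR ;; dec 3) ;; ctl) (?R [?x, 0, 0] u) (?R [bits_encode v, 0, 0] (u @ [b]))"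
    by (intro exec_Seq)
  have "exec (write_com chd ctl) (?R [bits_encode v, 0, 0] (u @ [b])) (?R [0, 0, 0] (u @ b # v))"
    using Cons.IH[of "u @ [b]"] by (simp only: append_assoc append_Cons append_Nil)
  then have "exec (write_com chd ctl) (?R [?x, 0, 0] u) (?R [0, 0, 0] (u @ b # v))"
    unfolding write_com_def
    by (rule exec_loop_step[where i=0, rotated -1]) (use body in simp_all)
  then show ?case by (simp only: append_Cons append_Nil)
qed

theorem turing_computable_pr:
  assumes "pr g" "\<And>w. g (bits_encode (rev w)) = bits_encode (f w)"
  shows "turing_computable f"
proof -
  have "pr (\<lambda>x. Suc (prod_encode (of_bool i, x)))" for i
    by (intro pr_comp[OF pr_Suc] pr_pair pr_const pr_id)
  note push = pr_computes[OF this]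
  obtain c0 k0 where c0: "computes c0 k0 (\<lambda>x. Suc (prod_encode (of_bool False, x)))"
    using push by blast
  obtain c1 k1 where c1: "computes c1 k1 (\<lambda>x. Suc (prod_encode (of_bool True, x)))"
    using push by blast
  define ci where "ci i = (if i then c1 else c0)" for i
  define ki where "ki i = (if i then k1 else k0)" for i
  have ci: "computes (ci i) (ki i) (\<lambda>x. Suc (prod_encode (of_bool i, x)))" for i
    using c0 c1 by (simp add: ci_def ki_def split: if_split)
  obtain cg kg where cg: "computes cg kg g" using assms(1) pr_computes by blast
  obtain ch kh where ch: "computes ch kh (\<lambda>x. fst (prod_decode (x - 1)))"
    using pr_computes[OF pr_comp[OF pr_fst pr_pred]] by blast
  obtain ct kt where ct: "computes ct kt (\<lambda>x. snd (prod_decode (x - 1)))"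
    using pr_computes[OF pr_comp[OF pr_snd pr_pred]] by blast
  define k where "k = ki True + ki False + kg + kh + kt"
  let ?c = "init_com (k + 3) ;; read_com (ci False 2) (ci True 2) ;; cg 2 ;; write_com (ch 3) (ct 2)"
  show ?thesis
  proof (rule turing_computableI)
    show "wf_com (k + 5) ?c"
      using wf_init_com[of "k + 3" "k + 5"] computes_wf[OF ci, of 2] computes_wf[OF cg, of 2]
        computes_wf[OF ch, of 3] computes_wf[OF ct, of 2]
      by (auto simp: read_com_def write_com_def wf_simps k_def)
    show "2 \<le> k + 5" by simp
    fix w
    let ?z = "replicate (k + 2) (0::nat)"
    let ?s = "(initial_store w)(0 := (word_cells w, int (length w)))"
    have k3: "replicate (k + 3) 0 = 0 # ?z" "?z = 0 # 0 # replicate k 0" by (simp_all add: numeral_3_eq_3)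
    have "exec (init_com (k + 3)) (initial_store w) (store_ctrs 2 (0 # ?z) (initial_store w))"
      using exec_init_com[of "k + 3" w] unfolding k3(1) .
    moreover have "exec (read_com (ci False 2) (ci True 2)) (store_ctrs 2 (0 # ?z) (initial_store w))
        (store_ctrs 2 (bits_encode (rev w) # ?z) ?s)"
    proof (rule exec_read_com[where c="\<lambda>i. ci i 2"])
      fix i x s
      have "ki i \<le> k + 2" by (cases i) (auto simp: k_def)
      from computes_at[OF ci this, of 2 2 "[]" x s]
      show "exec (ci i 2) (store_ctrs 2 (x # ?z) s) (store_ctrs 2 (Suc (prod_encode (of_bool i, x)) # ?z) s)"
        by simp
    qed
    moreover have "exec (cg 2) (store_ctrs 2 (bits_encode (rev w) # ?z) ?s) (store_ctrs 2 (bits_encode (f w) # ?z) ?s)"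
      using computes_at[OF cg, of "k + 2" 2 2 "[]" "bits_encode (rev w)" ?s] assms(2)[of w] by (simp add: k_def)
    moreover have "exec (write_com (ch 3) (ct 2)) (store_ctrs 2 (bits_encode (f w) # ?z) ?s)
        (store_ctrs 2 (0 # ?z) (?s(1 := (word_cells (f w), int (length (f w))))))"
    proof -
      have "?s = ?s(1 := (word_cells [], int (length ([] :: bool list))))"
        by (auto simp: initial_store_def fun_eq_iff)
      moreover have "exec (write_com (ch 3) (ct 2))
         (store_ctrs 2 (bits_encode (f w) # 0 # 0 # replicate k 0) (?s(1 := (word_cells [], int (length ([] :: bool list))))))
         (store_ctrs 2 (0 # 0 # 0 # replicate k 0) (?s(1 := (word_cells ([] @ f w), int (length ([] @ f w))))))"
      proof (rule exec_write_com)
        fix x y s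
        show "exec (ch 3) (store_ctrs 2 (y # x # 0 # replicate k 0) s)
          (store_ctrs 2 (y # fst (prod_decode (x - 1)) # 0 # replicate k 0) s)"
          using computes_at[OF ch, of "Suc k" 3 2 "[y]" x s] by (simp add: k_def)
        show "exec (ct 2) (store_ctrs 2 (x # 0 # 0 # replicate k 0) s)
          (store_ctrs 2 (snd (prod_decode (x - 1)) # 0 # 0 # replicate k 0) s)"
          using computes_at[OF ct, of "Suc (Suc k)" 2 2 "[]" x s] by (simp add: k_def)
      qed
      ultimately show ?thesis unfolding k3(2) by (metis append_Nil)
    qed
    ultimately have "exec ?c (initial_store w) (store_ctrs 2 (0 # ?z) (?s(1 := (word_cells (f w), int (length (f w))))))"
      by (intro exec_Seq)
    moreover have "fst (store_ctrs 2 (0 # ?z) (?s(1 := (word_cells (f w), int (length (f w))))) 1) = word_cells (f w)"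
      by (simp add: store_ctrs_def)
    ultimately show "\<exists>s. exec ?c (initial_store w) s \<and> fst (s 1) = word_cells (f w)"
      by blast
  qed
qed

section \<open>Primitive recursive functions on structured data\<close>

class enc = fixes enc :: "'a \<Rightarrow> nat"

instantiation nat :: enc begin
definition enc_nat :: "nat \<Rightarrow> nat" where [simp]: "enc_nat n = n"
instance ..
end

instantiation bool :: enc begin
definition enc_bool :: "bool \<Rightarrow> nat" where [simp]: "enc_bool b = of_bool b"
instance ..
end

text \<open>Positive and negative parts form the code, so both are projections, and arithmetic
  reduces to differences of natural numbers.\<close>

instantiation int :: enc begin
definition enc_int :: "int \<Rightarrow> nat" where [simp]: "enc_int z = prod_encode (nat z, nat (- z))"
instance ..
end

instantiation prod :: (enc, enc) enc begin
definition enc_prod :: "'a \<times> 'b \<Rightarrow> nat" where [simp]: "enc_prod p = prod_encode (enc (fst p), enc (snd p))"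
instance ..
end

instantiation list :: (enc) enc begin
definition enc_list :: "'a list \<Rightarrow> nat" where [simp]: "enc_list xs = list_encode (map enc xs)"
instance ..
end

text \<open>Nothing is asked of numbers that are not codes. The rules mirror the formation of terms,
  so that a function is shown computable by unfolding its definition.\<close>

definition cmp :: "('a::enc \<Rightarrow> 'b::enc) \<Rightarrow> bool" where
  "cmp f \<longleftrightarrow> (\<exists>g. pr g \<and> (\<forall>x. g (enc x) = enc (f x)))"

lemma cmpI: "pr g \<Longrightarrow> (\<And>x. g (enc x) = enc (f x)) \<Longrightarrow> cmp f"
  unfolding cmp_def by blast

lemma cmp_comp: assumes "cmp h" "cmp f" shows "cmp (\<lambda>x. h (f x))"
proof -
  obtain g where g: "pr g" "\<And>x. g (enc x) = enc (h x)" using assms(1) unfolding cmp_def by blast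
  obtain k where k: "pr k" "\<And>x. k (enc x) = enc (f x)" using assms(2) unfolding cmp_def by blast
  show ?thesis by (rule cmpI[OF pr_comp[OF g(1) k(1)]]) (simp add: g k)
qed

lemma cmp_id: "cmp (\<lambda>x. x)"
  by (rule cmpI[OF pr_id]) simp

lemma cmp_const: "cmp (\<lambda>x. c)"
  by (rule cmpI[OF pr_const]) simp

lemma cmp_pair: assumes "cmp f" "cmp g" shows "cmp (\<lambda>x. (f x, g x))"
proof -
  obtain g' where g: "pr g'" "\<And>x. g' (enc x) = enc (g x)" using assms(2) unfolding cmp_def by blast
  obtain k where k: "pr k" "\<And>x. k (enc x) = enc (f x)" using assms(1) unfolding cmp_def by blast
  show ?thesis by (rule cmpI[OF pr_pair[OF k(1) g(1)]]) (simp add: g k)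
qed

lemma cmp_fst: "cmp f \<Longrightarrow> cmp (\<lambda>x. fst (f x))"
  by (rule cmp_comp[of fst], rule cmpI[OF pr_fst]) simp

lemma cmp_snd: "cmp f \<Longrightarrow> cmp (\<lambda>x. snd (f x))"
  by (rule cmp_comp[of snd], rule cmpI[OF pr_snd]) simp

lemma cmp_comp2:
  assumes "cmp (\<lambda>p. h (fst p) (snd p))" "cmp f" "cmp g"
  shows "cmp (\<lambda>x. h (f x) (g x))"
  using cmp_comp[OF assms(1) cmp_pair[OF assms(2,3)]] by simp

lemma cmp_comp3:
  assumes "cmp (\<lambda>p. h (fst p) (fst (snd p)) (snd (snd p)))" "cmp f" "cmp g" "cmp k"
  shows "cmp (\<lambda>x. h (f x) (g x) (k x))"
  using cmp_comp[OF assms(1) cmp_pair[OF assms(2) cmp_pair[OF assms(3,4)]]] by simp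

lemma cmp_via:
  assumes "pr h" "cmp f" "\<And>x. h (enc (f x)) = enc (g x)"
  shows "cmp g"
proof -
  obtain k where k: "pr k" "\<And>x. k (enc x) = enc (f x)" using assms(2) unfolding cmp_def by blast
  show ?thesis by (rule cmpI[OF pr_comp[OF assms(1) k(1)]]) (simp add: assms k)
qed

lemma cmp_if: assumes "cmp c" "cmp f" "cmp g" shows "cmp (\<lambda>x. if c x then f x else g x)"
proof -
  obtain c' where c: "pr c'" "\<And>x. c' (enc x) = enc (c x)" using assms(1) unfolding cmp_def by blast
  obtain f' where f: "pr f'" "\<And>x. f' (enc x) = enc (f x)" using assms(2) unfolding cmp_def by blast
  obtain g' where g: "pr g'" "\<And>x. g' (enc x) = enc (g x)" using assms(3) unfolding cmp_def by blast
  show ?thesis by (rule cmpI[OF pr_if[OF c(1) g(1) f(1)]]) (simp add: c f g)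
qed

lemma cmp_Suc: "cmp f \<Longrightarrow> cmp (\<lambda>x. Suc (f x))"
  by (rule cmp_comp[of Suc], rule cmpI[OF pr_Suc]) simp

lemma cmp_plus_nat: fixes f g :: "'a::enc \<Rightarrow> nat" shows "cmp f \<Longrightarrow> cmp g \<Longrightarrow> cmp (\<lambda>x. f x + g x)"
  by (rule cmp_via[where f="\<lambda>x. (f x, g x)", OF pr_plus[OF pr_fst pr_snd] cmp_pair]) auto

lemma cmp_minus_nat: fixes f g :: "'a::enc \<Rightarrow> nat" shows "cmp f \<Longrightarrow> cmp g \<Longrightarrow> cmp (\<lambda>x. f x - g x)"
  by (rule cmp_via[where f="\<lambda>x. (f x, g x)", OF pr_minus[OF pr_fst pr_snd] cmp_pair]) auto

lemma cmp_times_nat: fixes f g :: "'a::enc \<Rightarrow> nat" shows "cmp f \<Longrightarrow> cmp g \<Longrightarrow> cmp (\<lambda>x. f x * g x)"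
  by (rule cmp_via[where f="\<lambda>x. (f x, g x)", OF pr_times[OF pr_fst pr_snd] cmp_pair]) auto

lemma cmp_le_nat: fixes f g :: "'a::enc \<Rightarrow> nat" shows "cmp f \<Longrightarrow> cmp g \<Longrightarrow> cmp (\<lambda>x. f x \<le> g x)"
  by (rule cmp_via[where f="\<lambda>x. (f x, g x)", OF pr_if[OF pr_minus[OF pr_fst pr_snd] pr_const[of 1] pr_const[of 0]] cmp_pair]) auto

lemma cmp_not: assumes "cmp f" shows "cmp (\<lambda>x. \<not> f x)"
proof -
  have *: "(\<not> f x) = (if f x then False else True)" for x by simp
  show ?thesis unfolding * by (intro cmp_if assms cmp_const)
qed

lemma cmp_conj: assumes "cmp f" "cmp g" shows "cmp (\<lambda>x. f x \<and> g x)"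
proof -
  have *: "(f x \<and> g x) = (if f x then g x else False)" for x by simp
  show ?thesis unfolding * by (intro cmp_if assms cmp_const)
qed

lemma cmp_disj: assumes "cmp f" "cmp g" shows "cmp (\<lambda>x. f x \<or> g x)"
proof -
  have *: "(f x \<or> g x) = (if f x then True else g x)" for x by simp
  show ?thesis unfolding * by (intro cmp_if assms cmp_const)
qed

lemma cmp_less_nat:
  fixes f g :: "'a::enc \<Rightarrow> nat" assumes "cmp f" "cmp g" shows "cmp (\<lambda>x. f x < g x)"
  unfolding not_le[symmetric] by (intro cmp_not cmp_le_nat assms)

lemma cmp_eq_nat:
  fixes f g :: "'a::enc \<Rightarrow> nat" assumes "cmp f" "cmp g" shows "cmp (\<lambda>x. f x = g x)"
  unfolding order.eq_iff by (intro cmp_conj cmp_le_nat assms)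

lemma cmp_nat: "cmp f \<Longrightarrow> cmp (\<lambda>x. nat (f x))"
  by (rule cmp_via[OF pr_fst]) auto

lemma cmp_nat_uminus: "cmp f \<Longrightarrow> cmp (\<lambda>x. nat (- f x))"
  by (rule cmp_via[OF pr_snd]) auto

lemma cmp_int_diff: assumes "cmp f" "cmp g" shows "cmp (\<lambda>x. int (f x) - int (g x))"
proof (rule cmp_via[OF pr_id cmp_pair[OF cmp_minus_nat[OF assms] cmp_minus_nat[OF assms(2,1)]]])
  fix x
  have "nat (int (f x) - int (g x)) = f x - g x" "nat (- (int (f x) - int (g x))) = g x - f x"
    by arith+
  then show "enc (f x - g x, g x - f x) = enc (int (f x) - int (g x))" by simp
qed

lemma cmp_int: "cmp f \<Longrightarrow> cmp (\<lambda>x. int (f x))"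
  using cmp_int_diff[OF _ cmp_const[of 0]] by simp

lemma cmp_uminus_int: fixes f :: "'a::enc \<Rightarrow> int" assumes "cmp f" shows "cmp (\<lambda>x. - f x)"
proof -
  have "- f x = int (nat (- f x)) - int (nat (f x))" for x by simp
  then show ?thesis using cmp_int_diff[OF cmp_nat_uminus[OF assms] cmp_nat[OF assms]] by simp
qed

lemma cmp_plus_int: fixes f g :: "'a::enc \<Rightarrow> int" assumes "cmp f" "cmp g" shows "cmp (\<lambda>x. f x + g x)"
proof -
  have "f x + g x = int (nat (f x) + nat (g x)) - int (nat (- f x) + nat (- g x))" for x by simp
  then show ?thesis
    using cmp_int_diff[OF cmp_plus_nat[OF cmp_nat[OF assms(1)] cmp_nat[OF assms(2)]]
        cmp_plus_nat[OF cmp_nat_uminus[OF assms(1)] cmp_nat_uminus[OF assms(2)]]] by simp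
qed

lemma cmp_times_int: fixes f g :: "'a::enc \<Rightarrow> int" assumes "cmp f" "cmp g" shows "cmp (\<lambda>x. f x * g x)"
proof -
  have *: "f x * g x = int (nat (f x) * nat (g x) + nat (- f x) * nat (- g x)) -
      int (nat (f x) * nat (- g x) + nat (- f x) * nat (g x))" for x
    by (cases "f x \<ge> 0"; cases "g x \<ge> 0") auto
  show ?thesis
    unfolding * by (intro cmp_int_diff cmp_plus_nat cmp_times_nat cmp_nat cmp_nat_uminus assms)
qed

lemma cmp_less_0_int: assumes "cmp f" shows "cmp (\<lambda>x. f x < (0::int))"
proof -
  have *: "f x < 0 \<longleftrightarrow> 0 < nat (- f x)" for x by auto
  show ?thesis unfolding * by (intro cmp_less_nat cmp_const cmp_nat_uminus assms)
qed

lemma cmp_eq_0_int: assumes "cmp f" shows "cmp (\<lambda>x. f x = (0::int))"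
proof -
  have *: "f x = 0 \<longleftrightarrow> nat (f x) + nat (- f x) = 0" for x by auto
  show ?thesis unfolding * by (intro cmp_eq_nat cmp_const cmp_nat cmp_nat_uminus cmp_plus_nat assms)
qed

lemma cmp_nat_abs: assumes "cmp f" shows "cmp (\<lambda>x. nat \<bar>f x\<bar>)"
proof -
  have *: "nat \<bar>f x\<bar> = nat (f x) + nat (- f x)" for x by auto
  show ?thesis unfolding * by (intro cmp_nat cmp_nat_uminus cmp_plus_nat assms)
qed

text \<open>Iteration in \<open>pr\<close> has no parameters, so \<open>x\<close> travels along as
  the first component of the iterated pair.\<close>

lemma cmp_iterate:
  fixes f :: "'a::enc \<Rightarrow> 'b::enc \<Rightarrow> 'b"
  assumes "cmp (\<lambda>z. f (fst z) (snd z))" "cmp n" "cmp a"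
  shows "cmp (\<lambda>x. (f x ^^ n x) (a x))"
proof -
  obtain g where g: "pr g" "\<And>z. g (enc z) = enc (f (fst z) (snd z))" using assms(1) unfolding cmp_def by blast
  obtain n' where n': "pr n'" "\<And>x. n' (enc x) = enc (n x)" using assms(2) unfolding cmp_def by blast
  obtain a' where a': "pr a'" "\<And>x. a' (enc x) = enc (a x)" using assms(3) unfolding cmp_def by blast
  let ?h = "\<lambda>z. prod_encode (fst (prod_decode z), g z)"
  have h: "pr ?h" by (intro pr_pair pr_fst g)
  have "pr (\<lambda>x. snd (prod_decode ((?h ^^ n' x) (prod_encode (x, a' x)))))"
    by (intro pr_comp[OF pr_snd] pr_iterate[OF h] n' a' pr_pair pr_id)
  moreover have "(?h ^^ m) (prod_encode (enc x, enc y)) = prod_encode (enc x, enc ((f x ^^ m) y))" for m x y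
  proof (induction m)
    case (Suc m)
    then show ?case using g(2)[of "(x, (f x ^^ m) y)"] by simp
  qed simp
  ultimately show ?thesis by (intro cmpI) (auto simp: n' a')
qed

lemma cmp_Cons: "cmp f \<Longrightarrow> cmp g \<Longrightarrow> cmp (\<lambda>x. f x # g x)"
  by (rule cmp_via[where f="\<lambda>x. (f x, g x)", OF pr_Suc cmp_pair]) auto

lemma cmp_tl: assumes "cmp f" shows "cmp (\<lambda>x. tl (f x))"
proof (rule cmp_via[OF pr_if[OF pr_id pr_const[of 0] pr_comp[OF pr_snd pr_pred]] assms])
  fix x
  show "(if enc (f x) = 0 then 0 else snd (prod_decode (enc (f x) - 1))) = enc (tl (f x))"
    by (cases "f x") auto
qed

lemma cmp_null: assumes "cmp f" shows "cmp (\<lambda>x. f x = [])"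
proof (rule cmp_via[OF pr_if[OF pr_id pr_const[of 1] pr_const[of 0]] assms])
  fix x
  show "(if enc (f x) = 0 then 1 else 0) = enc (f x = [])" by (cases "f x") auto
qed

lemma cmp_case_list:
  fixes a :: "'a::enc \<Rightarrow> 'c::enc" and f :: "'a \<Rightarrow> 'b::enc \<Rightarrow> 'b list \<Rightarrow> 'c"
  assumes "cmp xs" "cmp a" "cmp (\<lambda>z. f (fst z) (fst (snd z)) (snd (snd z)))"
  shows "cmp (\<lambda>x. case xs x of [] \<Rightarrow> a x | y # ys \<Rightarrow> f x y ys)"
proof -
  obtain g where g: "pr g" "\<And>z. g (enc z) = enc (f (fst z) (fst (snd z)) (snd (snd z)))"
    using assms(3) unfolding cmp_def by blast
  obtain s where s: "pr s" "\<And>x. s (enc x) = enc (xs x)" using assms(1) unfolding cmp_def by blast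
  obtain a' where a': "pr a'" "\<And>x. a' (enc x) = enc (a x)" using assms(2) unfolding cmp_def by blast
  let ?h = "\<lambda>x. if s x = 0 then a' x else g (prod_encode (x, s x - 1))"
  have "pr ?h" by (intro pr_if a' s pr_comp[OF g(1)] pr_pair pr_id pr_comp[OF pr_pred])
  moreover have "?h (enc x) = enc (case xs x of [] \<Rightarrow> a x | y # ys \<Rightarrow> f x y ys)" for x
  proof (cases "xs x")
    case (Cons y ys)
    then show ?thesis using g(2)[of "(x, y, ys)"] by (simp add: s)
  qed (simp add: s a')
  ultimately show ?thesis by (rule cmpI)
qed

lemma length_le_list_encode: "length xs \<le> list_encode xs"
proof (induction xs)
  case (Cons x xs)
  then show ?case using le_prod_encode_2[of "list_encode xs" x] by simp
qed simp

text \<open>A fold is an iteration of a step that does nothing once the list is exhausted; the code of a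
  list bounds its length.\<close>

lemma cmp_foldl:
  fixes f :: "'a::enc \<Rightarrow> 'b::enc \<Rightarrow> 'c::enc \<Rightarrow> 'b"
  assumes "cmp (\<lambda>z. f (fst z) (fst (snd z)) (snd (snd z)))" "cmp a" "cmp xs"
  shows "cmp (\<lambda>x. foldl (f x) (a x) (xs x))"
proof -
  define st where "st x p = (case snd p of [] \<Rightarrow> p | y # ys \<Rightarrow> (f x (fst p) y, ys))" for x and p :: "'b \<times> 'c list"
  have st: "cmp (\<lambda>z. st (fst z) (snd z))"
    unfolding st_def
    by (intro cmp_case_list[where f="\<lambda>z y ys. (f (fst z) (fst (snd z)) y, ys)"] cmp_fst cmp_snd cmp_id cmp_pair
        cmp_comp3[where h=f, OF assms(1)])
  have code: "cmp (\<lambda>x. enc (xs x))" by (rule cmp_via[OF pr_id assms(3)]) simp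
  have "(st x ^^ n) (b, ys) = (foldl (f x) b ys, [])" if "length ys \<le> n" for x n b ys
    using that
  proof (induction n arbitrary: b ys)
    case (Suc n)
    then show ?case by (cases ys) (auto simp: funpow_Suc_right st_def simp del: funpow.simps)
  qed simp
  then have "fst ((st x ^^ enc (xs x)) (a x, xs x)) = foldl (f x) (a x) (xs x)" for x
    using length_le_list_encode[of "map enc (xs x)"] by simp
  moreover have "cmp (\<lambda>x. fst ((st x ^^ enc (xs x)) (a x, xs x)))"
    by (intro cmp_fst cmp_iterate st code cmp_pair assms)
  ultimately show ?thesis by simp
qed

lemmas cmp_basic = cmp_id cmp_const cmp_pair cmp_fst cmp_snd cmp_if cmp_Suc cmp_plus_nat cmp_minus_nat
  cmp_times_nat cmp_le_nat cmp_less_nat cmp_eq_nat cmp_not cmp_conj cmp_disj cmp_nat cmp_int cmp_uminus_int cmp_plus_int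
  cmp_times_int cmp_less_0_int cmp_eq_0_int cmp_nat_abs cmp_Cons cmp_tl cmp_null

lemma cmp_rev: assumes "cmp xs" shows "cmp (\<lambda>x. rev (xs x))"
proof -
  have "foldl (\<lambda>acc y. y # acc) a ys = rev ys @ a" for a and ys :: "'b list"
    by (induction ys arbitrary: a) auto
  then have *: "rev (xs x) = foldl (\<lambda>acc y. y # acc) [] (xs x)" for x by simp
  show ?thesis unfolding * by (intro cmp_foldl assms cmp_basic)
qed

lemma cmp_append: assumes "cmp xs" "cmp ys" shows "cmp (\<lambda>x. xs x @ ys x)"
proof -
  have "foldl (\<lambda>acc y. y # acc) a ys = rev ys @ a" for a and ys :: "'b list"
    by (induction ys arbitrary: a) auto
  then have *: "xs x @ ys x = foldl (\<lambda>acc y. y # acc) (ys x) (rev (xs x))" for x by simp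
  show ?thesis unfolding * by (intro cmp_foldl assms cmp_basic cmp_rev)
qed

lemma cmp_foldr:
  fixes f :: "'a::enc \<Rightarrow> 'c::enc \<Rightarrow> 'b::enc \<Rightarrow> 'b"
  assumes "cmp (\<lambda>z. f (fst z) (fst (snd z)) (snd (snd z)))" "cmp a" "cmp xs"
  shows "cmp (\<lambda>x. foldr (f x) (xs x) (a x))"
  unfolding foldr_conv_foldl
  by (intro cmp_foldl cmp_rev assms) (intro cmp_comp3[where h=f, OF assms(1)] cmp_basic)

lemma cmp_map:
  fixes f :: "'a::enc \<Rightarrow> 'b::enc \<Rightarrow> 'c::enc"
  assumes "cmp (\<lambda>z. f (fst z) (snd z))" "cmp xs"
  shows "cmp (\<lambda>x. map (f x) (xs x))"
proof -
  have *: "map g ys = foldr (\<lambda>y acc. g y # acc) ys []" for g :: "'b \<Rightarrow> 'c" and ys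
    by (induction ys) auto
  show ?thesis unfolding *
    by (intro cmp_foldr cmp_basic assms(2)) (intro cmp_comp2[where h=f, OF assms(1)] cmp_basic)
qed

lemma cmp_concat: assumes "cmp xs" shows "cmp (\<lambda>x. concat (xs x))"
proof -
  have *: "concat ys = foldr (\<lambda>y acc. y @ acc) ys []" for ys :: "'b list list"
    by (induction ys) auto
  show ?thesis unfolding * by (intro cmp_foldr cmp_basic assms cmp_append)
qed

lemma cmp_filter:
  fixes P :: "'a::enc \<Rightarrow> 'b::enc \<Rightarrow> bool"
  assumes "cmp (\<lambda>z. P (fst z) (snd z))" "cmp xs"
  shows "cmp (\<lambda>x. filter (P x) (xs x))"
proof -
  have *: "filter g ys = foldr (\<lambda>y acc. if g y then y # acc else acc) ys []" for g :: "'b \<Rightarrow> bool" and ys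
    by (induction ys) auto
  show ?thesis unfolding *
    by (intro cmp_foldr cmp_basic assms(2)) (intro cmp_comp2[where h=P, OF assms(1)] cmp_basic)
qed

lemma cmp_length: assumes "cmp xs" shows "cmp (\<lambda>x. length (xs x))"
proof -
  have *: "length ys = foldr (\<lambda>y acc. Suc acc) ys 0" for ys :: "'b list"
    by (induction ys) auto
  show ?thesis unfolding * by (intro cmp_foldr cmp_basic assms)
qed

lemma cmp_sum_list_int: assumes "cmp xs" shows "cmp (\<lambda>x. sum_list (xs x) :: int)"
proof -
  have *: "sum_list ys = foldr (\<lambda>y acc. y + acc) ys 0" for ys :: "int list"
    by (induction ys) auto
  show ?thesis unfolding * by (intro cmp_foldr cmp_basic assms)
qed

lemma cmp_upt: assumes "cmp n" shows "cmp (\<lambda>x. [0..<n x])"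
proof -
  have *: "[0..<m] = rev (snd (((\<lambda>p. (Suc (fst p), fst p # snd p)) ^^ m) (0, [])))" for m
  proof -
    have "((\<lambda>p. (Suc (fst p), fst p # snd p)) ^^ m) (0, []) = (m, rev [0..<m])"
      by (induction m) auto
    then show ?thesis by simp
  qed
  show ?thesis unfolding * by (intro cmp_rev cmp_snd cmp_iterate cmp_basic assms)
qed

lemma cmp_replicate: assumes "cmp n" "cmp a" shows "cmp (\<lambda>x. replicate (n x) (a x))"
proof -
  have *: "replicate m b = ((\<lambda>ys. b # ys) ^^ m) []" for m and b :: 'b
    by (induction m) auto
  show ?thesis unfolding *
    by (intro cmp_iterate cmp_basic assms cmp_comp[OF assms(2)])
qed

lemma cmp_takeWhile_id: assumes "cmp xs" shows "cmp (\<lambda>x. takeWhile id (xs x))"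
proof -
  have *: "takeWhile id ys = foldr (\<lambda>y acc. if y then y # acc else []) ys []" for ys
    by (induction ys) auto
  show ?thesis unfolding * by (intro cmp_foldr cmp_basic assms)
qed

lemma cmp_drop: assumes "cmp n" "cmp xs" shows "cmp (\<lambda>x. drop (n x) (xs x))"
proof -
  have *: "drop m ys = (tl ^^ m) ys" for m and ys :: "'b list"
    by (induction m arbitrary: ys) (auto simp: drop_Suc funpow_swap1)
  show ?thesis unfolding *
    by (intro cmp_iterate cmp_basic assms)
qed

lemma cmp_enumerate: assumes "cmp n" "cmp xs" shows "cmp (\<lambda>x. enumerate (n x) (xs x))"
proof -
  have "foldl (\<lambda>p y. (Suc (fst p), (fst p, y) # snd p)) (m, acc) ys = (m + length ys, rev (enumerate m ys) @ acc)"
    for m acc and ys :: "'b list"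
    by (induction ys arbitrary: m acc) auto
  then have *: "enumerate m ys = rev (snd (foldl (\<lambda>p y. (Suc (fst p), (fst p, y) # snd p)) (m, []) ys))"
    for m and ys :: "'b list" by simp
  show ?thesis unfolding *
    by (intro cmp_rev cmp_snd cmp_foldl cmp_basic assms)
qed

lemmas cmp_rules = cmp_basic cmp_foldl cmp_foldr cmp_map cmp_concat cmp_filter cmp_length cmp_rev cmp_append
  cmp_sum_list_int cmp_upt cmp_replicate cmp_takeWhile_id cmp_drop cmp_enumerate cmp_iterate cmp_case_list

theorem turing_computable_cmp:
  assumes "cmp f" shows "turing_computable f"
proof -
  have "cmp (\<lambda>w. f (rev w))" by (intro cmp_comp[OF assms] cmp_rev cmp_id)
  then obtain g where "pr g" "\<And>w. g (enc w) = enc (f (rev w))" unfolding cmp_def by blast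
  moreover have "map enc w = (map of_bool w :: nat list)" for w :: "bool list" by simp
  ultimately show ?thesis by (intro turing_computable_pr[of g]) (simp_all del: map_eq_conv)
qed

section \<open>The local algebra\<close>

text \<open>
  Let \<open>u = S + T - 1\<close>, \<open>v = S - T\<close> and \<open>x\<^sub>i = D\<^sub>i - 1\<close>. The algebra is \<open>\<rat>[v]/v\<^sup>5\<close> (coordinates
  \<open>a0, \<dots>, a4\<close>) plus the span of the \<open>x\<^sub>i\<close> (coordinates \<open>xc\<close>) plus a space annihilated by the maximal ideal,
  which contains \<open>u\<close> (coordinate \<open>wu\<close>), \<open>v x\<^sub>i\<close> (\<open>wv\<close>) and \<open>x\<^sub>i x\<^sub>j\<close>; in the last case the coordinates
  \<open>wx\<close> form a symmetric matrix, in which \<open>x\<^sub>i\<^sup>2\<close> has the diagonal entry \<open>2\<close>.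
\<close>

datatype alg = Alg (a0: rat) (a1: rat) (a2: rat) (a3: rat) (a4: rat)
  (xc: "nat \<Rightarrow> rat") (wu: rat) (wv: "nat \<Rightarrow> rat") (wx: "nat \<Rightarrow> nat \<Rightarrow> rat")

lemma alg_eqI:
  assumes "a0 A = a0 B" "a1 A = a1 B" "a2 A = a2 B" "a3 A = a3 B" "a4 A = a4 B"
    "\<And>i. xc A i = xc B i" "wu A = wu B" "\<And>i. wv A i = wv B i" "\<And>i j. wx A i j = wx B i j"
  shows "A = B"
  using assms by (cases A; cases B) (simp add: fun_eq_iff)

instantiation alg :: comm_ring_1
begin

definition zero_alg :: alg where
  "0 = Alg 0 0 0 0 0 (\<lambda>i. 0) 0 (\<lambda>i. 0) (\<lambda>i j. 0)"

definition one_alg :: alg where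
  "1 = Alg 1 0 0 0 0 (\<lambda>i. 0) 0 (\<lambda>i. 0) (\<lambda>i j. 0)"

definition plus_alg :: "alg \<Rightarrow> alg \<Rightarrow> alg" where
  "A + B = Alg (a0 A + a0 B) (a1 A + a1 B) (a2 A + a2 B) (a3 A + a3 B) (a4 A + a4 B) (\<lambda>i. xc A i + xc B i)
     (wu A + wu B) (\<lambda>i. wv A i + wv B i) (\<lambda>i j. wx A i j + wx B i j)"

definition minus_alg :: "alg \<Rightarrow> alg \<Rightarrow> alg" where
  "A - B = Alg (a0 A - a0 B) (a1 A - a1 B) (a2 A - a2 B) (a3 A - a3 B) (a4 A - a4 B) (\<lambda>i. xc A i - xc B i)
     (wu A - wu B) (\<lambda>i. wv A i - wv B i) (\<lambda>i j. wx A i j - wx B i j)"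

definition uminus_alg :: "alg \<Rightarrow> alg" where
  "- A = Alg (- a0 A) (- a1 A) (- a2 A) (- a3 A) (- a4 A) (\<lambda>i. - xc A i) (- wu A) (\<lambda>i. - wv A i) (\<lambda>i j. - wx A i j)"

definition times_alg :: "alg \<Rightarrow> alg \<Rightarrow> alg" where
  "A * B = Alg (a0 A * a0 B) (a0 A * a1 B + a1 A * a0 B) (a0 A * a2 B + a1 A * a1 B + a2 A * a0 B)
     (a0 A * a3 B + a1 A * a2 B + a2 A * a1 B + a3 A * a0 B)
     (a0 A * a4 B + a1 A * a3 B + a2 A * a2 B + a3 A * a1 B + a4 A * a0 B)
     (\<lambda>i. a0 A * xc B i + xc A i * a0 B) (a0 A * wu B + wu A * a0 B)
     (\<lambda>i. a0 A * wv B i + wv A i * a0 B + a1 A * xc B i + xc A i * a1 B)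
     (\<lambda>i j. a0 A * wx B i j + wx A i j * a0 B + xc A i * xc B j + xc A j * xc B i)"

instance
  by standard
    (auto intro!: alg_eqI simp: zero_alg_def one_alg_def plus_alg_def minus_alg_def uminus_alg_def times_alg_def
      algebra_simps)

end

lemma alg_zero [simp]: "a0 0 = 0" "a1 0 = 0" "a2 0 = 0" "a3 0 = 0" "a4 0 = 0" "xc 0 i = 0" "wu 0 = 0" "wv 0 i = 0" "wx 0 i j = 0"
  by (simp_all add: zero_alg_def)

lemma alg_one [simp]: "a0 1 = 1" "a1 1 = 0" "a2 1 = 0" "a3 1 = 0" "a4 1 = 0" "xc 1 i = 0" "wu 1 = 0" "wv 1 i = 0" "wx 1 i j = 0"
  by (simp_all add: one_alg_def)

lemma alg_plus [simp]: "a0 (A + B) = a0 A + a0 B" "a1 (A + B) = a1 A + a1 B" "a2 (A + B) = a2 A + a2 B"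
  "a3 (A + B) = a3 A + a3 B" "a4 (A + B) = a4 A + a4 B" "xc (A + B) i = xc A i + xc B i"
  "wu (A + B) = wu A + wu B" "wv (A + B) i = wv A i + wv B i" "wx (A + B) i j = wx A i j + wx B i j"
  by (simp_all add: plus_alg_def)

lemma alg_minus [simp]: "a0 (A - B) = a0 A - a0 B" "a1 (A - B) = a1 A - a1 B" "a2 (A - B) = a2 A - a2 B"
  "a3 (A - B) = a3 A - a3 B" "a4 (A - B) = a4 A - a4 B" "xc (A - B) i = xc A i - xc B i"
  "wu (A - B) = wu A - wu B" "wv (A - B) i = wv A i - wv B i" "wx (A - B) i j = wx A i j - wx B i j"
  by (simp_all add: minus_alg_def)

lemma alg_uminus [simp]: "a0 (- A) = - a0 A" "a1 (- A) = - a1 A" "a2 (- A) = - a2 A" "a3 (- A) = - a3 A"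
  "a4 (- A) = - a4 A" "xc (- A) i = - xc A i" "wu (- A) = - wu A" "wv (- A) i = - wv A i" "wx (- A) i j = - wx A i j"
  by (simp_all add: uminus_alg_def)

lemma alg_times [simp]: "a0 (A * B) = a0 A * a0 B" "a1 (A * B) = a0 A * a1 B + a1 A * a0 B"
  "a2 (A * B) = a0 A * a2 B + a1 A * a1 B + a2 A * a0 B"
  "a3 (A * B) = a0 A * a3 B + a1 A * a2 B + a2 A * a1 B + a3 A * a0 B"
  "a4 (A * B) = a0 A * a4 B + a1 A * a3 B + a2 A * a2 B + a3 A * a1 B + a4 A * a0 B"
  "xc (A * B) i = a0 A * xc B i + xc A i * a0 B" "wu (A * B) = a0 A * wu B + wu A * a0 B"
  "wv (A * B) i = a0 A * wv B i + wv A i * a0 B + a1 A * xc B i + xc A i * a1 B"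
  "wx (A * B) i j = a0 A * wx B i j + wx A i j * a0 B + xc A i * xc B j + xc A j * xc B i"
  by (simp_all add: times_alg_def)

definition scalar :: "rat \<Rightarrow> alg" where
  "scalar c = Alg c 0 0 0 0 (\<lambda>i. 0) 0 (\<lambda>i. 0) (\<lambda>i j. 0)"

lemma alg_scalar [simp]: "a0 (scalar c) = c" "a1 (scalar c) = 0" "a2 (scalar c) = 0" "a3 (scalar c) = 0" "a4 (scalar c) = 0"
  "xc (scalar c) i = 0" "wu (scalar c) = 0" "wv (scalar c) i = 0" "wx (scalar c) i j = 0"
  by (simp_all add: scalar_def)

lemma scalar_0 [simp]: "scalar 0 = 0" and scalar_1 [simp]: "scalar 1 = 1"
  by (auto intro!: alg_eqI)

lemma scalar_add: "scalar (c + d) = scalar c + scalar d" and scalar_mult: "scalar (c * d) = scalar c * scalar d"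
  by (auto intro!: alg_eqI)

text \<open>
  The image of \<open>2\<^sup>w S\<^sup>p T\<^sup>q D\<^sup>e\<close>, where \<open>k = p - q\<close> and \<open>w = p + q\<close>: the coordinates \<open>a0, \<dots>, a4\<close> are the
  coefficients of \<open>(1 + v)\<^sup>p (1 - v)\<^sup>q\<close>. It makes sense for negative exponents as well.
\<close>

definition theta :: "rat \<Rightarrow> rat \<Rightarrow> (nat \<Rightarrow> rat) \<Rightarrow> alg" where
  "theta k w e = Alg 1 k ((k^2 - w) / 2) ((k^3 - 3 * k * w + 2 * k) / 6)
     ((k^4 - 6 * k^2 * w + 3 * w^2 + 8 * k^2 - 6 * w) / 24)
     e w (\<lambda>i. k * e i) (\<lambda>i j. e i * e j - (if i = j then e i else 0))"

lemma alg_theta [simp]: "a0 (theta k w e) = 1" "a1 (theta k w e) = k" "a2 (theta k w e) = (k^2 - w) / 2"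
  "a3 (theta k w e) = (k^3 - 3 * k * w + 2 * k) / 6"
  "a4 (theta k w e) = (k^4 - 6 * k^2 * w + 3 * w^2 + 8 * k^2 - 6 * w) / 24"
  "xc (theta k w e) i = e i" "wu (theta k w e) = w" "wv (theta k w e) i = k * e i"
  "wx (theta k w e) i j = e i * e j - (if i = j then e i else 0)"
  by (simp_all add: theta_def)

lemma theta_0: "theta 0 0 (\<lambda>i. 0) = 1"
  by (auto intro!: alg_eqI)

text \<open>Multiplying monomials adds exponents. The diagonal of \<open>wx\<close> is forced:
  \<open>x\<^sub>i\<^sup>2\<close> has the coefficient \<open>e (e - 1) / 2\<close> in
  \<open>(1 + x\<^sub>i)^e\<close> and the diagonal entry \<open>2\<close>, which gives
  \<open>e\<^sup>2 - e\<close>.\<close>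

lemma theta_add: "theta k w e * theta k' w' e' = theta (k + k') (w + w') (\<lambda>i. e i + e' i)"
proof (rule alg_eqI)
  show "a2 (theta k w e * theta k' w' e') = a2 (theta (k + k') (w + w') (\<lambda>i. e i + e' i))"
    by (simp add: field_simps power2_eq_square)
  show "a3 (theta k w e * theta k' w' e') = a3 (theta (k + k') (w + w') (\<lambda>i. e i + e' i))"
    by (simp add: field_simps power2_eq_square power3_eq_cube)
  show "a4 (theta k w e * theta k' w' e') = a4 (theta (k + k') (w + w') (\<lambda>i. e i + e' i))"
    by (simp add: field_simps power2_eq_square power3_eq_cube power4_eq_xxxx)
qed (auto simp: algebra_simps)

section \<open>Evaluation of polynomials in the algebra\<close>

definition mon_alg :: "(nat \<Rightarrow>\<^sub>0 nat) \<Rightarrow> alg" where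
  "mon_alg m = (let p = Poly_Mapping.lookup m 0; q = Poly_Mapping.lookup m 1 in
     scalar ((1/2) ^ (p + q)) * theta (of_nat p - of_nat q) (of_nat p + of_nat q) (\<lambda>i. of_nat (Poly_Mapping.lookup m (i + 2))))"

lemma mon_alg_0 [simp]: "mon_alg 0 = 1"
  by (simp add: mon_alg_def theta_0)

lemma mon_alg_add: "mon_alg (m + m') = mon_alg m * mon_alg m'"
proof -
  have *: "scalar a * A * (scalar b * B) = scalar (a * b) * (A * B)" for a b A B
    by (simp add: scalar_mult ac_simps)
  show ?thesis
    unfolding mon_alg_def Let_def * theta_add
    by (simp add: lookup_add power_add algebra_simps)
qed

definition eval_alg :: "rat mpoly \<Rightarrow> alg" where
  "eval_alg p = (\<Sum>m \<in> Poly_Mapping.keys p. scalar (Poly_Mapping.lookup p m) * mon_alg m)"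

lemma eval_alg_superset:
  assumes "finite M" "Poly_Mapping.keys p \<subseteq> M"
  shows "eval_alg p = (\<Sum>m \<in> M. scalar (Poly_Mapping.lookup p m) * mon_alg m)"
  unfolding eval_alg_def using assms by (intro sum.mono_neutral_left) (auto simp: in_keys_iff)

lemma eval_alg_add: "eval_alg (p + q) = eval_alg p + eval_alg q"
proof -
  let ?M = "Poly_Mapping.keys p \<union> Poly_Mapping.keys q"
  have "eval_alg (p + q) = (\<Sum>m \<in> ?M. scalar (Poly_Mapping.lookup (p + q) m) * mon_alg m)"
    using Poly_Mapping.keys_add[of p q] by (intro eval_alg_superset) auto
  also have "\<dots> = eval_alg p + eval_alg q"
    by (simp add: eval_alg_superset[of ?M] lookup_add scalar_add distrib_right sum.distrib)
  finally show ?thesis .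
qed

lemma eval_alg_single [simp]: "eval_alg (Poly_Mapping.single m c) = scalar c * mon_alg m"
  by (cases "c = 0") (auto simp: eval_alg_def)

lemma poly_mapping_sum_single:
  fixes p :: "'b \<Rightarrow>\<^sub>0 'a::comm_monoid_add"
  shows "p = (\<Sum>m \<in> Poly_Mapping.keys p. Poly_Mapping.single m (Poly_Mapping.lookup p m))"
proof (rule poly_mapping_eqI)
  fix m
  have "(\<Sum>m' \<in> Poly_Mapping.keys p. Poly_Mapping.lookup (Poly_Mapping.single m' (Poly_Mapping.lookup p m')) m) =
      (\<Sum>m' \<in> Poly_Mapping.keys p. if m = m' then Poly_Mapping.lookup p m' else 0)"
    by (intro sum.cong) (auto simp: lookup_single)
  then show "Poly_Mapping.lookup p m = Poly_Mapping.lookup (\<Sum>m \<in> Poly_Mapping.keys p. Poly_Mapping.single m (Poly_Mapping.lookup p m)) m"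
    by (simp add: lookup_sum in_keys_iff)
qed

lemma mpoly_induct [case_names single add]:
  fixes p :: "'a::comm_monoid_add mpoly"
  assumes single: "\<And>m c. P (Poly_Mapping.single m c)" and add: "\<And>p q. P p \<Longrightarrow> P q \<Longrightarrow> P (p + q)"
  shows "P p"
proof -
  have "P (\<Sum>m \<in> M. Poly_Mapping.single m (Poly_Mapping.lookup p m))" if "finite M" for M
    using that
  proof (induction M rule: finite_induct)
    case empty
    then show ?case using single[of 0 0] by simp
  next
    case (insert m M)
    then show ?case using add[OF single] by simp
  qed
  then show ?thesis by (subst poly_mapping_sum_single) simp
qed

lemma eval_alg_mult: "eval_alg (p * q) = eval_alg p * eval_alg q"
proof (induction p rule: mpoly_induct)
  case (single m c)
  show ?case
  proof (induction q rule: mpoly_induct)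
    case (single m' c')
    show ?case by (simp add: mult_single mon_alg_add scalar_mult ac_simps)
  next
    case (add p q)
    then show ?case by (simp add: distrib_left eval_alg_add)
  qed
next
  case (add p q)
  then show ?case by (simp add: distrib_right eval_alg_add)
qed

lemma eval_alg_0 [simp]: "eval_alg 0 = 0"
  by (simp add: eval_alg_def)

lemma eval_alg_1 [simp]: "eval_alg 1 = 1"
  using eval_alg_single[of 0 1] by (simp del: eval_alg_single)

lemma eval_alg_uminus: "eval_alg (- p) = - eval_alg p"
  using eval_alg_add[of p "- p"] by (simp add: eq_neg_iff_add_eq_0 add.commute)

lemma eval_alg_diff: "eval_alg (p - q) = eval_alg p - eval_alg q"
  using eval_alg_add[of p "- q"] by (simp add: eval_alg_uminus)

lemma eval_alg_sum: "eval_alg (\<Sum>i \<in> X. f i) = (\<Sum>i \<in> X. eval_alg (f i))"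
  by (induction X rule: infinite_finite_induct) (auto simp: eval_alg_add)

lemma eval_alg_power: "eval_alg (p ^ n) = eval_alg p ^ n"
  by (induction n) (auto simp: eval_alg_mult)

definition poly_const :: "rat \<Rightarrow> rat mpoly" where
  "poly_const c = Poly_Mapping.single 0 c"

lemma eval_alg_const [simp]: "eval_alg (poly_const c) = scalar c"
  by (simp add: poly_const_def)

definition polyU :: "rat mpoly" where "polyU = varS + varT - 1"
definition polyV :: "rat mpoly" where "polyV = varS - varT"
definition polyX :: "nat \<Rightarrow> rat mpoly" where "polyX i = varD i - 1"

lemma eval_alg_varS: "eval_alg varS = scalar (1/2) * theta 1 1 (\<lambda>i. 0)"
  and eval_alg_varT: "eval_alg varT = scalar (1/2) * theta (-1) 1 (\<lambda>i. 0)"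
  and eval_alg_varD: "eval_alg (varD i) = theta 0 0 (\<lambda>j. if i = j then 1 else 0)"
  by (simp_all add: varS_def varT_def varD_def mvar_def mon_alg_def lookup_single when_def if_distrib[of of_nat] cong: if_cong)

definition algU :: alg where "algU = Alg 0 0 0 0 0 (\<lambda>i. 0) 1 (\<lambda>i. 0) (\<lambda>i j. 0)"
definition algV :: alg where "algV = Alg 0 1 0 0 0 (\<lambda>i. 0) 0 (\<lambda>i. 0) (\<lambda>i j. 0)"
definition algX :: "nat \<Rightarrow> alg" where
  "algX l = Alg 0 0 0 0 0 (\<lambda>i. if i = l then 1 else 0) 0 (\<lambda>i. 0) (\<lambda>i j. 0)"

lemma algUVX [simp]:
  "a0 algU = 0" "a1 algU = 0" "a2 algU = 0" "a3 algU = 0" "a4 algU = 0" "xc algU i = 0" "wu algU = 1" "wv algU i = 0" "wx algU i j = 0"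
  "a0 algV = 0" "a1 algV = 1" "a2 algV = 0" "a3 algV = 0" "a4 algV = 0" "xc algV i = 0" "wu algV = 0" "wv algV i = 0" "wx algV i j = 0"
  "a0 (algX l) = 0" "a1 (algX l) = 0" "a2 (algX l) = 0" "a3 (algX l) = 0" "a4 (algX l) = 0"
  "xc (algX l) i = (if i = l then 1 else 0)" "wu (algX l) = 0" "wv (algX l) i = 0" "wx (algX l) i j = 0"
  by (simp_all add: algU_def algV_def algX_def)

lemma eval_alg_UVX [simp]: "eval_alg polyU = algU" "eval_alg polyV = algV" "eval_alg (polyX i) = algX i"
  by (auto intro!: alg_eqI simp: polyU_def polyV_def polyX_def eval_alg_add eval_alg_diff eval_alg_varS eval_alg_varT eval_alg_varD)

subsection \<open>The polynomial ring\<close>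

lemma carrier_mpoly: "p \<in> carrier (mpoly_ring k) \<longleftrightarrow> mvars p \<subseteq> {..<k}"
  by (simp add: mpoly_ring_def)

lemma mpoly_ring_simps [simp]:
  "p \<otimes>\<^bsub>mpoly_ring k\<^esub> q = p * q" "p \<oplus>\<^bsub>mpoly_ring k\<^esub> q = p + q" "\<one>\<^bsub>mpoly_ring k\<^esub> = 1" "\<zero>\<^bsub>mpoly_ring k\<^esub> = 0"
  by (simp_all add: mpoly_ring_def)

lemma carrier_add: "p \<in> carrier (mpoly_ring k) \<Longrightarrow> q \<in> carrier (mpoly_ring k) \<Longrightarrow> p + q \<in> carrier (mpoly_ring k)"
  using mvars_add[of p q] by (auto simp: carrier_mpoly)

lemma carrier_uminus: "p \<in> carrier (mpoly_ring k) \<Longrightarrow> - p \<in> carrier (mpoly_ring k)" for p :: "'a::comm_ring_1 mpoly"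
  by (simp add: carrier_mpoly mvars_def)

lemma carrier_diff: "p \<in> carrier (mpoly_ring k) \<Longrightarrow> q \<in> carrier (mpoly_ring k) \<Longrightarrow> p - q \<in> carrier (mpoly_ring k)"
  for p :: "'a::comm_ring_1 mpoly"
  using carrier_add[of p k "- q"] carrier_uminus[of q k] by simp

lemma carrier_mult: "p \<in> carrier (mpoly_ring k) \<Longrightarrow> q \<in> carrier (mpoly_ring k) \<Longrightarrow> p * q \<in> carrier (mpoly_ring k)"
  for p :: "'a::comm_ring_1 mpoly"
  using mvars_mult[of p q] by (auto simp: carrier_mpoly)

lemma carrier_0: "0 \<in> carrier (mpoly_ring k)" and carrier_1: "1 \<in> carrier (mpoly_ring k)"
  by (auto simp: carrier_mpoly mvars_def)

lemma carrier_power: "p \<in> carrier (mpoly_ring k) \<Longrightarrow> p ^ n \<in> carrier (mpoly_ring k)" for p :: "'a::comm_ring_1 mpoly"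
  by (induction n) (auto intro: carrier_mult carrier_1)

lemma carrier_sum: "(\<And>i. i \<in> X \<Longrightarrow> f i \<in> carrier (mpoly_ring k)) \<Longrightarrow> sum f X \<in> carrier (mpoly_ring k)"
  by (induction X rule: infinite_finite_induct) (auto intro: carrier_add carrier_0)

lemma carrier_prod: "(\<And>i. i \<in> X \<Longrightarrow> f i \<in> carrier (mpoly_ring k)) \<Longrightarrow> prod f X \<in> carrier (mpoly_ring k)"
  for f :: "_ \<Rightarrow> 'a::comm_ring_1 mpoly"
  by (induction X rule: infinite_finite_induct) (auto intro: carrier_mult carrier_1)

lemma carrier_const: "poly_const c \<in> carrier (mpoly_ring k)"
  by (auto simp: carrier_mpoly mvars_def poly_const_def split: if_splits)

lemma carrier_mvar: "i < k \<Longrightarrow> mvar i \<in> carrier (mpoly_ring k)"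
  by (auto simp: carrier_mpoly mvars_def mvar_def split: if_splits)

lemma carrier_numeral: "numeral n \<in> carrier (mpoly_ring k)"
proof -
  have "of_nat m \<in> carrier (mpoly_ring k)" for m
    by (induction m) (auto intro: carrier_add carrier_0 carrier_1)
  from this[of "numeral n"] show ?thesis by simp
qed

lemma carrier_varS: "0 < k \<Longrightarrow> varS \<in> carrier (mpoly_ring k)" and carrier_varT: "1 < k \<Longrightarrow> varT \<in> carrier (mpoly_ring k)"
  and carrier_varD: "i + 2 < k \<Longrightarrow> varD i \<in> carrier (mpoly_ring k)"
  unfolding varS_def varT_def varD_def by (auto intro: carrier_mvar)

lemma carrier_UVX: "1 < k \<Longrightarrow> polyU \<in> carrier (mpoly_ring k)" "1 < k \<Longrightarrow> polyV \<in> carrier (mpoly_ring k)"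
  "i + 2 < k \<Longrightarrow> polyX i \<in> carrier (mpoly_ring k)"
  by (auto simp: polyU_def polyV_def polyX_def intro!: carrier_add carrier_diff carrier_varS carrier_varT carrier_varD carrier_1)

lemmas carrier_rules = carrier_add carrier_uminus carrier_diff carrier_mult carrier_0 carrier_1 carrier_power
  carrier_sum carrier_prod carrier_const carrier_numeral carrier_varS carrier_varT carrier_varD carrier_UVX

lemma single_add_mvar: "Poly_Mapping.single (Poly_Mapping.single i n + m) c = mvar i ^ n * Poly_Mapping.single m (c :: 'a::comm_ring_1)"
proof (induction n)
  case (Suc n)
  have "Poly_Mapping.single i (Suc n) + m = Poly_Mapping.single i 1 + (Poly_Mapping.single i n + m)"
    by (simp add: single_add[symmetric] flip: add.assoc)
  then have "Poly_Mapping.single (Poly_Mapping.single i (Suc n) + m) c =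
      mvar i * Poly_Mapping.single (Poly_Mapping.single i n + m) c"
    by (simp add: mvar_def mult_single)
  then show ?case by (simp add: Suc mult.assoc)
qed simp

lemma carrier_mpoly_induct [consumes 1, case_names const add mvar]:
  fixes p :: "rat mpoly"
  assumes "p \<in> carrier (mpoly_ring k)"
    and const: "\<And>c. P (poly_const c)" and add: "\<And>p q. P p \<Longrightarrow> P q \<Longrightarrow> P (p + q)"
    and mvar: "\<And>i p. i < k \<Longrightarrow> P p \<Longrightarrow> P (mvar i * p)"
  shows "P p"
proof -
  have pow: "P (mvar i ^ n * p)" if "i < k" "P p" for i n p
    using that by (induction n) (auto simp: mult.assoc mvar)
  have *: "P (Poly_Mapping.single (\<Sum>i \<in> X. Poly_Mapping.single i (f i)) c)" if "finite X" "X \<subseteq> {..<k}" for X f c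
    using that
  proof (induction X rule: finite_induct)
    case empty
    then show ?case using const[of c] by (simp add: poly_const_def)
  next
    case (insert i X)
    then show ?case by (simp add: single_add_mvar pow)
  qed
  have single: "P (Poly_Mapping.single m c)" if "m \<in> Poly_Mapping.keys p" for m c
    using *[of "Poly_Mapping.keys m" "Poly_Mapping.lookup m" c] that assms(1)
    by (subst poly_mapping_sum_single[of m]) (auto simp: carrier_mpoly mvars_def)
  have 0: "P 0" using const[of 0] by (simp add: poly_const_def)
  have *: "P (\<Sum>m \<in> M. Poly_Mapping.single m (Poly_Mapping.lookup p m))"
    if "finite M" "M \<subseteq> Poly_Mapping.keys p" for M
    using that by (induction M rule: finite_induct) (auto intro: add single 0)
  show ?thesis
    using *[of "Poly_Mapping.keys p"] by (subst poly_mapping_sum_single[of p]) simp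
qed

lemma poly_const_simps: "poly_const 0 = 0" "poly_const 1 = 1" "poly_const (c + d) = poly_const c + poly_const d"
  "poly_const (c * d) = poly_const c * poly_const d" "poly_const (- c) = - poly_const c" "poly_const (c - d) = poly_const c - poly_const d"
  by (simp_all add: poly_const_def single_add mult_single single_uminus single_diff)


lemma alg_sum [simp]: "a0 (sum f X) = (\<Sum>i\<in>X. a0 (f i))" "a1 (sum f X) = (\<Sum>i\<in>X. a1 (f i))"
  "a2 (sum f X) = (\<Sum>i\<in>X. a2 (f i))" "a3 (sum f X) = (\<Sum>i\<in>X. a3 (f i))" "a4 (sum f X) = (\<Sum>i\<in>X. a4 (f i))"
  "xc (sum f X) j = (\<Sum>i\<in>X. xc (f i) j)" "wx (sum f X) j l = (\<Sum>i\<in>X. wx (f i) j l)"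
  by (induction X rule: infinite_finite_induct; simp)+


subsection \<open>The ideal attached to a system of quadratic equations\<close>

text \<open>
  An equation is a list of terms \<open>(c, i, j)\<close>, which stand for \<open>c y\<^sub>i y\<^sub>j\<close> with \<open>y\<^sub>0 = 1\<close>; the
  index \<open>Suc i\<close> belongs to the variable \<open>D i\<close>. The coordinates of the last component of the
  algebra are numbered in the same way.
\<close>

type_synonym equation = "(int \<times> nat \<times> nat) list"

fun coord :: "alg \<Rightarrow> nat \<Rightarrow> nat \<Rightarrow> rat" where
  "coord A 0 0 = wu A"
| "coord A 0 (Suc j) = wv A j"
| "coord A (Suc i) 0 = wv A i"
| "coord A (Suc i) (Suc j) = wx A i j"

definition functional :: "equation \<Rightarrow> alg \<Rightarrow> rat" where
  "functional E A = (\<Sum>(c, i, j) \<leftarrow> E. of_int c * coord A i j)"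

lemma functional_simps [simp]: "functional [] A = 0"
  "functional ((c, i, j) # E) A = of_int c * coord A i j + functional E A"
  by (simp_all add: functional_def)

lemma coord_add: "coord (A + B) i j = coord A i j + coord B i j"
  by (cases i; cases j) auto

lemma functional_add: "functional E (A + B) = functional E A + functional E B"
  by (induction E) (auto simp: coord_add algebra_simps)

lemma functional_0: "functional E 0 = 0"
  using functional_add[of E 0 0] by simp

lemma functional_sum: "functional E (\<Sum>i \<in> X. f i) = (\<Sum>i \<in> X. functional E (f i))"
  by (induction X rule: infinite_finite_induct) (auto simp: functional_add functional_0)

text \<open>If the components along \<open>1\<close>, \<open>v\<close> and \<open>x\<^sub>i\<close>
  vanish, a factor acts on the last component through its residue \<open>a0 B\<close> alone. Hence
  every functional, whatever the equation, has a kernel stable under multiplication.\<close>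

lemma coord_scale: "xc A = (\<lambda>i. 0) \<Longrightarrow> a1 A = 0 \<Longrightarrow> a0 A = 0 \<Longrightarrow> coord (B * A) i j = a0 B * coord A i j"
  by (cases i; cases j) auto

lemma functional_scale:
  "xc A = (\<lambda>i. 0) \<Longrightarrow> a1 A = 0 \<Longrightarrow> a0 A = 0 \<Longrightarrow> functional E (B * A) = a0 B * functional E A"
  by (induction E) (auto simp: coord_scale distrib_left mult.left_commute)

lemma functional_scalar: "functional E (scalar c * A) = c * functional E A"
proof -
  have "coord (scalar c * A) i j = c * coord A i j" for i j by (cases i; cases j) auto
  then show ?thesis by (induction E) (auto simp: algebra_simps)
qed

text \<open>The constant \<open>y\<^sub>0 = 1\<close> is represented by \<open>v\<close>, so that
  \<open>v x\<^sub>i\<close> carries the linear terms. Its square is carried by \<open>u\<close>,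
  because \<open>v\<^sup>2\<close> serves to compare exponents of \<open>S\<close> and
  \<open>T\<close>.\<close>

definition hvar :: "nat \<Rightarrow> rat mpoly" where
  "hvar i = (case i of 0 \<Rightarrow> polyV | Suc j \<Rightarrow> polyX j)"

text \<open>The factor \<open>2\<close> makes the functionals of \<open>pair_poly i j\<close> uniform in \<open>i\<close> and \<open>j\<close>.\<close>

definition pair_poly :: "nat \<Rightarrow> nat \<Rightarrow> rat mpoly" where
  "pair_poly i j = (if i = 0 \<and> j = 0 then 2 * polyU else hvar i * hvar j)"

text \<open>An entry of the matrix of the polar form: the coefficient of
  \<open>y\<^sub>i y\<^sub>j\<close>, doubled on the diagonal.\<close>

definition pair_coeff :: "equation \<Rightarrow> nat \<Rightarrow> nat \<Rightarrow> int" where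
  "pair_coeff E i j = (\<Sum>(c, i', j') \<leftarrow> E. c * (of_bool (i' = i \<and> j' = j) + of_bool (i' = j \<and> j' = i)))"

lemma pair_coeff_simps [simp]: "pair_coeff [] i j = 0"
  "pair_coeff ((c, i', j') # E) i j = c * (of_bool (i' = i \<and> j' = j) + of_bool (i' = j \<and> j' = i)) + pair_coeff E i j"
  by (simp_all add: pair_coeff_def)

lemma coord_pair_poly: "coord (eval_alg (pair_poly i j)) k l = of_bool (k = i \<and> l = j) + of_bool (k = j \<and> l = i)"
proof -
  have "(2 :: rat mpoly) = poly_const 2" by (simp add: poly_const_def)
  then have "eval_alg (2 * polyU) = scalar 2 * algU"
    by (simp only: eval_alg_mult eval_alg_const eval_alg_UVX)
  then show ?thesis
    by (cases i; cases j; cases k; cases l) (auto simp: pair_poly_def hvar_def eval_alg_mult)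
qed

lemma functional_pair_poly: "functional E (eval_alg (pair_poly i j)) = of_int (pair_coeff E i j)"
  by (induction E) (auto simp: coord_pair_poly)

text \<open>
  The variable \<open>D (n + k)\<close> is a dummy variable that is added to the left hand side of the equation
  number \<open>k\<close>; its square is subject to the equation \<open>y\<^sup>2 = 0\<close>.
\<close>

definition extended :: "nat \<Rightarrow> equation list \<Rightarrow> nat \<Rightarrow> equation" where
  "extended n eqs k = (1, 0, Suc (n + k)) # eqs ! k"

locale quadratic_system =
  fixes n :: nat and eqs :: "equation list"
  assumes indices: "\<And>E c i j. E \<in> set eqs \<Longrightarrow> (c, i, j) \<in> set E \<Longrightarrow> i \<le> n \<and> j \<le> n"
begin

abbreviation r :: nat where "r \<equiv> length eqs"
abbreviation N :: nat where "N \<equiv> n + r"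

text \<open>The pivots \<open>polyV * polyX (n + k)\<close> are dual to the functionals; subtracting
  each of them with the value of its functional moves the product into the common kernel.\<close>

definition rel_poly :: "nat \<Rightarrow> nat \<Rightarrow> rat mpoly" where
  "rel_poly i j = pair_poly i j -
     (\<Sum>k<r. poly_const (of_int (pair_coeff (extended n eqs k) i j)) * (polyV * polyX (n + k)))"

text \<open>Squares of dummy variables are excluded from the relations: they violate the condition
  that encodes \<open>y\<^sup>2 = 0\<close>. The cubics help to make the pivots and these squares
  annihilated by the maximal ideal.\<close>

definition gens :: "rat mpoly set" where
  "gens = {rel_poly i j | i j. i \<le> N \<and> j \<le> N \<and> \<not> (i = j \<and> n < i)} \<union>
     (\<Union>k<r. {polyV ^ 2 * polyX (n + k), polyV * polyX (n + k) ^ 2, polyX (n + k) ^ 3}) \<union> {polyV ^ 5}"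

definition ker :: "alg set" where
  "ker = {A. a0 A = 0 \<and> a1 A = 0 \<and> a2 A = 0 \<and> a3 A = 0 \<and> a4 A = 0 \<and> xc A = (\<lambda>i. 0) \<and>
     (\<forall>k<r. functional (extended n eqs k) A = 0 \<and> wx A (n + k) (n + k) = 0)}"

definition sys_ideal :: "rat mpoly set" where
  "sys_ideal = {p \<in> carrier (STD_ring N). eval_alg p \<in> ker}"

lemma ker_add: "A \<in> ker \<Longrightarrow> B \<in> ker \<Longrightarrow> A + B \<in> ker"
  by (simp add: ker_def functional_add fun_eq_iff)

lemma ker_mult: "A \<in> ker \<Longrightarrow> B * A \<in> ker"
  by (simp add: ker_def functional_scale fun_eq_iff)

lemma ker_mult': "A \<in> ker \<Longrightarrow> A * B \<in> ker"
  using ker_mult by (simp add: mult.commute)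

lemma ker_0: "0 \<in> ker"
  by (simp add: ker_def functional_0 fun_eq_iff)

text \<open>The original equations mention indices up to \<open>n\<close> only, so a dummy variable
  is seen by one functional, through its product with the constant.\<close>

lemma pair_coeff_extended:
  assumes "k < r" "l < r" "i \<le> N" "i \<noteq> Suc (n + l)"
  shows "pair_coeff (extended n eqs k) (Suc (n + l)) i = of_bool (i = 0 \<and> k = l)"
proof -
  have "pair_coeff E (Suc (n + l)) i = 0" if "\<forall>t \<in> set E. fst (snd t) \<le> n \<and> snd (snd t) \<le> n" for E
    using that
  proof (induction E)
    case (Cons t E)
    then show ?case by (cases t) (simp add: of_bool_def)
  qed simp
  moreover have "\<forall>t \<in> set (eqs ! k). fst (snd t) \<le> n \<and> snd (snd t) \<le> n"
    using indices[OF nth_mem[OF assms(1)]] by fastforce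
  ultimately have "pair_coeff (eqs ! k) (Suc (n + l)) i = 0" by blast
  then show ?thesis using assms by (auto simp: extended_def)
qed

lemma sys_ideal_ideal: "ideal sys_ideal (STD_ring N)"
proof -
  interpret R: cring "STD_ring N :: rat mpoly ring" by (rule cring_mpoly_ring)
  show ?thesis
  proof (rule idealI[OF R.ring_axioms])
    show "subgroup sys_ideal (add_monoid (STD_ring N))"
    proof (rule R.add.subgroupI)
      show "sys_ideal \<noteq> {}" using ker_0 carrier_0 by (force simp: sys_ideal_def)
      fix a assume a: "a \<in> sys_ideal"
      have "- a \<in> sys_ideal"
        using a ker_mult[of "eval_alg a" "- 1"] by (auto simp: sys_ideal_def eval_alg_uminus intro: carrier_uminus)
      moreover have "\<ominus>\<^bsub>STD_ring N\<^esub> a = - a"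
        using a by (intro R.minus_equality) (auto simp: sys_ideal_def intro: carrier_uminus)
      ultimately show "\<ominus>\<^bsub>STD_ring N\<^esub> a \<in> sys_ideal" by simp
    qed (auto simp: sys_ideal_def eval_alg_add intro: carrier_add ker_add)
  qed (auto simp: sys_ideal_def eval_alg_mult intro: carrier_mult ker_mult ker_mult')
qed

lemma gens_carrier: "gens \<subseteq> carrier (STD_ring N)"
proof -
  have "hvar i \<in> carrier (STD_ring N)" if "i \<le> N" for i
    using that by (cases i) (auto simp: hvar_def intro!: carrier_rules)
  then have "pair_poly i j \<in> carrier (STD_ring N)" if "i \<le> N" "j \<le> N" for i j
    using that by (auto simp: pair_poly_def intro!: carrier_rules)
  then show ?thesis
    by (auto simp: gens_def rel_poly_def intro!: carrier_rules)
qed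

lemma functional_VX: "k < r \<Longrightarrow> l < r \<Longrightarrow> functional (extended n eqs k) (algV * algX (n + l)) = of_bool (k = l)"
  using functional_pair_poly[of "extended n eqs k" "Suc (n + l)" 0] pair_coeff_extended[of k l 0]
  by (simp add: pair_poly_def hvar_def eval_alg_mult mult.commute)

lemma functional_XX:
  assumes "k < r" "l < r"
  shows "functional (extended n eqs k) (algX (n + l) * algX (n + l)) = 0"
proof -
  have "functional E (algX (n + l) * algX (n + l)) = 0" if "\<forall>t \<in> set E. fst (snd t) \<le> n \<and> snd (snd t) \<le> n" for E
    using that
  proof (induction E)
    case (Cons t E)
    obtain c i j where t: "t = (c, i, j)" by (cases t)
    have "coord (algX (n + l) * algX (n + l)) i j = 0"
      using Cons.prems t by (cases i; cases j) auto
    with Cons t show ?case by simp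
  qed simp
  moreover have "\<forall>t \<in> set (eqs ! k). fst (snd t) \<le> n \<and> snd (snd t) \<le> n"
    using indices[OF nth_mem[OF assms(1)]] by fastforce
  ultimately show ?thesis by (simp add: extended_def)
qed

lemma gens_ideal: "gens \<subseteq> sys_ideal"
proof
  fix g assume g: "g \<in> gens"
  consider i j where "g = rel_poly i j" "i \<le> N" "j \<le> N" "\<not> (i = j \<and> n < i)"
    | k where "k < r" "g \<in> {polyV ^ 2 * polyX (n + k), polyV * polyX (n + k) ^ 2, polyX (n + k) ^ 3}"
    | "g = polyV ^ 5"
    using g unfolding gens_def by blast
  then have "eval_alg g \<in> ker"
  proof cases
    case (1 i j)
    let ?A = "eval_alg (pair_poly i j)"
    let ?B = "\<Sum>k<r. scalar (of_int (pair_coeff (extended n eqs k) i j)) * (algV * algX (n + k))"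
    have g: "eval_alg g = ?A + - 1 * ?B"
      by (simp add: 1(1) rel_poly_def eval_alg_diff eval_alg_sum eval_alg_mult)
    have "functional (extended n eqs k) ?B = of_int (pair_coeff (extended n eqs k) i j)" if "k < r" for k
    proof -
      have "functional (extended n eqs k) ?B =
          (\<Sum>l<r. if l = k then of_int (pair_coeff (extended n eqs l) i j) else 0)"
        unfolding functional_sum functional_scalar using that by (intro sum.cong) (auto simp: functional_VX)
      then show ?thesis using that by simp
    qed
    then have "functional (extended n eqs k) (eval_alg g) = 0" if "k < r" for k
      unfolding g functional_add functional_pair_poly
      using functional_scalar[of "extended n eqs k" "- 1" ?B] that by (simp add: scalar_def one_alg_def uminus_alg_def)
    moreover have "wx ?A (n + k) (n + k) = 0" for k
      using coord_pair_poly[of i j "Suc (n + k)" "Suc (n + k)"] 1(4) by auto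
    moreover have "a0 ?A = 0" "a1 ?A = 0" "a2 ?A = 0" "a3 ?A = 0" "a4 ?A = 0" "xc ?A l = 0" for l
      by (cases i; cases j; simp add: pair_poly_def hvar_def eval_alg_mult)+
    ultimately show ?thesis
      by (simp add: ker_def g fun_eq_iff)
  next
    case (2 k)
    then have "eval_alg g = 0"
      by (auto intro!: alg_eqI simp: eval_alg_mult eval_alg_power power2_eq_square power3_eq_cube)
    then show ?thesis by (simp add: ker_0)
  next
    case 3
    have "algV ^ 5 = 0"
      by (auto intro!: alg_eqI simp: eval_nat_numeral)
    then have "eval_alg g = 0" by (simp add: 3 eval_alg_power)
    then show ?thesis by (simp add: ker_0)
  qed
  then show "g \<in> sys_ideal" using g gens_carrier by (auto simp: sys_ideal_def)
qed

end

section \<open>The generators generate the whole kernel ideal\<close>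

context quadratic_system
begin

definition gen_ideal :: "rat mpoly set" where
  "gen_ideal = genideal (STD_ring N) gens"

lemma gen_ideal_ideal: "ideal gen_ideal (STD_ring N)"
  unfolding gen_ideal_def using gens_carrier
  by (intro ring.genideal_ideal cring.axioms(1) cring_mpoly_ring)

lemma gen_ideal_subset: "gen_ideal \<subseteq> sys_ideal"
  unfolding gen_ideal_def
  by (intro ring.genideal_minimal cring.axioms(1) cring_mpoly_ring sys_ideal_ideal gens_ideal)

lemma gen_ideal_gens: "g \<in> gens \<Longrightarrow> g \<in> gen_ideal"
  unfolding gen_ideal_def using ring.genideal_self[OF cring.axioms(1)[OF cring_mpoly_ring] gens_carrier] by auto

lemma gen_ideal_add: "p \<in> gen_ideal \<Longrightarrow> q \<in> gen_ideal \<Longrightarrow> p + q \<in> gen_ideal"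
  using additive_subgroup.a_closed[OF ideal.axioms(1)[OF gen_ideal_ideal], of p q] by simp

lemma gen_ideal_0: "0 \<in> gen_ideal"
  using additive_subgroup.zero_closed[OF ideal.axioms(1)[OF gen_ideal_ideal]] by simp

lemma gen_ideal_mult: "p \<in> gen_ideal \<Longrightarrow> c \<in> carrier (STD_ring N) \<Longrightarrow> c * p \<in> gen_ideal"
  using ideal.I_l_closed[OF gen_ideal_ideal, of p c] by simp

lemma gen_ideal_sum: "(\<And>i. i \<in> X \<Longrightarrow> f i \<in> gen_ideal) \<Longrightarrow> sum f X \<in> gen_ideal"
  by (induction X rule: infinite_finite_induct) (auto intro: gen_ideal_add gen_ideal_0)

lemma rel_poly_gens: "i \<le> N \<Longrightarrow> j \<le> N \<Longrightarrow> \<not> (i = j \<and> n < i) \<Longrightarrow> rel_poly i j \<in> gen_ideal"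
  by (rule gen_ideal_gens) (auto simp: gens_def)

lemma cubic_gens:
  assumes "k < r"
  shows "polyV ^ 2 * polyX (n + k) \<in> gen_ideal" "polyV * polyX (n + k) ^ 2 \<in> gen_ideal" "polyX (n + k) ^ 3 \<in> gen_ideal"
  using assms by (auto intro!: gen_ideal_gens simp: gens_def)

lemma pair_poly_rel: "pair_poly i j = rel_poly i j +
    (\<Sum>k<r. poly_const (of_int (pair_coeff (extended n eqs k) i j)) * (polyV * polyX (n + k)))"
  by (simp add: rel_poly_def)

lemma dummy_X:
  assumes "k < r" "i < N" "i \<noteq> n + k"
  shows "polyX (n + k) * polyX i \<in> gen_ideal"
proof -
  have "pair_coeff (extended n eqs l) (Suc (n + k)) (Suc i) = 0" if "l < r" for l
    using pair_coeff_extended[of l k "Suc i"] assms that by simp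
  then have "rel_poly (Suc (n + k)) (Suc i) = polyX (n + k) * polyX i"
    by (simp add: rel_poly_def pair_poly_def hvar_def poly_const_simps)
  then show ?thesis
    using rel_poly_gens[of "Suc (n + k)" "Suc i"] assms by simp
qed

lemma V_VX: "k < r \<Longrightarrow> polyV * (polyV * polyX (n + k)) \<in> gen_ideal"
  using cubic_gens(1)[of k] by (simp add: power2_eq_square ac_simps)

lemma X_VX:
  assumes "k < r" "i < N" shows "polyX i * (polyV * polyX (n + k)) \<in> gen_ideal"
proof (cases "i = n + k")
  case True
  then show ?thesis using cubic_gens(2)[OF assms(1)] by (simp add: power2_eq_square ac_simps)
next
  case False
  have "polyV * (polyX (n + k) * polyX i) \<in> gen_ideal"
    by (rule gen_ideal_mult[OF dummy_X[OF assms False] carrier_UVX(2)]) simp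
  then show ?thesis by (simp add: ac_simps)
qed

text \<open>Modulo the ideal each product is a combination of pivots, so a factor that annihilates
  the pivots annihilates all of them.\<close>

lemma mult_pair_poly:
  assumes "y \<in> carrier (STD_ring N)" "\<And>k. k < r \<Longrightarrow> y * (polyV * polyX (n + k)) \<in> gen_ideal"
    and "i \<le> N" "j \<le> N" "\<not> (i = j \<and> n < i)"
  shows "y * pair_poly i j \<in> gen_ideal"
proof -
  have "(\<Sum>k<r. poly_const (of_int (pair_coeff (extended n eqs k) i j)) * (y * (polyV * polyX (n + k)))) \<in> gen_ideal"
    using assms(2) by (intro gen_ideal_sum gen_ideal_mult[OF _ carrier_const]) auto
  moreover have "y * rel_poly i j \<in> gen_ideal"
    using gen_ideal_mult[OF rel_poly_gens[OF assms(3-5)] assms(1)] .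
  ultimately show ?thesis
    unfolding pair_poly_rel using gen_ideal_add by (simp add: distrib_left sum_distrib_left mult.left_commute)
qed

lemma U_half: "polyU = poly_const (1/2) * pair_poly 0 0"
proof -
  have "poly_const (1/2) * 2 = 1"
    using poly_const_simps(4)[of "1/2" 2] by (simp add: poly_const_simps(2)) (simp add: poly_const_def)
  then show ?thesis by (simp add: pair_poly_def flip: mult.assoc)
qed

lemma mult_U:
  assumes "y \<in> carrier (STD_ring N)" "\<And>k. k < r \<Longrightarrow> y * (polyV * polyX (n + k)) \<in> gen_ideal"
  shows "polyU * y \<in> gen_ideal"
proof -
  have "poly_const (1/2) * (y * pair_poly 0 0) \<in> gen_ideal"
    by (rule gen_ideal_mult[OF mult_pair_poly[OF assms] carrier_const]) auto
  then show ?thesis by (simp add: U_half ac_simps)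
qed

text \<open>Representatives of a vector space basis of the quotient: their span is stable under all
  variables, and the coordinates and functionals that define \<open>ker\<close> separate
  them.\<close>

definition basis :: "rat mpoly set" where
  "basis = {polyV ^ a | a. a < 5} \<union> {polyX i | i. i < N} \<union> (\<Union>k<r. {polyV * polyX (n + k), polyX (n + k) ^ 2})"

lemma basis_mem: "a < 5 \<Longrightarrow> polyV ^ a \<in> basis" "i < N \<Longrightarrow> polyX i \<in> basis"
  "k < r \<Longrightarrow> polyV * polyX (n + k) \<in> basis" "k < r \<Longrightarrow> polyX (n + k) ^ 2 \<in> basis"
  unfolding basis_def by blast+

inductive_set reduced :: "rat mpoly set" where
  reduced_ideal: "p \<in> gen_ideal \<Longrightarrow> p \<in> reduced"
| reduced_basis: "p \<in> basis \<Longrightarrow> p \<in> reduced"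
| reduced_add: "p \<in> reduced \<Longrightarrow> q \<in> reduced \<Longrightarrow> p + q \<in> reduced"
| reduced_const: "p \<in> reduced \<Longrightarrow> poly_const c * p \<in> reduced"

lemma reduced_mult:
  assumes "p \<in> reduced" "y \<in> carrier (STD_ring N)" "\<And>b. b \<in> basis \<Longrightarrow> y * b \<in> reduced"
  shows "y * p \<in> reduced"
  using assms(1)
  by (induction rule: reduced.induct)
    (auto simp: distrib_left mult.left_commute[of y "poly_const _"] intro: reduced.intros gen_ideal_mult assms)

lemma reduced_sum: "(\<And>i. i \<in> X \<Longrightarrow> f i \<in> reduced) \<Longrightarrow> sum f X \<in> reduced"
  by (induction X rule: infinite_finite_induct) (auto intro: reduced_add reduced_ideal gen_ideal_0)

lemma reduced_pair_poly: "i \<le> N \<Longrightarrow> j \<le> N \<Longrightarrow> \<not> (i = j \<and> n < i) \<Longrightarrow> pair_poly i j \<in> reduced"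
  unfolding pair_poly_rel
  by (intro reduced_add reduced_sum reduced_const) (auto intro: reduced_ideal reduced_basis basis_mem rel_poly_gens)

lemma basisE:
  assumes "b \<in> basis"
  obtains a where "b = polyV ^ a" "a < 5" | i where "b = polyX i" "i < N"
    | k where "k < r" "b = polyV * polyX (n + k)" | k where "k < r" "b = polyX (n + k) ^ 2"
  using assms unfolding basis_def by blast

lemma V_basis: assumes "b \<in> basis" shows "polyV * b \<in> reduced"
  using assms
proof (cases rule: basisE)
  case (1 a)
  show ?thesis
  proof (cases "a = 4")
    case True
    have "polyV ^ 5 \<in> gen_ideal" by (rule gen_ideal_gens) (simp add: gens_def)
    then show ?thesis using 1 True by (simp add: reduced_ideal flip: power_Suc)
  next
    case False
    then have "polyV ^ Suc a \<in> basis" using 1 by (intro basis_mem) simp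
    then show ?thesis using 1 by (simp add: reduced_basis)
  qed
next
  case (2 i)
  then show ?thesis using reduced_pair_poly[of 0 "Suc i"] by (simp add: pair_poly_def hvar_def)
next
  case (3 k)
  then show ?thesis using V_VX reduced_ideal by simp
next
  case (4 k)
  then show ?thesis using cubic_gens(2) reduced_ideal by simp
qed

lemma X_basis: assumes "b \<in> basis" "i < N" shows "polyX i * b \<in> reduced"
  using assms(1)
proof (cases rule: basisE)
  case (1 a)
  consider "a = 0" | "a = 1" | c where "a = Suc (Suc c)" by (metis One_nat_def not0_implies_Suc)
  then show ?thesis
  proof cases
    case 1
    then show ?thesis using \<open>b = polyV ^ a\<close> assms(2) by (simp add: reduced_basis basis_mem)
  next
    case 2
    then show ?thesis using \<open>b = polyV ^ a\<close> assms(2) reduced_pair_poly[of "Suc i" 0] by (simp add: pair_poly_def hvar_def)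
  next
    case (3 c)
    \<comment> \<open>With at least two factors \<open>v\<close>, one of them annihilates the
      product \<open>x\<^sub>i v\<close>.\<close>
    have "polyV ^ c * (polyV * pair_poly (Suc i) 0) \<in> gen_ideal"
      by (rule gen_ideal_mult[OF mult_pair_poly]) (use assms(2) in \<open>auto intro!: carrier_rules V_VX\<close>)
    then show ?thesis
      using \<open>b = polyV ^ a\<close> 3 by (intro reduced_ideal) (simp add: pair_poly_def hvar_def ac_simps)
  qed
next
  case (2 j)
  show ?thesis
  proof (cases "i = j \<and> n \<le> i")
    case True
    moreover have "i - n < r" using True assms(2) by linarith
    ultimately have "polyX i * b \<in> basis"
      using basis_mem(4)[of "i - n"] 2(1) by (simp add: power2_eq_square)
    then show ?thesis by (rule reduced_basis)
  next
    case False
    then show ?thesis using 2 assms(2) reduced_pair_poly[of "Suc i" "Suc j"] by (auto simp: pair_poly_def hvar_def)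
  qed
next
  case (3 k)
  then show ?thesis using X_VX assms(2) reduced_ideal by simp
next
  case (4 k)
  show ?thesis
  proof (cases "i = n + k")
    case True
    then show ?thesis using 4 cubic_gens(3)[of k] by (intro reduced_ideal) (simp add: power2_eq_square power3_eq_cube mult.assoc)
  next
    case False
    have "polyX (n + k) * (polyX (n + k) * polyX i) \<in> gen_ideal"
      by (rule gen_ideal_mult[OF dummy_X]) (use 4 assms(2) False in \<open>auto intro!: carrier_rules\<close>)
    then show ?thesis using 4 by (intro reduced_ideal) (simp add: power2_eq_square ac_simps)
  qed
qed

lemma U_basis: assumes "b \<in> basis" shows "polyU * b \<in> reduced"
  using assms
proof (cases rule: basisE)
  case (1 a)
  show ?thesis
  proof (cases a)
    case 0
    then show ?thesis
      using 1 reduced_const[OF reduced_pair_poly[of 0 0], of "1/2"] by (simp add: U_half)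
  next
    case (Suc c)
    have "polyV ^ c * (polyU * polyV) \<in> gen_ideal"
      by (rule gen_ideal_mult[OF mult_U]) (auto intro!: carrier_rules V_VX)
    then show ?thesis using 1 Suc by (intro reduced_ideal) (simp add: ac_simps)
  qed
next
  case (2 i)
  then show ?thesis by (auto intro!: reduced_ideal mult_U X_VX carrier_rules)
next
  case (3 k)
  have "polyX (n + k) * (polyU * polyV) \<in> gen_ideal"
    by (rule gen_ideal_mult[OF mult_U]) (use 3 in \<open>auto intro!: carrier_rules V_VX\<close>)
  then show ?thesis using 3 by (intro reduced_ideal) (simp add: ac_simps)
next
  case (4 k)
  have "polyX (n + k) * (polyU * polyX (n + k)) \<in> gen_ideal"
    by (rule gen_ideal_mult[OF mult_U]) (use 4 in \<open>auto intro!: carrier_rules X_VX\<close>)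
  then show ?thesis using 4 by (intro reduced_ideal) (simp add: power2_eq_square ac_simps)
qed

text \<open>Since \<open>S = (1 + u + v) / 2\<close>, \<open>T = (1 + u - v) / 2\<close> and
  \<open>D\<^sub>j = 1 + x\<^sub>j\<close>, stability of the span under \<open>u\<close>,
  \<open>v\<close> and \<open>x\<^sub>j\<close> is enough.\<close>

lemma carrier_reduced: assumes "p \<in> carrier (STD_ring N)" shows "p \<in> reduced"
  using assms
proof (induction rule: carrier_mpoly_induct)
  case (const c)
  have "polyV ^ 0 \<in> reduced" by (intro reduced_basis basis_mem) simp
  then show ?case using reduced_const[of "polyV ^ 0" c] by simp
next
  case (add p q)
  then show ?case by (rule reduced_add)
next
  case (mvar i p)
  have U: "polyU * p \<in> reduced"
    by (rule reduced_mult[OF mvar(2) _ U_basis]) (auto intro!: carrier_rules)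
  have V: "polyV * p \<in> reduced"
    by (rule reduced_mult[OF mvar(2) _ V_basis]) (auto intro!: carrier_rules)
  have mV: "poly_const (-1) * (polyV * p) \<in> reduced" by (rule reduced_const[OF V])
  have half: "poly_const (1/2) * 2 = 1"
    using poly_const_simps(4)[of "1/2" 2] by (simp add: poly_const_simps(2)) (simp add: poly_const_def)
  consider "i = 0" | "i = 1" | j where "i = j + 2" by (metis One_nat_def add_2_eq_Suc' not0_implies_Suc)
  then show ?case
  proof cases
    case 1
    have "mvar i * p = (poly_const (1/2) * 2) * (varS * p)" by (simp add: half 1 varS_def)
    also have "\<dots> = poly_const (1/2) * (p + polyU * p + polyV * p)"
      by (simp add: polyU_def polyV_def algebra_simps)
    finally have eq: "mvar i * p = poly_const (1/2) * (p + polyU * p + polyV * p)" .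
    show ?thesis unfolding eq by (intro reduced_const[of _ "1/2"] reduced_add U V mvar(2))
  next
    case 2
    have "mvar i * p = (poly_const (1/2) * 2) * (varT * p)" unfolding half by (simp add: 2 varT_def)
    also have "\<dots> = poly_const (1/2) * (p + polyU * p + poly_const (-1) * (polyV * p))"
      by (simp add: polyU_def polyV_def algebra_simps poly_const_simps)
    finally have eq: "mvar i * p = poly_const (1/2) * (p + polyU * p + poly_const (-1) * (polyV * p))" .
    show ?thesis unfolding eq by (intro reduced_const[of _ "1/2"] reduced_add U mV mvar(2))
  next
    case (3 j)
    have "polyX j * p \<in> reduced"
      by (rule reduced_mult[OF mvar(2) _ X_basis]) (use 3 mvar(1) in \<open>auto intro!: carrier_rules\<close>)
    moreover have "mvar i * p = p + polyX j * p"
      by (simp add: polyX_def varD_def 3 algebra_simps)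
    ultimately show ?thesis using mvar(2) reduced_add by simp
  qed
qed

section \<open>Normal forms and their uniqueness\<close>

definition normal_form :: "(nat \<Rightarrow> rat) \<Rightarrow> (nat \<Rightarrow> rat) \<Rightarrow> (nat \<Rightarrow> rat) \<Rightarrow> (nat \<Rightarrow> rat) \<Rightarrow> rat mpoly" where
  "normal_form a b c d = (\<Sum>i<5. poly_const (a i) * polyV ^ i) + (\<Sum>i<N. poly_const (b i) * polyX i) +
     (\<Sum>k<r. poly_const (c k) * (polyV * polyX (n + k))) + (\<Sum>k<r. poly_const (d k) * polyX (n + k) ^ 2)"

lemma normal_form_add: "normal_form a b c d + normal_form a' b' c' d' =
    normal_form (\<lambda>i. a i + a' i) (\<lambda>i. b i + b' i) (\<lambda>i. c i + c' i) (\<lambda>i. d i + d' i)"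
  by (simp add: normal_form_def poly_const_simps distrib_right sum.distrib)

lemma normal_form_mult: "poly_const e * normal_form a b c d =
    normal_form (\<lambda>i. e * a i) (\<lambda>i. e * b i) (\<lambda>i. e * c i) (\<lambda>i. e * d i)"
  by (simp add: normal_form_def poly_const_simps distrib_left sum_distrib_left mult.assoc)

lemma normal_form_0: "normal_form (\<lambda>i. 0) (\<lambda>i. 0) (\<lambda>i. 0) (\<lambda>i. 0) = 0"
  by (simp add: normal_form_def poly_const_simps)

lemma sum_indicator: "finite X \<Longrightarrow> j \<in> X \<Longrightarrow> (\<Sum>i\<in>X. poly_const (of_bool (i = j)) * f i) = f j"
proof -
  assume "finite X" "j \<in> X"
  moreover have "(\<Sum>i\<in>X. poly_const (of_bool (i = j)) * f i) = (\<Sum>i\<in>X. if i = j then f i else 0)"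
    by (intro sum.cong) (auto simp: poly_const_simps)
  ultimately show ?thesis by simp
qed

lemma basis_normal_form: assumes "p \<in> basis" shows "\<exists>a b c d. p = normal_form a b c d"
  using assms
proof (cases rule: basisE)
  case (1 l)
  then have "p = normal_form (\<lambda>i. of_bool (i = l)) (\<lambda>i. 0) (\<lambda>i. 0) (\<lambda>i. 0)"
    by (simp add: normal_form_def sum_indicator poly_const_simps(1))
  then show ?thesis by blast
next
  case (2 l)
  then have "p = normal_form (\<lambda>i. 0) (\<lambda>i. of_bool (i = l)) (\<lambda>i. 0) (\<lambda>i. 0)"
    by (simp add: normal_form_def sum_indicator poly_const_simps(1))
  then show ?thesis by blast
next
  case (3 l)
  then have "p = normal_form (\<lambda>i. 0) (\<lambda>i. 0) (\<lambda>i. of_bool (i = l)) (\<lambda>i. 0)"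
    using sum_indicator[of "{..<r}" l "\<lambda>k. polyV * polyX (n + k)"]
    by (simp add: normal_form_def poly_const_simps(1))
  then show ?thesis by blast
next
  case (4 l)
  then have "p = normal_form (\<lambda>i. 0) (\<lambda>i. 0) (\<lambda>i. 0) (\<lambda>i. of_bool (i = l))"
    using sum_indicator[of "{..<r}" l "\<lambda>k. polyX (n + k) ^ 2"]
    by (simp add: normal_form_def poly_const_simps(1))
  then show ?thesis by blast
qed

lemma reduced_normal_form: "p \<in> reduced \<Longrightarrow> \<exists>q a b c d. q \<in> gen_ideal \<and> p = q + normal_form a b c d"
proof (induction rule: reduced.induct)
  case (reduced_ideal p)
  then show ?case using normal_form_0 by (metis add.right_neutral)
next
  case (reduced_basis p)
  then show ?case using basis_normal_form gen_ideal_0 by (metis add.left_neutral)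
next
  case (reduced_add p p')
  then obtain q a b c d q' a' b' c' d' where *: "q \<in> gen_ideal" "p = q + normal_form a b c d"
    "q' \<in> gen_ideal" "p' = q' + normal_form a' b' c' d'" by blast
  then have "p + p' = (q + q') + (normal_form a b c d + normal_form a' b' c' d')" by simp
  with * show ?case unfolding normal_form_add using gen_ideal_add by blast
next
  case (reduced_const p e)
  then obtain q a b c d where *: "q \<in> gen_ideal" "p = q + normal_form a b c d" by blast
  then have "poly_const e * p = poly_const e * q + poly_const e * normal_form a b c d" by (simp add: distrib_left)
  with * show ?case unfolding normal_form_mult using gen_ideal_mult carrier_const by blast
qed

text \<open>Each group of coefficients has its own conditions in \<open>ker\<close>:
  \<open>a\<close> the powers of \<open>v\<close>, \<open>b\<close> the coordinates
  \<open>xc\<close>, then \<open>c\<close> the functionals, to which the pivots are dual, and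
  \<open>d\<close> the diagonal of \<open>wx\<close>.\<close>

lemma normal_form_ker:
  assumes "eval_alg (normal_form a b c d) \<in> ker"
  shows "normal_form a b c d = 0"
proof -
  let ?A = "eval_alg (normal_form a b c d)"
  have ev: "?A = (\<Sum>i<5. scalar (a i) * algV ^ i) + (\<Sum>i<N. scalar (b i) * algX i) +
     (\<Sum>k<r. scalar (c k) * (algV * algX (n + k))) + (\<Sum>k<r. scalar (d k) * (algX (n + k) * algX (n + k)))"
    by (simp add: normal_form_def eval_alg_add eval_alg_sum eval_alg_mult eval_alg_power power2_eq_square)
  have 5: "{..<5} = {0, 1, 2, 3, 4::nat}" by auto
  have a: "a i = 0" if "i < 5" for i
    using assms that unfolding ker_def ev by (auto simp: 5 eval_nat_numeral less_Suc_eq)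
  have b: "b i = 0" if "i < N" for i
  proof -
    have "xc ?A i = (\<Sum>j<N. if j = i then b j else 0)"
      unfolding ev by (simp add: 5 eval_nat_numeral if_distrib[of "\<lambda>x. b _ * x"] cong: if_cong)
    then show ?thesis using assms that by (simp add: ker_def)
  qed
  have ev': "?A = (\<Sum>k<r. scalar (c k) * (algV * algX (n + k))) + (\<Sum>k<r. scalar (d k) * (algX (n + k) * algX (n + k)))"
    unfolding ev using a b by simp
  have c: "c l = 0" if "l < r" for l
  proof -
    have "functional (extended n eqs l) ?A = (\<Sum>k<r. c k * of_bool (l = k))"
      unfolding ev' functional_add functional_sum functional_scalar using that by (simp add: functional_VX functional_XX)
    also have "\<dots> = (\<Sum>k<r. if l = k then c k else 0)" by (intro sum.cong) auto
    finally show ?thesis using assms that by (simp add: ker_def)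
  qed
  have d: "d l = 0" if "l < r" for l
  proof -
    have "wx ?A (n + l) (n + l) = (\<Sum>k<r. wx (scalar (d k) * (algX (n + k) * algX (n + k))) (n + l) (n + l))"
      unfolding ev' alg_plus alg_sum by simp
    also have "\<dots> = (\<Sum>k<r. if l = k then 2 * d k else 0)" by (intro sum.cong) auto
    finally show ?thesis using assms that by (simp add: ker_def)
  qed
  show ?thesis
    unfolding normal_form_def using a b c d by (simp add: poly_const_simps)
qed

text \<open>The normal form of an element of the kernel ideal is again mapped to \<open>ker\<close>,
  because the generators are; so it is zero.\<close>

theorem gen_ideal_eq: "gen_ideal = sys_ideal"
proof
  show "sys_ideal \<subseteq> gen_ideal"
  proof
    fix p assume p: "p \<in> sys_ideal"
    then have "p \<in> reduced" by (intro carrier_reduced) (simp add: sys_ideal_def)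
    then obtain q a b c d where q: "q \<in> gen_ideal" "p = q + normal_form a b c d"
      using reduced_normal_form by blast
    then have "eval_alg (normal_form a b c d) = eval_alg p + - 1 * eval_alg q"
      by (simp add: eval_alg_add)
    moreover have "eval_alg p \<in> ker" "eval_alg q \<in> ker"
      using p q(1) gen_ideal_subset by (auto simp: sys_ideal_def)
    ultimately have "normal_form a b c d = 0"
      using normal_form_ker ker_add ker_mult by metis
    then show "p \<in> gen_ideal" using q by simp
  qed
qed (rule gen_ideal_subset)

end

subsection \<open>Primary ideals with nilpotent radical\<close>

text \<open>A prime of the quotient contains the image of \<open>M\<close>, which consists of
  nilpotents, and equals it by maximality. A single prime admits no chain of positive
  length.\<close>

lemma (in cring) has_krull_dim_0:
  assumes I: "ideal I R" and M: "maximalideal M R" and IM: "I \<subseteq> M"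
    and nilp: "\<And>a. a \<in> M \<Longrightarrow> \<exists>k::nat. a [^] k \<in> I"
  shows "has_krull_dim (R Quot I) 0"
proof -
  note Msub = additive_subgroup.a_subset[OF ideal.axioms(1)[OF maximalideal.axioms(1)[OF M]]]
  note hom = ideal.rcos_ring_hom[OF I]
  note hmult = ring_hom_mult[OF hom, symmetric] and hone = ring_hom_one[OF hom] and hclosed = ring_hom_closed[OF hom]
  have surj: "\<exists>a \<in> carrier R. X = I +> a" if "X \<in> carrier (R Quot I)" for X
    using that by (auto simp: FactRing_def A_RCOSETS_def')
  have zero: "I +> a = \<zero>\<^bsub>R Quot I\<^esub>" if "a \<in> I" for a
    using abelian_subgroup.a_rcos_const[OF abelian_subgroupI3[OF ideal.axioms(1)[OF I] abelian_group_axioms] that]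
    by (simp add: FactRing_def)
  have memM: "a \<in> M" if ab: "a \<in> carrier R" "I +> a = I +> b" "b \<in> M" for a b
  proof -
    have "a \<in> I +> a"
      using abelian_subgroup.a_rcos_self[OF abelian_subgroupI3[OF ideal.axioms(1)[OF I] abelian_group_axioms] ab(1)] .
    then obtain i where "i \<in> I" "a = i \<oplus> b" using ab(2) by (auto simp: a_r_coset_def')
    then show ?thesis
      using IM ab(3) additive_subgroup.a_closed[OF ideal.axioms(1)[OF maximalideal.axioms(1)[OF M]]] by auto
  qed
  have unique: "P = (+>) I ` M" if P: "primeideal P (R Quot I)" for P
  proof -
    note Pi = primeideal.axioms(1)[OF P]
    let ?pre = "{a \<in> carrier R. I +> a \<in> P}"
    have pow: "I +> a \<in> P" if "a \<in> carrier R" "I +> (a [^] (k::nat)) \<in> P" for a k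
      using that(2)
    proof (induction k)
      case 0
      then have "P = carrier (R Quot I)" using ideal.one_imp_carrier[OF Pi] hone by simp
      then show ?case using hclosed that(1) by blast
    next
      case (Suc k)
      then have "(I +> (a [^] k)) \<otimes>\<^bsub>R Quot I\<^esub> (I +> a) \<in> P" using that(1) by (simp add: hmult)
      then show ?case using primeideal.I_prime[OF P] hclosed that(1) Suc.IH by blast
    qed
    have "ideal ?pre R" by (rule ring_hom_ring.ideal_vimage[OF ideal.rcos_ring_hom_ring[OF I] Pi])
    moreover have "M \<subseteq> ?pre"
    proof
      fix a assume a: "a \<in> M"
      then have ac: "a \<in> carrier R" using Msub by blast
      obtain k :: nat where "a [^] k \<in> I" using nilp[OF a] by blast
      then have "I +> (a [^] k) \<in> P"
        using zero additive_subgroup.zero_closed[OF ideal.axioms(1)[OF Pi]] by simp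
      then show "a \<in> ?pre" using pow ac by blast
    qed
    moreover have "?pre \<subseteq> carrier R" by blast
    ultimately consider "?pre = M" | "?pre = carrier R" using maximalideal.I_maximal[OF M] by blast
    then show ?thesis
    proof cases
      case 1
      have "P \<subseteq> carrier (R Quot I)" using additive_subgroup.a_subset[OF ideal.axioms(1)[OF Pi]] .
      then show ?thesis using 1 surj by blast
    next
      case 2
      then have "\<one> \<in> ?pre" using one_closed by (simp only: 2)
      then have "\<one>\<^bsub>R Quot I\<^esub> \<in> P" unfolding hone[symmetric] by blast
      then have "P = carrier (R Quot I)" using ideal.one_imp_carrier[OF Pi] by simp
      then show ?thesis using primeideal.I_notcarr[OF P] by blast
    qed
  qed
  have "primeideal ((+>) I ` M) (R Quot I)"
  proof (rule primeidealI)
    show "ideal ((+>) I ` M) (R Quot I)"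
      by (rule ring_ideal_imp_quot_ideal[OF I maximalideal.axioms(1)[OF M]])
    show "cring (R Quot I)" by (rule ideal.quotient_is_cring[OF I cring_axioms])
    show "carrier (R Quot I) \<noteq> (+>) I ` M"
    proof
      assume "carrier (R Quot I) = (+>) I ` M"
      then obtain b where "b \<in> M" "I +> \<one> = I +> b" using hclosed[OF one_closed] by auto
      then have "\<one> \<in> M" using memM by blast
      then show False
        using ideal.one_imp_carrier[OF maximalideal.axioms(1)[OF M]] maximalideal.I_notcarr[OF M] by blast
    qed
    fix X Y assume X: "X \<in> carrier (R Quot I)" and Y: "Y \<in> carrier (R Quot I)"
      and XY: "X \<otimes>\<^bsub>R Quot I\<^esub> Y \<in> (+>) I ` M"
    obtain a b where ab: "a \<in> carrier R" "X = I +> a" "b \<in> carrier R" "Y = I +> b" using surj X Y by blast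
    then have "X \<otimes>\<^bsub>R Quot I\<^esub> Y = I +> (a \<otimes> b)" by (simp add: hmult)
    then obtain c where "I +> (a \<otimes> b) = I +> c" "c \<in> M" using XY by auto
    then have "a \<otimes> b \<in> M" using memM ab by blast
    then have "a \<in> M \<or> b \<in> M"
      using primeideal.I_prime[OF maximalideal_prime[OF M]] ab by blast
    then show "X \<in> (+>) I ` M \<or> Y \<in> (+>) I ` M" using ab by blast
  qed
  then have "prime_chain (R Quot I) 0 (\<lambda>_. (+>) I ` M)" by (simp add: prime_chain_def)
  moreover have "l = 0" if "prime_chain (R Quot I) l P" for l P
  proof (rule ccontr)
    assume "l \<noteq> 0"
    then have "primeideal (P 0) (R Quot I)" "primeideal (P 1) (R Quot I)" "P 0 \<subset> P 1"
      using that by (auto simp: prime_chain_def)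
    then show False using unique[of "P 0"] unique[of "P 1"] by simp
  qed
  ultimately show ?thesis unfolding has_krull_dim_def by blast
qed

lemma nat_pow_mpoly_ring: "p [^]\<^bsub>mpoly_ring k\<^esub> (m::nat) = p ^ m" for p :: "'a::comm_ring_1 mpoly"
  by (induction m) (simp_all add: nat_pow_def mpoly_ring_def mult.commute)

lemma alg_nilpotent: "a0 A = 0 \<Longrightarrow> A ^ 5 = 0"
  by (rule alg_eqI) (simp_all add: eval_nat_numeral)

text \<open>After scaling the residue to \<open>1\<close>, the difference to \<open>1\<close> has
  fifth power zero, so the geometric series breaks off.\<close>

lemma alg_unit:
  assumes "a0 A \<noteq> 0" obtains B where "B * A = 1"
proof -
  let ?B = "scalar (1 / a0 A)"
  let ?C = "1 - ?B * A"
  have "?C ^ 5 = 0" using assms by (intro alg_nilpotent) simp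
  moreover have "(1 + ?C + ?C ^ 2 + ?C ^ 3 + ?C ^ 4) * (1 - ?C) = 1 - ?C ^ 5"
    by (simp add: eval_nat_numeral algebra_simps)
  ultimately have "(1 + ?C + ?C ^ 2 + ?C ^ 3 + ?C ^ 4) * ?B * A = 1"
    by (simp add: mult.assoc)
  then show ?thesis by (rule that)
qed

lemma a0_power: "a0 (A ^ k) = a0 A ^ k"
  by (induction k) simp_all

text \<open>\<open>a0\<close> after \<open>eval_alg\<close> is evaluation at
  \<open>S = T = 1/2\<close>, \<open>D\<^sub>i = 1\<close>. This describes the maximal ideal by a
  membership test instead of generators.\<close>

definition point_kernel :: "nat \<Rightarrow> rat mpoly set" where
  "point_kernel N = {p \<in> carrier (STD_ring N). a0 (eval_alg p) = 0}"

lemma point_kernel_ideal: "ideal (point_kernel N) (STD_ring N)"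
proof -
  interpret R: cring "STD_ring N :: rat mpoly ring" by (rule cring_mpoly_ring)
  show ?thesis
  proof (rule idealI[OF R.ring_axioms])
    show "subgroup (point_kernel N) (add_monoid (STD_ring N))"
    proof (rule R.add.subgroupI)
      show "point_kernel N \<noteq> {}" using carrier_0 by (force simp: point_kernel_def)
      fix a assume a: "a \<in> point_kernel N"
      have "\<ominus>\<^bsub>STD_ring N\<^esub> a = - a"
        using a by (intro R.minus_equality) (auto simp: point_kernel_def intro: carrier_uminus)
      then show "\<ominus>\<^bsub>STD_ring N\<^esub> a \<in> point_kernel N"
        using a by (auto simp: point_kernel_def eval_alg_uminus intro: carrier_uminus)
    qed (auto simp: point_kernel_def eval_alg_add intro: carrier_add)
  qed (auto simp: point_kernel_def eval_alg_mult intro: carrier_mult)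
qed

lemma poly_const_numeral: "poly_const (numeral n) = numeral n"
  by (simp add: poly_const_def)

lemma point_ideal_gens:
  "{2 * varS - 1, 2 * varT - 1} \<union> (\<lambda>i. varD i - 1) ` {..<N} \<subseteq> point_kernel N"
proof -
  have "eval_alg 2 = scalar 2"
    using eval_alg_const[of 2] by (simp add: poly_const_numeral)
  then show ?thesis
    by (auto simp: point_kernel_def eval_alg_diff eval_alg_mult eval_alg_varS eval_alg_varT eval_alg_varD
        intro!: carrier_rules)
qed

lemma point_ideal_ideal: "ideal (point_ideal N) (STD_ring N)"
  and point_ideal_gen: "g \<in> {2 * varS - 1, 2 * varT - 1} \<union> (\<lambda>i. varD i - 1) ` {..<N} \<Longrightarrow> g \<in> point_ideal N"
  and point_ideal_subset: "point_ideal N \<subseteq> point_kernel N"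
proof -
  interpret R: cring "STD_ring N :: rat mpoly ring" by (rule cring_mpoly_ring)
  have sub: "{2 * varS - 1, 2 * varT - 1} \<union> (\<lambda>i. varD i - 1) ` {..<N} \<subseteq> carrier (STD_ring N)"
    using point_ideal_gens[of N] by (auto simp: point_kernel_def)
  show "ideal (point_ideal N) (STD_ring N)" unfolding point_ideal_def by (rule R.genideal_ideal[OF sub])
  show "g \<in> point_ideal N" if "g \<in> {2 * varS - 1, 2 * varT - 1} \<union> (\<lambda>i. varD i - 1) ` {..<N}"
    using R.genideal_self[OF sub] that unfolding point_ideal_def by blast
  show "point_ideal N \<subseteq> point_kernel N"
    unfolding point_ideal_def by (rule R.genideal_minimal[OF point_kernel_ideal point_ideal_gens])
qed

lemma point_ideal_add: "p \<in> point_ideal N \<Longrightarrow> q \<in> point_ideal N \<Longrightarrow> p + q \<in> point_ideal N"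
  using additive_subgroup.a_closed[OF ideal.axioms(1)[OF point_ideal_ideal], of p N q] by simp

lemma point_ideal_mult: "p \<in> point_ideal N \<Longrightarrow> c \<in> carrier (STD_ring N) \<Longrightarrow> c * p \<in> point_ideal N"
  using ideal.I_l_closed[OF point_ideal_ideal, of p N c] by simp

lemma poly_const_half: "poly_const (1/2) * 2 = 1"
  using poly_const_simps(4)[of "1/2" 2] by (simp add: poly_const_simps(2)) (simp add: poly_const_numeral)

lemma minus_const_point_ideal:
  assumes "p \<in> carrier (STD_ring N)"
  shows "p \<in> carrier (STD_ring N) \<and> (\<exists>c. p - poly_const c \<in> point_ideal N)"
  using assms
proof (induction rule: carrier_mpoly_induct)
  case (const c)
  have "0 \<in> point_ideal N"
    using additive_subgroup.zero_closed[OF ideal.axioms(1)[OF point_ideal_ideal]] by simp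
  then show ?case by (auto intro!: exI[of _ c] carrier_const)
next
  case (add p q)
  then obtain c d where "p - poly_const c \<in> point_ideal N" "q - poly_const d \<in> point_ideal N" by blast
  then have "p + q - poly_const (c + d) \<in> point_ideal N"
    using point_ideal_add[of "p - poly_const c" N "q - poly_const d"] by (simp add: poly_const_simps algebra_simps)
  then show ?case using add by (auto intro: carrier_add)
next
  case (mvar i p)
  then obtain c where c: "p - poly_const c \<in> point_ideal N" by blast
  have half: "poly_const (1/2) * (2 * q - 1) = q - poly_const (1/2)" for q
    using poly_const_half by (simp add: algebra_simps flip: mult.assoc)
  have i: "\<exists>d. mvar i - poly_const d \<in> point_ideal N"
  proof -
    consider "i = 0" | "i = 1" | j where "i = j + 2" by (metis One_nat_def add_2_eq_Suc' not0_implies_Suc)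
    then show ?thesis
    proof cases
      case 1
      have "poly_const (1/2) * (2 * varS - 1) \<in> point_ideal N"
        by (intro point_ideal_mult point_ideal_gen carrier_const) simp
      then show ?thesis unfolding half 1 varS_def[symmetric] by blast
    next
      case 2
      have "poly_const (1/2) * (2 * varT - 1) \<in> point_ideal N"
        by (intro point_ideal_mult point_ideal_gen carrier_const) simp
      then show ?thesis unfolding half 2 varT_def[symmetric] by blast
    next
      case (3 j)
      then have "varD j - poly_const 1 \<in> point_ideal N"
        unfolding poly_const_simps using mvar(1) by (intro point_ideal_gen) simp
      then show ?thesis unfolding 3 varD_def by blast
    qed
  qed
  then obtain d where d: "mvar i - poly_const d \<in> point_ideal N" by blast
  have "mvar i * (p - poly_const c) + poly_const c * (mvar i - poly_const d) \<in> point_ideal N"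
    using c d mvar(1) by (intro point_ideal_add point_ideal_mult carrier_const carrier_mvar)
  then have "mvar i * p - poly_const (c * d) \<in> point_ideal N"
    by (simp add: poly_const_simps algebra_simps)
  then show ?case using mvar by (auto intro: carrier_mult carrier_mvar)
qed

lemma point_ideal_eq: "point_ideal N = point_kernel N"
proof
  show "point_kernel N \<subseteq> point_ideal N"
  proof
    fix p assume p: "p \<in> point_kernel N"
    then obtain c where c: "p - poly_const c \<in> point_ideal N"
      using minus_const_point_ideal by (auto simp: point_kernel_def)
    then have "p - poly_const c \<in> point_kernel N" using point_ideal_subset by blast
    then have "c = 0" using p by (simp add: point_kernel_def eval_alg_diff)
    then show "p \<in> point_ideal N" using c by (simp add: poly_const_simps)
  qed
qed (rule point_ideal_subset)

lemma point_ideal_maximal: "maximalideal (point_ideal N) (STD_ring N)"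
proof (rule maximalidealI)
  show "ideal (point_ideal N) (STD_ring N)" by (rule point_ideal_ideal)
  have "1 \<in> carrier (STD_ring N)" "1 \<notin> point_ideal N"
    by (auto simp: point_ideal_eq point_kernel_def carrier_1)
  then show "carrier (STD_ring N) \<noteq> point_ideal N" by blast
  fix J assume J: "ideal J (STD_ring N)" "point_ideal N \<subseteq> J" "J \<subseteq> carrier (STD_ring N)"
  show "J = point_ideal N \<or> J = carrier (STD_ring N)"
  proof (rule disjCI)
    assume "J \<noteq> carrier (STD_ring N)"
    show "J = point_ideal N"
    proof (rule ccontr)
      assume "J \<noteq> point_ideal N"
      then obtain p where p: "p \<in> J" "p \<notin> point_ideal N" using J(2) by blast
      let ?c = "a0 (eval_alg p)"
      have pc: "p \<in> carrier (STD_ring N)" using p J(3) by blast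
      have c: "?c \<noteq> 0" using p pc by (auto simp: point_ideal_eq point_kernel_def)
      have "poly_const ?c - p \<in> point_ideal N"
        using pc by (auto simp: point_ideal_eq point_kernel_def eval_alg_diff intro: carrier_diff carrier_const)
      then have "poly_const ?c - p \<in> J" using J(2) by blast
      then have "(poly_const ?c - p) + p \<in> J"
        using additive_subgroup.a_closed[OF ideal.axioms(1)[OF J(1)], of "poly_const ?c - p" p] p by simp
      then have "poly_const (1 / ?c) * poly_const ?c \<in> J"
        using ideal.I_l_closed[OF J(1), of "poly_const ?c" "poly_const (1 / ?c)"] carrier_const by simp
      then have "\<one>\<^bsub>STD_ring N\<^esub> \<in> J"
        using c by (simp add: poly_const_simps(2) flip: poly_const_simps(4))
      then show False
        using ideal.one_imp_carrier[OF J(1)] \<open>J \<noteq> carrier (STD_ring N)\<close> by blast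
    qed
  qed
qed

section \<open>Radical, primarity and dimension of the ideal\<close>

context quadratic_system
begin

lemma sys_ideal_subset: "sys_ideal \<subseteq> point_ideal N"
  by (auto simp: sys_ideal_def point_ideal_eq point_kernel_def ker_def)

lemma sys_ideal_nilpotent: "p \<in> point_ideal N \<Longrightarrow> p ^ 5 \<in> sys_ideal"
  by (auto simp: sys_ideal_def point_ideal_eq point_kernel_def eval_alg_power alg_nilpotent ker_0 intro: carrier_power)

lemma sys_ideal_radical: "radical (STD_ring N) sys_ideal = point_ideal N"
proof
  show "radical (STD_ring N) sys_ideal \<subseteq> point_ideal N"
    unfolding radical_def nat_pow_mpoly_ring
    by (auto simp: sys_ideal_def point_ideal_eq point_kernel_def ker_def eval_alg_power a0_power)
  show "point_ideal N \<subseteq> radical (STD_ring N) sys_ideal"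
    using sys_ideal_nilpotent unfolding radical_def nat_pow_mpoly_ring
    by (auto simp: point_ideal_eq point_kernel_def)
qed

lemma sys_ideal_proper: "sys_ideal \<noteq> carrier (STD_ring N)"
  using sys_ideal_subset maximalideal.I_notcarr[OF point_ideal_maximal, of N]
    additive_subgroup.a_subset[OF ideal.axioms(1)[OF point_ideal_ideal, of N]] by blast

text \<open>The algebra is local: an element outside the radical has nonzero residue, hence a unit
  as image, which can be cancelled from the product.\<close>

lemma sys_ideal_primary: "primary_to (STD_ring N) sys_ideal (point_ideal N)"
  unfolding primary_to_def primary_ideal_def
proof (intro conjI ballI impI)
  fix a b assume a: "a \<in> carrier (STD_ring N)" and b: "b \<in> carrier (STD_ring N)"
    and ab: "a \<otimes>\<^bsub>STD_ring N\<^esub> b \<in> sys_ideal"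
  show "a \<in> sys_ideal \<or> b \<in> radical (STD_ring N) sys_ideal"
  proof (rule disjCI)
    assume "b \<notin> radical (STD_ring N) sys_ideal"
    then have "a0 (eval_alg b) \<noteq> 0"
      using b unfolding sys_ideal_radical point_ideal_eq point_kernel_def by blast
    then obtain B where B: "B * eval_alg b = 1" by (rule alg_unit)
    have "eval_alg a * eval_alg b \<in> ker"
      using ab unfolding sys_ideal_def mpoly_ring_simps mem_Collect_eq eval_alg_mult by blast
    then have "B * (eval_alg a * eval_alg b) \<in> ker" by (rule ker_mult)
    moreover have "B * (eval_alg a * eval_alg b) = eval_alg a * (B * eval_alg b)" by (simp only: ac_simps)
    ultimately have "eval_alg a \<in> ker" unfolding B by simp
    then show "a \<in> sys_ideal" using a by (simp add: sys_ideal_def)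
  qed
qed (rule sys_ideal_ideal sys_ideal_proper sys_ideal_radical)+

lemma sys_ideal_krull_dim: "has_krull_dim (STD_ring N Quot sys_ideal) 0"
proof (rule cring.has_krull_dim_0[OF cring_mpoly_ring sys_ideal_ideal point_ideal_maximal sys_ideal_subset])
  fix p assume "p \<in> point_ideal N"
  then show "\<exists>k::nat. p [^]\<^bsub>STD_ring N\<^esub> k \<in> sys_ideal"
    unfolding nat_pow_mpoly_ring using sys_ideal_nilpotent by blast
qed

end

subsection \<open>Trinomials in the ideal\<close>

definition eq_value :: "(nat \<Rightarrow> int) \<Rightarrow> equation \<Rightarrow> int" where
  "eq_value y E = (\<Sum>(c, i, j) \<leftarrow> E. c * y i * y j)"

lemma eq_value_simps [simp]: "eq_value y [] = 0" "eq_value y ((c, i, j) # E) = c * y i * y j + eq_value y E"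
  by (simp_all add: eq_value_def)

lemma eq_value_cong:
  "(\<And>c i j. (c, i, j) \<in> set E \<Longrightarrow> y i = z i \<and> y j = z j) \<Longrightarrow> eq_value y E = eq_value z E"
  by (induction E) (auto, metis)

lemma functional_eq_value:
  "(\<And>i j. coord A i j = \<kappa> * of_int (y i * y j)) \<Longrightarrow> functional E A = \<kappa> * of_int (eq_value y E)"
  by (induction E) (auto simp: algebra_simps)

text \<open>The equations are the coordinates of \<open>c\<^sub>0 + c\<^sub>1 X\<^sub>1 + c\<^sub>2 X\<^sub>2\<close>, where \<open>X\<^sub>i = theta k\<^sub>i w\<^sub>i e\<^sub>i\<close>.\<close>

lemma trinomial_numbers:
  fixes c0 c1 c2 k1 k2 w1 w2 :: rat
  assumes nz: "c0 \<noteq> 0" "c1 \<noteq> 0" "c2 \<noteq> 0"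
    and e0: "c0 + c1 + c2 = 0" and e1: "c1 * k1 + c2 * k2 = 0"
    and e2: "c1 * (k1^2 - w1) + c2 * (k2^2 - w2) = 0"
    and e3: "c1 * (k1^3 - 3 * k1 * w1 + 2 * k1) + c2 * (k2^3 - 3 * k2 * w2 + 2 * k2) = 0"
    and e4: "c1 * (k1^4 - 6 * k1^2 * w1 + 3 * w1^2 + 8 * k1^2 - 6 * w1) +
             c2 * (k2^4 - 6 * k2^2 * w2 + 3 * w2^2 + 8 * k2^2 - 6 * w2) = 0"
  shows "k1 = 0 \<and> k2 = 0 \<and> w1 = 0 \<and> w2 = 0 \<or>
    k1^2 - k1 * k2 + k2^2 = 3 \<and> w1 = (k1^2 - 2 * k1 * k2) / 3 \<and> w2 = (k2^2 - 2 * k1 * k2) / 3"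
proof (cases "k1 = 0")
  case True
  then have k2: "k2 = 0" using e1 nz by simp
  have w: "c1 * w1 + c2 * w2 = 0" using e2 True k2 by (simp add: algebra_simps)
  have "c1 * w1^2 + c2 * w2^2 = 0"
    using e4 w True k2 by (simp add: algebra_simps)
  \<comment> \<open>The weighted sums of first and second powers of \<open>w1\<close>,
    \<open>w2\<close> both vanish; a common nonzero value would contradict
    \<open>c1 + c2 = - c0\<close>.\<close>
  moreover have "c1 * w1^2 + c2 * w2^2 = (c1 * w1) * (w1 - w2) + w2 * (c1 * w1 + c2 * w2)"
    by (simp add: algebra_simps power2_eq_square)
  ultimately have "w1 = 0 \<or> w1 = w2" using w nz by simp
  moreover have "w1 = 0" if "w1 = w2"
  proof (rule ccontr)
    assume "w1 \<noteq> 0"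
    have "(c1 + c2) * w1 = 0" using w that by (simp add: algebra_simps)
    then show False using \<open>w1 \<noteq> 0\<close> e0 nz by simp
  qed
  ultimately have "w1 = 0" by blast
  then show ?thesis using True k2 w nz by simp
next
  case False
  have k2: "k2 \<noteq> 0" using e1 False nz by auto
  \<comment> \<open>\<open>(c1, c2)\<close> is proportional to \<open>(k2, - k1)\<close>, which
    eliminates the coefficients from all further equations.\<close>
  have cross: "k1 * B = k2 * A" if "c1 * A + c2 * B = 0" for A B
  proof -
    have "c2 * (k1 * B - k2 * A) = k1 * (c1 * A + c2 * B) - A * (c1 * k1 + c2 * k2)"
      by (simp add: algebra_simps)
    then show ?thesis using that e1 nz by simp
  qed
  have ne: "k1 \<noteq> k2"
  proof
    assume "k1 = k2"
    then have "(c1 + c2) * k1 = 0" using e1 by (simp add: algebra_simps)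
    then show False using False e0 nz by simp
  qed
  have "(k1 * k2) * (k2^2 - 3 * w2) = (k1 * k2) * (k1^2 - 3 * w1)"
    using cross[OF e3] by (simp add: algebra_simps power2_eq_square power3_eq_cube)
  then have "k2^2 - 3 * w2 = k1^2 - 3 * w1" using False k2 by simp
  then have w1: "w1 = w2 + (k1^2 - k2^2) / 3" by (simp add: field_simps)
  have "k1 * (k2^2 - w2) - k2 * (k1^2 - w1) = - (k1 - k2) * (w2 - (k2^2 - 2 * k1 * k2) / 3)"
    unfolding w1 by (simp add: field_simps power2_eq_square power3_eq_cube)
  then have w2: "w2 = (k2^2 - 2 * k1 * k2) / 3" using cross[OF e2] ne by simp
  have w1': "w1 = (k1^2 - 2 * k1 * k2) / 3" unfolding w1 w2 by (simp add: field_simps)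
  \<comment> \<open>So far \<open>w1\<close> and \<open>w2\<close> are determined by
    \<open>k1\<close> and \<open>k2\<close>, which are only known to be distinct and nonzero. The
    coefficient of \<open>v^4\<close> is the first to restrict them further.\<close>
  have "k2 * (k1^4 - 6 * k1^2 * w1 + 3 * w1^2 + 8 * k1^2 - 6 * w1) -
      k1 * (k2^4 - 6 * k2^2 * w2 + 3 * w2^2 + 8 * k2^2 - 6 * w2) =
      (2/3) * k1 * k2 * (k1 - k2) * (3 - (k1^2 - k1 * k2 + k2^2))"
    unfolding w1' w2 by (simp add: field_simps eval_nat_numeral)
  then have "k1^2 - k1 * k2 + k2^2 = 3" using cross[OF e4] False k2 ne by simp
  then show ?thesis using w1' w2 by blast
qed

text \<open>The form is the norm of the Eisenstein integers; four times it is
  \<open>(2 a - b)\<^sup>2 + 3 b\<^sup>2\<close>. The six solutions are the six orders of three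
  terms whose values of \<open>p - q\<close> are \<open>0\<close>, \<open>1\<close>,
  \<open>-1\<close> up to a common shift.\<close>

lemma norm_three:
  fixes a b :: int
  assumes "a^2 - a * b + b^2 = 3"
  shows "(a, b) \<in> {(1, -1), (-1, 1), (2, 1), (1, 2), (-1, -2), (-2, -1)}"
proof -
  have "(2 * a - b)^2 + 3 * b^2 = 12" "(2 * b - a)^2 + 3 * a^2 = 12"
    using assms by (simp_all add: power2_eq_square algebra_simps)
  then have "3 * a^2 \<le> 12" "3 * b^2 \<le> 12"
    using zero_le_power2[of "2 * a - b"] zero_le_power2[of "2 * b - a"] by linarith+
  then have "\<bar>a\<bar> \<le> 2" "\<bar>b\<bar> \<le> 2"
    using power2_le_iff_abs_le[of 2 a] power2_le_iff_abs_le[of 2 b] by simp_all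
  then have "a \<in> {-2, -1, 0, 1, 2}" "b \<in> {-2, -1, 0, 1, 2}" by auto
  then show ?thesis using assms by auto
qed

section \<open>Images of the affine trinomials\<close>

definition mon_D :: "nat \<Rightarrow> (nat \<Rightarrow> nat) \<Rightarrow> nat \<Rightarrow>\<^sub>0 nat" where
  "mon_D l f = (\<Sum>i<l. Poly_Mapping.single (i + 2) (f i))"

lemma lookup_mon_D: "Poly_Mapping.lookup (mon_D l f) j = (if 2 \<le> j \<and> j < l + 2 then f (j - 2) else 0)"
proof -
  have "Poly_Mapping.lookup (mon_D l f) j = (\<Sum>i<l. if i + 2 = j then f i else 0)"
    by (auto simp: mon_D_def lookup_sum lookup_single when_def intro!: sum.cong)
  also have "\<dots> = (\<Sum>i<l. if i = j - 2 \<and> 2 \<le> j then f i else 0)"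
    by (intro sum.cong) auto
  also have "\<dots> = (if 2 \<le> j \<and> j < l + 2 then f (j - 2) else 0)"
    by (cases "2 \<le> j") auto
  finally show ?thesis .
qed

lemma mvar_power: "mvar i ^ k = Poly_Mapping.single (Poly_Mapping.single i k) (1 :: 'a::comm_ring_1)"
  using single_add_mvar[of i k 0 "1 :: 'a"] by simp

lemma prod_varD: "(\<Prod>i<l. varD i ^ f i) = Poly_Mapping.single (mon_D l f) 1"
  by (induction l) (simp_all add: mon_D_def varD_def mvar_power mult_single add.commute)

lemma affine_trinomial_single: "affine_trinomial d =
    Poly_Mapping.single (mon_D (length d) (\<lambda>i. nat \<bar>d ! i\<bar>)) 1
    - Poly_Mapping.single (Poly_Mapping.single 0 1 + mon_D (length d) (\<lambda>i. nat (\<bar>d ! i\<bar> + d ! i))) 1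
    - Poly_Mapping.single (Poly_Mapping.single 1 1 + mon_D (length d) (\<lambda>i. nat (\<bar>d ! i\<bar> - d ! i))) 1"
  unfolding affine_trinomial_def prod_varD by (simp add: varS_def varT_def mvar_def mult_single)

definition list_fun :: "int list \<Rightarrow> nat \<Rightarrow> int" where
  "list_fun d i = (if i < length d then d ! i else 0)"

text \<open>The cleared denominator is a monomial, hence a unit; it can be split off because the
  algebra has room for negative exponents.\<close>

lemma eval_affine_trinomial: "eval_alg (affine_trinomial d) = theta 0 0 (\<lambda>i. of_int \<bar>list_fun d i\<bar>) *
   (1 - scalar (1/2) * theta 1 1 (\<lambda>i. of_int (list_fun d i)) - scalar (1/2) * theta (-1) 1 (\<lambda>i. - of_int (list_fun d i)))"
proof -
  have *: "A * (1 - s * B - s * C) = A - s * (A * B) - s * (A * C)" for A B C s :: alg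
    by (simp add: algebra_simps)
  have nn: "\<bar>d ! i\<bar> + d ! i \<ge> 0" "\<bar>d ! i\<bar> - d ! i \<ge> 0" for i by auto
  have 1: "of_nat (if i < length d then nat \<bar>d ! i\<bar> else 0) = rat_of_int \<bar>list_fun d i\<bar>"
    "of_nat (if i < length d then nat (\<bar>d ! i\<bar> + d ! i) else 0) = rat_of_int \<bar>list_fun d i\<bar> + of_int (list_fun d i)"
    "of_nat (if i < length d then nat (\<bar>d ! i\<bar> - d ! i) else 0) = rat_of_int \<bar>list_fun d i\<bar> - of_int (list_fun d i)" for i
    using nn[of i] by (auto simp: list_fun_def of_nat_nat simp del: of_int_abs)
  show ?thesis
    unfolding affine_trinomial_single eval_alg_diff eval_alg_single * theta_add mon_alg_def Let_def
    by (simp add: lookup_add lookup_mon_D lookup_single 1 del: of_int_abs cong: if_cong)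
qed

definition tau_alg :: "(nat \<Rightarrow> int) \<Rightarrow> alg" where
  "tau_alg d = 1 - scalar (1/2) * theta 1 1 (\<lambda>i. of_int (d i)) - scalar (1/2) * theta (-1) 1 (\<lambda>i. - of_int (d i))"

text \<open>Averaging over \<open>(1, d)\<close> and \<open>(-1, - d)\<close> keeps the even part:
  the linear coordinates and the correction on the diagonal of \<open>wx\<close> cancel, while
  \<open>k d\<^sub>i\<close> and \<open>d\<^sub>i d\<^sub>j\<close> survive. Higher powers of
  \<open>v\<close> do not occur, since \<open>2 S = 1 + u + v\<close>.\<close>

lemma tau_alg_simps: "a0 (tau_alg d) = 0" "a1 (tau_alg d) = 0" "a2 (tau_alg d) = 0" "a3 (tau_alg d) = 0" "a4 (tau_alg d) = 0"
  "xc (tau_alg d) = (\<lambda>i. 0)" "coord (tau_alg d) i j = - 1 * of_int (case_nat 1 d i * case_nat 1 d j)"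
  by (auto simp: tau_alg_def fun_eq_iff split: nat.split intro!: alg_eqI)
     (cases i; cases j; auto simp: field_simps)

context quadratic_system
begin

lemma eqs_nth_cong:
  assumes "k < r" "\<And>i. i \<le> n \<Longrightarrow> y i = z i" shows "eq_value y (eqs ! k) = eq_value z (eqs ! k)"
proof (rule eq_value_cong)
  fix c i j assume "(c, i, j) \<in> set (eqs ! k)"
  then show "y i = z i \<and> y j = z j" using indices[OF nth_mem[OF assms(1)]] assms(2) by blast
qed

lemma theta_inverse: "theta (- k) (- w) (\<lambda>i. - e i) * theta k w e = 1"
  by (simp add: theta_add theta_0)

lemma ker_theta: "theta k w e * A \<in> ker \<longleftrightarrow> A \<in> ker"
proof
  assume "theta k w e * A \<in> ker"
  then have "theta (- k) (- w) (\<lambda>i. - e i) * (theta k w e * A) \<in> ker" by (rule ker_mult)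
  then show "A \<in> ker" by (simp add: theta_inverse flip: mult.assoc)
qed (rule ker_mult)

text \<open>The diagonal coordinates make the squares of the dummy entries vanish; once these
  entries are zero, each extended equation is the original one.\<close>

lemma tau_alg_ker: "tau_alg d \<in> ker \<longleftrightarrow> (\<forall>k<r. d (n + k) = 0 \<and> eq_value (case_nat 1 d) (eqs ! k) = 0)"
proof -
  have *: "functional E (tau_alg d) = - of_int (eq_value (case_nat 1 d) E)" for E
    using functional_eq_value[OF tau_alg_simps(7)] by simp
  have "wx (tau_alg d) i i = - ((of_int (d i))^2)" for i
    using tau_alg_simps(7)[of d "Suc i" "Suc i"] by (simp add: power2_eq_square)
  moreover have "wv (tau_alg d) i = - of_int (d i)" for i
    using tau_alg_simps(7)[of d 0 "Suc i"] by simp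
  ultimately show ?thesis
    by (auto simp: ker_def tau_alg_simps * extended_def)
qed

lemma affine_trinomial_carrier: "length d = N \<Longrightarrow> affine_trinomial d \<in> carrier (STD_ring N)"
  unfolding affine_trinomial_def by (auto intro!: carrier_rules)

lemma affine_trinomial_ideal:
  assumes "length d = N"
  shows "affine_trinomial d \<in> sys_ideal \<longleftrightarrow>
    (\<forall>k<r. list_fun d (n + k) = 0 \<and> eq_value (case_nat 1 (list_fun d)) (eqs ! k) = 0)"
  using affine_trinomial_carrier[OF assms]
  by (simp add: sys_ideal_def eval_affine_trinomial ker_theta flip: tau_alg_def tau_alg_ker)

lemma affine_trinomial_solvable:
  "(\<exists>d. length d = N \<and> affine_trinomial d \<in> sys_ideal) \<longleftrightarrow> (\<exists>y. \<forall>E \<in> set eqs. eq_value (case_nat 1 y) E = 0)"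
proof
  assume "\<exists>d. length d = N \<and> affine_trinomial d \<in> sys_ideal"
  then obtain d where "\<forall>k<r. eq_value (case_nat 1 (list_fun d)) (eqs ! k) = 0"
    using affine_trinomial_ideal by blast
  then show "\<exists>y. \<forall>E \<in> set eqs. eq_value (case_nat 1 y) E = 0" by (metis in_set_conv_nth)
next
  assume "\<exists>y. \<forall>E \<in> set eqs. eq_value (case_nat 1 y) E = 0"
  then obtain y where y: "\<forall>E \<in> set eqs. eq_value (case_nat 1 y) E = 0" by blast
  let ?d = "map y [0..<n] @ replicate r 0"
  have "eq_value (case_nat 1 (list_fun ?d)) (eqs ! k) = eq_value (case_nat 1 y) (eqs ! k)" if "k < r" for k
    using that by (rule eqs_nth_cong) (auto simp: list_fun_def nth_append split: nat.split)
  then have "affine_trinomial ?d \<in> sys_ideal"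
    using y by (subst affine_trinomial_ideal) (auto simp: list_fun_def nth_append)
  then show "\<exists>d. length d = N \<and> affine_trinomial d \<in> sys_ideal" by (intro exI[of _ ?d]) simp
qed

text \<open>The quadrinomial is \<open>u v\<close>, and \<open>u\<close> is annihilated by the
  maximal ideal.\<close>

lemma quadrinomial_ideal: "varS ^ 2 - varT ^ 2 - varS + varT \<in> sys_ideal"
proof -
  have "varS ^ 2 - varT ^ 2 - varS + varT = polyV * polyU"
    by (simp add: polyU_def polyV_def algebra_simps power2_eq_square)
  moreover have "algV * algU = 0" by (rule alg_eqI) simp_all
  ultimately show ?thesis
    by (auto simp: sys_ideal_def eval_alg_mult ker_0 intro!: carrier_rules)
qed

end

lemma single_ne: "i \<noteq> j \<Longrightarrow> a \<noteq> 0 \<Longrightarrow> Poly_Mapping.single i a \<noteq> Poly_Mapping.single j b"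
  by (metis lookup_single_eq lookup_single_not_eq)

lemma num_terms_quadrinomial: "num_terms (varS ^ 2 - varT ^ 2 - varS + varT) = 4"
proof -
  let ?m = "\<lambda>i k. Poly_Mapping.single i k :: nat \<Rightarrow>\<^sub>0 nat"
  have eq: "varS ^ 2 - varT ^ 2 - varS + varT = Poly_Mapping.single (?m 0 2) 1 - Poly_Mapping.single (?m 1 2) 1
      - Poly_Mapping.single (?m 0 1) 1 + Poly_Mapping.single (?m 1 1) (1::rat)"
    by (simp add: varS_def varT_def mvar_power) (simp add: mvar_def)
  have same: "?m 0 2 \<noteq> ?m 0 1" "?m 1 2 \<noteq> ?m 1 1"
    unfolding inj_eq[OF inj_single] by simp_all
  have diff: "?m 0 a \<noteq> ?m 1 b" if "a \<noteq> 0" for a b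
    by (rule single_ne) (use that in simp_all)
  have d1: "?m 0 1 \<noteq> ?m 1 b" and d2: "?m 0 2 \<noteq> ?m 1 b" for b
    by (rule diff, simp)+
  have ne: "?m 0 2 \<noteq> ?m 1 2" "?m 0 2 \<noteq> ?m 0 1" "?m 0 2 \<noteq> ?m 1 1" "?m 1 2 \<noteq> ?m 0 1" "?m 1 2 \<noteq> ?m 1 1" "?m 0 1 \<noteq> ?m 1 1"
    using d2 same d1[of 2, symmetric] d1[of 1] by blast+
  have "Poly_Mapping.keys (Poly_Mapping.single a 1 - Poly_Mapping.single b 1 - Poly_Mapping.single c 1 +
      Poly_Mapping.single d (1::rat)) = {a, b, c, d}"
    if "a \<noteq> b" "a \<noteq> c" "a \<noteq> d" "b \<noteq> c" "b \<noteq> d" "c \<noteq> d" for a b c d :: "nat \<Rightarrow>\<^sub>0 nat"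
    using that by (auto simp: in_keys_iff lookup_add lookup_minus lookup_single when_def split: if_splits)
  from this[OF ne] have "num_terms (varS ^ 2 - varT ^ 2 - varS + varT) = card {?m 0 2, ?m 1 2, ?m 0 1, ?m 1 1}"
    unfolding eq num_terms_def by (rule arg_cong)
  also have "\<dots> = 4"
  proof -
    have "card {a, b, c, d} = 4"
      if "a \<noteq> b" "a \<noteq> c" "a \<noteq> d" "b \<noteq> c" "b \<noteq> d" "c \<noteq> d" for a b c d :: "nat \<Rightarrow>\<^sub>0 nat"
      using that by simp
    from this[OF ne] show ?thesis .
  qed
  finally show ?thesis .
qed

text \<open>\<open>case_nat 0 e\<close> puts \<open>y\<^sub>0 = 0\<close>, which leaves the leading
  forms of the equations.\<close>

locale anisotropic_system = quadratic_system +
  assumes anisotropic: "\<And>e i. (\<And>E. E \<in> set eqs \<Longrightarrow> eq_value (case_nat 0 e) E = 0) \<Longrightarrow> i < n \<Longrightarrow> e i = 0"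
begin

lemma trinomial_core:
  fixes k1 k2 w1 w2 :: int and e1 e2 :: "nat \<Rightarrow> int"
  assumes nz: "c0 \<noteq> 0" "c1 \<noteq> 0" "c2 \<noteq> 0"
    and ker: "scalar c0 + scalar c1 * theta (of_int k1) (of_int w1) (\<lambda>i. of_int (e1 i)) +
       scalar c2 * theta (of_int k2) (of_int w2) (\<lambda>i. of_int (e2 i)) \<in> ker"
    and ne: "k2 \<noteq> 0 \<or> w2 \<noteq> 0 \<or> e2 \<noteq> (\<lambda>i. 0)" and N: "\<And>i. N \<le> i \<Longrightarrow> e2 i = 0"
  shows "(k1, k2) \<in> {(1, -1), (-1, 1), (2, 1), (1, 2), (-1, -2), (-2, -1)}"
    and "k1 = 1 \<Longrightarrow> k2 = -1 \<Longrightarrow> w1 = 1 \<and> w2 = 1 \<and> c1 = - c0 / 2 \<and> c2 = - c0 / 2 \<and> (\<forall>i. e2 i = - e1 i)"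
proof -
  let ?A = "scalar c0 + scalar c1 * theta (of_int k1) (of_int w1) (\<lambda>i. of_int (e1 i)) +
       scalar c2 * theta (of_int k2) (of_int w2) (\<lambda>i. of_int (e2 i))"
  have e0: "c0 + c1 + c2 = 0" using ker by (auto simp: ker_def)
  have e1': "c1 * of_int k1 + c2 * of_int k2 = 0" using ker by (auto simp: ker_def)
  have ee: "c1 * of_int (e1 i) + c2 * of_int (e2 i) = 0" for i
    using ker by (auto simp: ker_def fun_eq_iff)
  have "rat_of_int k1 = 0 \<and> rat_of_int k2 = 0 \<and> rat_of_int w1 = 0 \<and> rat_of_int w2 = 0 \<or>
    (rat_of_int k1)^2 - of_int k1 * of_int k2 + (of_int k2)^2 = 3 \<and> rat_of_int w1 = ((of_int k1)^2 - 2 * of_int k1 * of_int k2) / 3 \<and>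
    rat_of_int w2 = ((of_int k2)^2 - 2 * of_int k1 * of_int k2) / 3"
  proof (rule trinomial_numbers[OF nz e0 e1'])
    have "a2 ?A = 0" "a3 ?A = 0" "a4 ?A = 0" using ker unfolding ker_def by blast+
    then show "c1 * ((of_int k1)^2 - of_int w1) + c2 * ((of_int k2)^2 - of_int w2) = 0"
      "c1 * ((of_int k1)^3 - 3 * of_int k1 * of_int w1 + 2 * of_int k1) + c2 * ((of_int k2)^3 - 3 * of_int k2 * of_int w2 + 2 * of_int k2) = 0"
      "c1 * ((of_int k1)^4 - 6 * (of_int k1)^2 * of_int w1 + 3 * (of_int w1)^2 + 8 * (of_int k1)^2 - 6 * of_int w1) +
             c2 * ((of_int k2)^4 - 6 * (of_int k2)^2 * of_int w2 + 3 * (of_int w2)^2 + 8 * (of_int k2)^2 - 6 * of_int w2) = 0"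
      by (simp_all add: add_divide_distrib[symmetric])
  qed
  moreover have False if z: "k1 = 0" "k2 = 0" "w1 = 0" "w2 = 0"
  proof -
    \<comment> \<open>The case of constant \<open>(p, q)\<close>. With
      \<open>e1 = - (c2 / c1) e2\<close> and \<open>c0 = - c1 - c2\<close>, the sum
      \<open>c1 e1 e1 + c2 e2 e2\<close> is \<open>e2 e2\<close> times this factor, so
      \<open>e2\<close> is a zero of the leading forms.\<close>
    let ?\<kappa> = "- c2 * c0 / c1"
    have e1: "of_int (e1 i) = - (c2 / c1) * of_int (e2 i)" for i
      using ee[of i] nz by (simp add: field_simps)
    have c0: "c0 = - c1 - c2" using e0 by (simp add: algebra_simps eq_neg_iff_add_eq_0)
    have "coord ?A i j = ?\<kappa> * of_int (case_nat 0 e2 i * case_nat 0 e2 j)" for i j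
      using nz by (cases i; cases j) (auto simp: z e1 c0 field_simps)
    note coord = this
    have \<kappa>: "?\<kappa> \<noteq> 0" using nz by simp
    have F: "eq_value (case_nat 0 e2) (extended n eqs k) = 0" if "k < r" for k
      using functional_eq_value[of ?A ?\<kappa> "case_nat 0 e2" "extended n eqs k", OF coord] ker that \<kappa>
      by (simp add: ker_def)
    then have "eq_value (case_nat 0 e2) E = 0" if "E \<in> set eqs" for E
      using that by (auto simp: in_set_conv_nth extended_def)
    then have 1: "e2 i = 0" if "i < n" for i using anisotropic that by blast
    \<comment> \<open>Anisotropy concerns the first \<open>n\<close> entries; the dummy entries
      vanish by their diagonal coordinates.\<close>
    have 2: "e2 (n + k) = 0" if "k < r" for k
    proof -
      have "wx ?A (n + k) (n + k) = 0" using ker that unfolding ker_def by blast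
      then have "?\<kappa> * of_int (e2 (n + k) * e2 (n + k)) = 0"
        using coord[of "Suc (n + k)" "Suc (n + k)"] by simp
      then show ?thesis using \<kappa> by simp
    qed
    have "e2 i = 0" for i
    proof -
      consider "i < n" | k where "i = n + k" "k < r" | "N \<le> i" by (metis add_less_cancel_left le_add_diff_inverse not_le)
      then show ?thesis using 1 2 N by cases auto
    qed
    then show False using ne z by auto
  qed
  ultimately have k: "(rat_of_int k1)^2 - of_int k1 * of_int k2 + (of_int k2)^2 = 3"
    and w: "rat_of_int w1 = ((of_int k1)^2 - 2 * of_int k1 * of_int k2) / 3"
    "rat_of_int w2 = ((of_int k2)^2 - 2 * of_int k1 * of_int k2) / 3" by auto
  have "rat_of_int (k1^2 - k1 * k2 + k2^2) = of_int 3" using k by simp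
  then show "(k1, k2) \<in> {(1, -1), (-1, 1), (2, 1), (1, 2), (-1, -2), (-2, -1)}"
    unfolding of_int_eq_iff by (rule norm_three)
  assume kk: "k1 = 1" "k2 = -1"
  then have c: "c1 = c2" using e1' by simp
  have "e2 i = - e1 i" for i
  proof -
    have "c1 * of_int (e1 i + e2 i) = 0" using ee[of i] c by (simp add: algebra_simps)
    then show ?thesis using nz by (simp add: eq_neg_iff_add_eq_0 add.commute del: of_int_add)
  qed
  moreover have "c1 = - c0 / 2" "c2 = - c0 / 2" using e0 c by (auto simp: field_simps eq_neg_iff_add_eq_0)
  ultimately show "w1 = 1 \<and> w2 = 1 \<and> c1 = - c0 / 2 \<and> c2 = - c0 / 2 \<and> (\<forall>i. e2 i = - e1 i)"
    using w kk by auto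
qed

end

section \<open>Monomials, binomials and trinomials in the ideal\<close>

definition mon_k :: "(nat \<Rightarrow>\<^sub>0 nat) \<Rightarrow> int" where
  "mon_k m = int (Poly_Mapping.lookup m 0) - int (Poly_Mapping.lookup m 1)"
definition mon_w :: "(nat \<Rightarrow>\<^sub>0 nat) \<Rightarrow> int" where
  "mon_w m = int (Poly_Mapping.lookup m 0) + int (Poly_Mapping.lookup m 1)"
definition mon_e :: "(nat \<Rightarrow>\<^sub>0 nat) \<Rightarrow> nat \<Rightarrow> int" where
  "mon_e m i = int (Poly_Mapping.lookup m (i + 2))"

lemma mon_alg_theta: "mon_alg m = scalar ((1/2) ^ (Poly_Mapping.lookup m 0 + Poly_Mapping.lookup m 1)) *
    theta (of_int (mon_k m)) (of_int (mon_w m)) (\<lambda>i. of_int (mon_e m i))"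
  by (simp add: mon_alg_def Let_def mon_k_def mon_w_def mon_e_def)

lemma mon_eqI: "mon_k m = mon_k m' \<Longrightarrow> mon_w m = mon_w m' \<Longrightarrow> mon_e m = mon_e m' \<Longrightarrow> m = m'"
proof (rule poly_mapping_eqI)
  fix j :: nat
  assume *: "mon_k m = mon_k m'" "mon_w m = mon_w m'" "mon_e m = mon_e m'"
  consider "j = 0" | "j = 1" | i where "j = i + 2" by (metis One_nat_def add_2_eq_Suc' not0_implies_Suc)
  then show "Poly_Mapping.lookup m j = Poly_Mapping.lookup m' j"
  proof cases
    case (3 i)
    then show ?thesis using fun_cong[OF *(3), of i] by (simp add: mon_e_def)
  qed (use * in \<open>auto simp: mon_k_def mon_w_def\<close>)
qed

lemma theta_shift: "theta (- k') (- w') (\<lambda>i. - e' i) * (scalar c * theta k w e) =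
    scalar c * theta (k - k') (w - w') (\<lambda>i. e i - e' i)"
  using theta_add[of "- k'" "- w'" "\<lambda>i. - e' i" k w e] by (simp add: mult.left_commute)

text \<open>\<open>theta\<close> stands for \<open>2^(p + q) S^p T^q D^e\<close>, and the
  coefficients are rescaled accordingly.\<close>

definition weight :: "rat mpoly \<Rightarrow> (nat \<Rightarrow>\<^sub>0 nat) \<Rightarrow> rat" where
  "weight p m = Poly_Mapping.lookup p m * (1/2) ^ (Poly_Mapping.lookup m 0 + Poly_Mapping.lookup m 1)"

lemma weight_nonzero: "m \<in> Poly_Mapping.keys p \<Longrightarrow> weight p m \<noteq> 0"
  by (simp add: weight_def in_keys_iff)

lemma eval_alg_weight: "eval_alg p = (\<Sum>m \<in> Poly_Mapping.keys p. scalar (weight p m) *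
    theta (of_int (mon_k m)) (of_int (mon_w m)) (\<lambda>i. of_int (mon_e m i)))"
  by (simp add: eval_alg_def mon_alg_theta weight_def scalar_mult mult.assoc)

context quadratic_system
begin

text \<open>Division by the monomial \<open>a\<close>, which need not give a polynomial, is possible
  in the algebra: its image is a unit, and \<open>ker\<close> is stable under
  multiplication.\<close>

lemma sys_ideal_shift:
  assumes "p \<in> sys_ideal"
  shows "(\<Sum>m \<in> Poly_Mapping.keys p. scalar (weight p m) *
    theta (of_int (mon_k m - mon_k a)) (of_int (mon_w m - mon_w a)) (\<lambda>i. of_int (mon_e m i - mon_e a i))) \<in> ker"
proof -
  have "theta (- of_int (mon_k a)) (- of_int (mon_w a)) (\<lambda>i. - of_int (mon_e a i)) * eval_alg p \<in> ker"
    using assms by (intro ker_mult) (simp add: sys_ideal_def)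
  then show ?thesis
    unfolding eval_alg_weight sum_distrib_left theta_shift by simp
qed

lemma no_monomial: assumes "p \<in> sys_ideal" shows "num_terms p \<noteq> 1"
proof
  assume "num_terms p = 1"
  then obtain a where a: "Poly_Mapping.keys p = {a}" by (auto simp: num_terms_def card_1_singleton_iff)
  have "weight p a = 0"
    using sys_ideal_shift[OF assms, of a] by (simp add: a ker_def)
  then show False using weight_nonzero[of a p] a by simp
qed

text \<open>After division by one term, the coordinates \<open>a1\<close>, \<open>a2\<close> and
  \<open>xc\<close> show that the other has the same \<open>p - q\<close>, \<open>p + q\<close> and
  exponents of \<open>D\<close>.\<close>

lemma no_binomial: assumes "p \<in> sys_ideal" shows "num_terms p \<noteq> 2"
proof
  assume "num_terms p = 2"
  then obtain a b where ab: "Poly_Mapping.keys p = {a, b}" "a \<noteq> b" by (auto simp: num_terms_def card_2_iff)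
  let ?A = "scalar (weight p a) * theta 0 0 (\<lambda>i. 0) + scalar (weight p b) *
    theta (of_int (mon_k b - mon_k a)) (of_int (mon_w b - mon_w a)) (\<lambda>i. of_int (mon_e b i - mon_e a i))"
  have A: "?A \<in> ker" using sys_ideal_shift[OF assms, of a] ab by simp
  have b: "weight p b \<noteq> 0" using weight_nonzero[of b p] ab by simp
  have "a1 ?A = 0" "a2 ?A = 0" "\<And>i. xc ?A i = 0" using A unfolding ker_def by auto
  then have k: "mon_k b = mon_k a" and w: "a2 ?A = 0" and e: "\<And>i. mon_e b i = mon_e a i"
    using b by (simp_all flip: of_int_diff)
  then have "mon_w b = mon_w a" using b by (simp flip: of_int_diff)
  then have "a = b" using k e by (intro mon_eqI) auto
  then show False using ab(2) by blast
qed

end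

context anisotropic_system
begin

lemma trinomial_pivot:
  assumes p: "p \<in> sys_ideal" and keys: "Poly_Mapping.keys p = {a, b, c}" and ne: "a \<noteq> b" "a \<noteq> c" "b \<noteq> c"
  shows "(mon_k b - mon_k a, mon_k c - mon_k a) \<in> {(1, -1), (-1, 1), (2, 1), (1, 2), (-1, -2), (-2, -1)}"
    and "mon_k b - mon_k a = 1 \<Longrightarrow> mon_k c - mon_k a = -1 \<Longrightarrow>
      mon_w b - mon_w a = 1 \<and> mon_w c - mon_w a = 1 \<and> weight p b = - weight p a / 2 \<and> weight p c = - weight p a / 2 \<and>
      (\<forall>i. mon_e c i - mon_e a i = - (mon_e b i - mon_e a i))"
proof -
  have "scalar (weight p a) * theta 0 0 (\<lambda>i. 0) + scalar (weight p b) *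
      theta (of_int (mon_k b - mon_k a)) (of_int (mon_w b - mon_w a)) (\<lambda>i. of_int (mon_e b i - mon_e a i)) +
      scalar (weight p c) *
      theta (of_int (mon_k c - mon_k a)) (of_int (mon_w c - mon_w a)) (\<lambda>i. of_int (mon_e c i - mon_e a i)) \<in> ker"
    using sys_ideal_shift[OF p, of a] ne by (simp add: keys add.assoc)
  then have ker: "scalar (weight p a) + scalar (weight p b) *
      theta (of_int (mon_k b - mon_k a)) (of_int (mon_w b - mon_w a)) (\<lambda>i. of_int (mon_e b i - mon_e a i)) +
      scalar (weight p c) *
      theta (of_int (mon_k c - mon_k a)) (of_int (mon_w c - mon_w a)) (\<lambda>i. of_int (mon_e c i - mon_e a i)) \<in> ker"
    by (simp only: theta_0 mult_1_right)
  have ne': "mon_k c - mon_k a \<noteq> 0 \<or> mon_w c - mon_w a \<noteq> 0 \<or> (\<lambda>i. mon_e c i - mon_e a i) \<noteq> (\<lambda>i. 0)"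
    using ne(2) mon_eqI[of c a] by (auto simp: fun_eq_iff)
  have N: "mon_e c i - mon_e a i = 0" if "N \<le> i" for i
  proof -
    have "Poly_Mapping.lookup m (i + 2) = 0" if "m \<in> Poly_Mapping.keys p" for m
    proof (rule ccontr)
      assume "Poly_Mapping.lookup m (i + 2) \<noteq> 0"
      then have "i + 2 \<in> mvars p" using that by (auto simp: mvars_def in_keys_iff)
      then show False using p \<open>N \<le> i\<close> by (auto simp: sys_ideal_def carrier_mpoly)
    qed
    then show ?thesis using keys by (simp add: mon_e_def)
  qed
  have nz: "weight p a \<noteq> 0" "weight p b \<noteq> 0" "weight p c \<noteq> 0"
    using weight_nonzero[of _ p] keys by auto
  show "(mon_k b - mon_k a, mon_k c - mon_k a) \<in> {(1, -1), (-1, 1), (2, 1), (1, 2), (-1, -2), (-2, -1)}"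
    by (rule trinomial_core(1)[OF nz ker ne' N])
  show "mon_w b - mon_w a = 1 \<and> mon_w c - mon_w a = 1 \<and> weight p b = - weight p a / 2 \<and> weight p c = - weight p a / 2 \<and>
      (\<forall>i. mon_e c i - mon_e a i = - (mon_e b i - mon_e a i))"
    if "mon_k b - mon_k a = 1" "mon_k c - mon_k a = -1"
    by (rule trinomial_core(2)[OF nz ker ne' N that])
qed

text \<open>The pivot \<open>a\<close> is the term of \<open>D^|d|\<close>; the terms with
  \<open>p - q\<close> one higher and one lower are those of \<open>S\<close> and \<open>T\<close>.
  Their exponents of \<open>D\<close> lie symmetrically about those of \<open>a\<close>, at distance
  \<open>d\<close>.\<close>

lemma trinomial_arranged:
  assumes p: "p \<in> sys_ideal" and keys: "Poly_Mapping.keys p = {a, b, c}" and ne: "a \<noteq> b" "a \<noteq> c" "b \<noteq> c"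
    and kb: "mon_k b - mon_k a = 1" and kc: "mon_k c - mon_k a = -1"
  shows "\<exists>t d. t \<in> carrier (STD_ring N) \<and> num_terms t = 1 \<and> length d = N \<and> p = t * affine_trinomial d"
proof -
  note piv = trinomial_pivot(2)[OF p keys ne kb kc]
  let ?l = "Poly_Mapping.lookup"
  have b01: "?l b 0 = Suc (?l a 0)" "?l b 1 = ?l a 1" and c01: "?l c 0 = ?l a 0" "?l c 1 = Suc (?l a 1)"
    using piv kb kc by (auto simp: mon_k_def mon_w_def)
  have cf: "?l p b = - ?l p a" "?l p c = - ?l p a"
  proof -
    define K :: rat where "K = (1/2) ^ (?l a 0 + ?l a 1)"
    have K: "K \<noteq> 0" by (simp add: K_def)
    have w: "weight p a = ?l p a * K" "weight p b = ?l p b * (K / 2)" "weight p c = ?l p c * (K / 2)"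
      unfolding weight_def b01 c01 K_def by simp_all
    have pv: "weight p b = - weight p a / 2" "weight p c = - weight p a / 2" using piv by blast+
    have "?l p b * (K / 2) = - (?l p a * K) / 2" "?l p c * (K / 2) = - (?l p a * K) / 2"
      by (simp_all only: w[symmetric] pv)
    then have "(?l p b + ?l p a) * K = 0" "(?l p c + ?l p a) * K = 0"
      unfolding distrib_right by linarith+
    then show "?l p b = - ?l p a" "?l p c = - ?l p a"
      using K by (simp_all add: eq_neg_iff_add_eq_0)
  qed
  define d where "d = map (\<lambda>i. mon_e b i - mon_e a i) [0..<N]"
  have d: "length d = N" "i < N \<Longrightarrow> d ! i = int (?l b (i + 2)) - int (?l a (i + 2))"
    "i < N \<Longrightarrow> d ! i = int (?l a (i + 2)) - int (?l c (i + 2))" for i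
    using piv by (auto simp: d_def mon_e_def)
  have supp: "?l m j = 0" if "m \<in> {a, b, c}" "N + 2 \<le> j" for m j
  proof (rule ccontr)
    assume "?l m j \<noteq> 0"
    then have "j \<in> mvars p" using that keys by (auto simp: mvars_def in_keys_iff)
    then show False using p that(2) by (auto simp: sys_ideal_def carrier_mpoly)
  qed
  let ?t = "a - mon_D N (\<lambda>i. nat \<bar>d ! i\<bar>)"
  \<comment> \<open>\<open>a + d\<close> and \<open>a - d\<close> are exponents, hence nonnegative;
    so the subtraction of \<open>|d|\<close> from \<open>a\<close> is not truncated.\<close>
  have le: "nat \<bar>d ! i\<bar> \<le> ?l a (i + 2)" if "i < N" for i
    using d(2,3)[OF that] by linarith
  have split: "j = 0 \<or> j = 1 \<or> N + 2 \<le> j \<or> (\<exists>i<N. j = i + 2)" for j :: nat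
    by (cases j; cases "j - 1") (auto simp: not_le less_Suc_eq_0_disj)
  have A: "?t + mon_D N (\<lambda>i. nat \<bar>d ! i\<bar>) = a"
  proof (rule poly_mapping_eqI)
    fix j
    show "?l (?t + mon_D N (\<lambda>i. nat \<bar>d ! i\<bar>)) j = ?l a j"
      using split[of j] le by (auto simp: lookup_add lookup_minus lookup_mon_D)
  qed
  have B: "?t + (Poly_Mapping.single 0 1 + mon_D N (\<lambda>i. nat (\<bar>d ! i\<bar> + d ! i))) = b"
  proof (rule poly_mapping_eqI)
    fix j
    consider "j = 0" | "j = 1" | "N + 2 \<le> j" | i where "i < N" "j = i + 2" using split[of j] by blast
    then show "?l (?t + (Poly_Mapping.single 0 1 + mon_D N (\<lambda>i. nat (\<bar>d ! i\<bar> + d ! i)))) j = ?l b j"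
    proof cases
      case (4 i)
      then have "?l a (i + 2) - nat \<bar>d ! i\<bar> + nat (\<bar>d ! i\<bar> + d ! i) = ?l b (i + 2)"
        using d(2)[of i] le[of i] by linarith
      with 4 show ?thesis by (simp add: lookup_add lookup_minus lookup_mon_D lookup_single)
    qed (use supp b01 in \<open>auto simp: lookup_add lookup_minus lookup_mon_D lookup_single\<close>)
  qed
  have C: "?t + (Poly_Mapping.single 1 1 + mon_D N (\<lambda>i. nat (\<bar>d ! i\<bar> - d ! i))) = c"
  proof (rule poly_mapping_eqI)
    fix j
    consider "j = 0" | "j = 1" | "N + 2 \<le> j" | i where "i < N" "j = i + 2" using split[of j] by blast
    then show "?l (?t + (Poly_Mapping.single 1 1 + mon_D N (\<lambda>i. nat (\<bar>d ! i\<bar> - d ! i)))) j = ?l c j"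
    proof cases
      case (4 i)
      then have "?l a (i + 2) - nat \<bar>d ! i\<bar> + nat (\<bar>d ! i\<bar> - d ! i) = ?l c (i + 2)"
        using d(3)[of i] le[of i] by linarith
      with 4 show ?thesis by (simp add: lookup_add lookup_minus lookup_mon_D lookup_single)
    qed (use supp c01 in \<open>auto simp: lookup_add lookup_minus lookup_mon_D lookup_single\<close>)
  qed
  let ?T = "Poly_Mapping.single ?t (?l p a)"
  have "p = Poly_Mapping.single a (?l p a) + Poly_Mapping.single b (?l p b) + Poly_Mapping.single c (?l p c)"
    by (subst poly_mapping_sum_single[of p]) (simp add: keys ne add.assoc)
  also have "\<dots> = ?T * affine_trinomial d"
    unfolding affine_trinomial_single d(1) right_diff_distrib mult_single A B C cf
    by (simp add: single_uminus)
  finally have "p = ?T * affine_trinomial d" .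
  moreover have nz: "?l p a \<noteq> 0" using keys by (metis in_keys_iff insertI1)
  then have "num_terms ?T = 1" by (simp add: num_terms_def)
  moreover have "?T \<in> carrier (STD_ring N)"
  proof -
    have "?l ?t j = 0" if "N + 2 \<le> j" for j
      using supp[of a j] that by (simp add: lookup_minus)
    then have "Poly_Mapping.keys ?t \<subseteq> {..<N + 2}" by (auto simp: in_keys_iff not_less[symmetric])
    then show ?thesis using nz by (simp add: carrier_mpoly mvars_def)
  qed
  ultimately show ?thesis using d(1) by blast
qed

lemma trinomial_form:
  assumes p: "p \<in> sys_ideal" and "num_terms p = 3"
  shows "\<exists>t d. t \<in> carrier (STD_ring N) \<and> num_terms t = 1 \<and> length d = N \<and> p = t * affine_trinomial d"
proof -
  obtain a b c where abc: "Poly_Mapping.keys p = {a, b, c}" and ne: "a \<noteq> b" "a \<noteq> c" "b \<noteq> c"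
    using assms(2) by (auto simp: num_terms_def card_3_iff)
  \<comment> \<open>Whatever the order of the terms, the one whose \<open>p - q\<close> lies in the
    middle is taken as pivot.\<close>
  have arr: ?thesis if "Poly_Mapping.keys p = {x, y, z}" "distinct [x, y, z]" "mon_k y - mon_k x = 1" "mon_k z - mon_k x = -1" for x y z
    using trinomial_arranged[OF p that(1) _ _ _ that(3,4)] that(2) by auto
  have K: "Poly_Mapping.keys p = {a, c, b}" "Poly_Mapping.keys p = {c, b, a}" "Poly_Mapping.keys p = {b, c, a}"
    "Poly_Mapping.keys p = {b, a, c}" "Poly_Mapping.keys p = {c, a, b}"
    using abc by auto
  consider "mon_k b - mon_k a = 1" "mon_k c - mon_k a = -1" | "mon_k b - mon_k a = -1" "mon_k c - mon_k a = 1"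
    | "mon_k b - mon_k a = 2" "mon_k c - mon_k a = 1" | "mon_k b - mon_k a = 1" "mon_k c - mon_k a = 2"
    | "mon_k b - mon_k a = -1" "mon_k c - mon_k a = -2" | "mon_k b - mon_k a = -2" "mon_k c - mon_k a = -1"
    using trinomial_pivot(1)[OF p abc ne] by auto
  then show ?thesis
  proof cases
    case 1
    then show ?thesis using ne by (intro arr[OF abc]) auto
  next
    case 2
    then show ?thesis using ne by (intro arr[OF K(1)]) auto
  next
    case 3
    then show ?thesis using ne by (intro arr[OF K(2)]) auto
  next
    case 4
    then show ?thesis using ne by (intro arr[OF K(3)]) auto
  next
    case 5
    then show ?thesis using ne by (intro arr[OF K(4)]) auto
  next
    case 6
    then show ?thesis using ne by (intro arr[OF K(5)]) auto
  qed
qed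

end

section \<open>Sums of four squares\<close>

definition four_squares :: "int \<Rightarrow> bool" where
  "four_squares n \<longleftrightarrow> (\<exists>a b c d. n = a^2 + b^2 + c^2 + d^2)"

lemma euler_four_squares:
  fixes a b c d :: int
  shows "(a^2 + b^2 + c^2 + d^2) * (A^2 + B^2 + C^2 + D^2) =
    (a * A + b * B + c * C + d * D)^2 + (a * B - b * A + c * D - d * C)^2 +
    (a * C - b * D - c * A + d * B)^2 + (a * D + b * C - c * B - d * A)^2"
  by (simp add: power2_eq_square algebra_simps)

lemma four_squares_mult: "four_squares m \<Longrightarrow> four_squares n \<Longrightarrow> four_squares (m * n)"
  unfolding four_squares_def using euler_four_squares by metis

lemma centered_residue:
  fixes a m :: int
  assumes "0 < m"
  obtains A k where "a = A + m * k" "2 * A \<le> m" "- m < 2 * A"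
proof -
  define t where "t = a mod m"
  have t: "0 \<le> t" "t < m" "a = t + m * (a div m)" using assms by (auto simp: t_def)
  show ?thesis
  proof (cases "2 * t \<le> m")
    case True
    show ?thesis
    proof (rule that[of t "a div m"])
      show "- m < 2 * t" using t(1) assms by linarith
    qed (use True t in auto)
  next
    case False
    show ?thesis
    proof (rule that[of "t - m" "a div m + 1"])
      show "a = t - m + m * (a div m + 1)" using t(3) unfolding distrib_left by linarith
      have "t - m \<le> 0" using t(2) by simp
      then show "2 * (t - m) \<le> m" using assms by simp
      show "- m < 2 * (t - m)" using False by simp
    qed
  qed
qed

lemma square_le_of_centered:
  fixes A m :: int
  assumes "2 * A \<le> m" "- m < 2 * A"
  shows "4 * A^2 \<le> m^2" "4 * A^2 = m^2 \<Longrightarrow> 2 * A = m"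
proof -
  have "(m - 2 * A) * (m + 2 * A) \<ge> 0" using assms by (intro mult_nonneg_nonneg) auto
  then show "4 * A^2 \<le> m^2" by (simp add: power2_eq_square algebra_simps)
  assume "4 * A^2 = m^2"
  then have "(m - 2 * A) * (m + 2 * A) = 0" by (simp add: power2_eq_square algebra_simps)
  then show "2 * A = m" using assms by auto
qed

text \<open>Lagrange's descent: centred residues modulo \<open>m\<close> have a sum of squares
  \<open>m r\<close>, and in Euler's product of the two sums all four entries are divisible by
  \<open>m\<close>, so \<open>m\<^sup>2\<close> cancels.\<close>

lemma four_squares_descent:
  fixes m p :: int
  assumes "prime p" "1 < m" "m < p" "four_squares (m * p)"
  shows "\<exists>r. 0 < r \<and> r < m \<and> four_squares (r * p)"
proof -
  obtain a b c d where abcd: "m * p = a^2 + b^2 + c^2 + d^2" using assms(4) by (auto simp: four_squares_def)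
  have m0: "0 < m" using assms(2) by simp
  obtain A ka where A: "a = A + m * ka" "2 * A \<le> m" "- m < 2 * A" using centered_residue[OF m0, of a] .
  obtain B kb where B: "b = B + m * kb" "2 * B \<le> m" "- m < 2 * B" using centered_residue[OF m0, of b] .
  obtain C kc where C: "c = C + m * kc" "2 * C \<le> m" "- m < 2 * C" using centered_residue[OF m0, of c] .
  obtain D kd where D: "d = D + m * kd" "2 * D \<le> m" "- m < 2 * D" using centered_residue[OF m0, of d] .
  have notdvd: "\<not> m^2 dvd m * p"
  proof
    assume "m^2 dvd m * p"
    then have "m dvd p" using m0 by (simp add: power2_eq_square)
    then have "m = 1 \<or> m = p" using assms(1) m0 by (simp add: prime_int_iff)
    then show False using assms(2,3) by simp
  qed
  define s where "s = A^2 + B^2 + C^2 + D^2"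
  define r where "r = p - (2 * A * ka + m * ka^2 + 2 * B * kb + m * kb^2 + 2 * C * kc + m * kc^2 + 2 * D * kd + m * kd^2)"
  have s: "s = m * r"
  proof -
    have "m * p = s + m * (2 * A * ka + m * ka^2 + 2 * B * kb + m * kb^2 + 2 * C * kc + m * kc^2 + 2 * D * kd + m * kd^2)"
      unfolding abcd s_def A(1) B(1) C(1) D(1) by (simp add: power2_eq_square algebra_simps)
    then show ?thesis unfolding r_def by (simp add: algebra_simps)
  qed
  have sq: "4 * A^2 \<le> m^2" "4 * B^2 \<le> m^2" "4 * C^2 \<le> m^2" "4 * D^2 \<le> m^2"
    using square_le_of_centered(1) A B C D by auto
  have "0 \<le> s" unfolding s_def by simp
  then have "0 \<le> r" using s m0 by (simp add: zero_le_mult_iff)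
  have "s \<le> m * m" using sq unfolding s_def power2_eq_square[of m] by linarith
  then have "r \<le> m" using s m0 by simp
  have "r \<noteq> 0"
  proof
    assume "r = 0"
    then have "A = 0" "B = 0" "C = 0" "D = 0"
      using s unfolding s_def by (auto simp: add_nonneg_eq_0_iff)
    then have "m * p = m^2 * (ka^2 + kb^2 + kc^2 + kd^2)"
      unfolding abcd A(1) B(1) C(1) D(1) by (simp add: power2_eq_square algebra_simps)
    then show False using notdvd by simp
  qed
  \<comment> \<open>Equality would force all residues to be \<open>m / 2\<close>, and then
    \<open>m\<^sup>2\<close> would divide \<open>m p\<close>.\<close>
  moreover have "r \<noteq> m"
  proof
    assume "r = m"
    then have "4 * A^2 + 4 * B^2 + 4 * C^2 + 4 * D^2 = 4 * m^2"
      using s unfolding s_def by (simp add: power2_eq_square)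
    then have "4 * A^2 = m^2" "4 * B^2 = m^2" "4 * C^2 = m^2" "4 * D^2 = m^2" using sq by linarith+
    then have half: "2 * A = m" "2 * B = m" "2 * C = m" "2 * D = m"
      using square_le_of_centered(2) A B C D by auto
    have BCD: "B = A" "C = A" "D = A" using half by auto
    have "m * p = 4 * A^2 + m^2 * (ka^2 + kb^2 + kc^2 + kd^2) + m * (2 * A * (ka + kb + kc + kd))"
      unfolding abcd A(1) B(1) C(1) D(1) BCD by (simp add: power2_eq_square algebra_simps)
    also have "\<dots> = m^2 * (1 + ka^2 + kb^2 + kc^2 + kd^2 + (ka + kb + kc + kd))"
      unfolding half(1) \<open>4 * A^2 = m^2\<close> by (simp add: power2_eq_square algebra_simps)
    finally show False using notdvd by simp
  qed
  ultimately have r: "0 < r" "r < m" using \<open>0 \<le> r\<close> \<open>r \<le> m\<close> by auto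
  let ?x = "r + A * ka + B * kb + C * kc + D * kd"
  let ?y = "B * ka - A * kb + D * kc - C * kd" and ?z = "C * ka - D * kb - A * kc + B * kd" and ?w = "D * ka + C * kb - B * kc - A * kd"
  have 1: "a * A + b * B + c * C + d * D = m * ?x"
  proof -
    have "a * A + b * B + c * C + d * D = s + m * (A * ka + B * kb + C * kc + D * kd)"
      unfolding A(1) B(1) C(1) D(1) s_def by (simp add: power2_eq_square algebra_simps)
    then show ?thesis unfolding s by (simp add: algebra_simps)
  qed
  have 2: "a * B - b * A + c * D - d * C = m * ?y" "a * C - b * D - c * A + d * B = m * ?z"
    "a * D + b * C - c * B - d * A = m * ?w"
    unfolding A(1) B(1) C(1) D(1) by (simp_all add: algebra_simps)
  have "m^2 * (r * p) = (m * p) * s" unfolding s by (simp add: power2_eq_square)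
  also have "\<dots> = (m * ?x)^2 + (m * ?y)^2 + (m * ?z)^2 + (m * ?w)^2"
    unfolding abcd s_def euler_four_squares 1 2 ..
  also have "\<dots> = m^2 * (?x^2 + ?y^2 + ?z^2 + ?w^2)"
  proof -
    have "(m * x)^2 + (m * y)^2 + (m * z)^2 + (m * w)^2 = m^2 * (x^2 + y^2 + z^2 + w^2)" for x y z w
      by (simp add: power_mult_distrib distrib_left)
    then show ?thesis .
  qed
  finally have "m^2 * (r * p) = m^2 * (?x^2 + ?y^2 + ?z^2 + ?w^2)" .
  then have "r * p = ?x^2 + ?y^2 + ?z^2 + ?w^2" using m0 by simp
  then show ?thesis using r unfolding four_squares_def by blast
qed

lemma square_residues_inj:
  fixes p :: int
  assumes "prime p" "odd p"
  shows "inj_on (\<lambda>x. x^2 mod p) {0..(p - 1) div 2}"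
proof (rule inj_onI)
  fix x y assume xy: "x \<in> {0..(p - 1) div 2}" "y \<in> {0..(p - 1) div 2}" "x^2 mod p = y^2 mod p"
  have "p dvd x^2 - y^2" using xy(3) by (simp add: mod_eq_dvd_iff)
  then have "p dvd (x - y) * (x + y)" by (simp add: power2_eq_square algebra_simps)
  then have dvd: "p dvd x - y \<or> p dvd x + y" using assms(1) prime_dvd_mult_iff by blast
  have b: "0 \<le> x" "0 \<le> y" "x + y < p" "0 < p" using xy assms by (auto elim!: oddE simp: prime_gt_0_int)
  from dvd show "x = y"
  proof
    assume "p dvd x - y"
    moreover have "\<bar>x - y\<bar> < p" using b by arith
    ultimately show "x = y" using zdvd_not_zless[of "\<bar>x - y\<bar>" p] b by (cases "x = y") auto
  next
    assume "p dvd x + y"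
    then have "x + y = 0" using zdvd_not_zless[of "x + y" p] b by (cases "x + y = 0") auto
    then show "x = y" using b by simp
  qed
qed

text \<open>Pigeonhole: \<open>x\<^sup>2\<close> and \<open>-1 - y\<^sup>2\<close> take
  \<open>(p + 1) / 2\<close> residues each, too many to be disjoint modulo \<open>p\<close>.\<close>

lemma prime_dvd_two_squares_Suc:
  fixes p :: int
  assumes "prime p" "odd p"
  shows "\<exists>x y. 0 \<le> x \<and> 0 \<le> y \<and> 2 * x < p \<and> 2 * y < p \<and> p dvd x^2 + y^2 + 1"
proof -
  let ?H = "{0..(p - 1) div 2}"
  let ?f = "\<lambda>x. x^2 mod p" and ?g = "\<lambda>y. (- 1 - y^2) mod p"
  have p0: "0 < p" using assms(1) prime_gt_0_int by blast
  have f: "inj_on ?f ?H" by (rule square_residues_inj[OF assms])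
  have g: "inj_on ?g ?H"
  proof (rule inj_onI)
    fix x y assume xy: "x \<in> ?H" "y \<in> ?H" "?g x = ?g y"
    have "p dvd (- 1 - x^2) - (- 1 - y^2)" using xy(3) by (simp add: mod_eq_dvd_iff)
    then have "p dvd y^2 - x^2" by simp
    then have "?f y = ?f x" by (simp add: mod_eq_dvd_iff)
    then show "x = y" using f xy by (auto simp: inj_on_def)
  qed
  have "?f ` ?H \<inter> ?g ` ?H \<noteq> {}"
  proof
    assume disj: "?f ` ?H \<inter> ?g ` ?H = {}"
    have "card (?f ` ?H \<union> ?g ` ?H) = card (?f ` ?H) + card (?g ` ?H)"
      using disj by (intro card_Un_disjoint) auto
    also have "\<dots> = 2 * card ?H" using card_image[OF f] card_image[OF g] by simp
    finally have "card (?f ` ?H \<union> ?g ` ?H) = 2 * card ?H" .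
    moreover have "card (?f ` ?H \<union> ?g ` ?H) \<le> card {0..<p}"
      using p0 by (intro card_mono) auto
    ultimately have "2 * nat ((p - 1) div 2 + 1) \<le> nat p" by simp
    then show False using assms(2) p0 by (auto elim!: oddE)
  qed
  then obtain x y where xy: "x \<in> ?H" "y \<in> ?H" "?f x = ?g y" by blast
  have "p dvd x^2 - (- 1 - y^2)" using xy(3) by (simp add: mod_eq_dvd_iff)
  then have "p dvd x^2 + y^2 + 1" by (simp add: algebra_simps)
  moreover have "2 * x < p" "2 * y < p" using xy p0 by auto
  ultimately show ?thesis using xy by auto
qed

lemma four_squares_prime:
  fixes p :: int
  assumes "prime p" shows "four_squares p"
proof (cases "odd p")
  case True
  obtain x y where xy: "0 \<le> x" "0 \<le> y" "2 * x < p" "2 * y < p" "p dvd x^2 + y^2 + 1"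
    using prime_dvd_two_squares_Suc[OF assms True] by blast
  have p0: "1 < p" using assms prime_gt_1_int by blast
  obtain m where m: "x^2 + y^2 + 1 = p * m" using xy(5) by blast
  have "four_squares (m * p)"
    unfolding four_squares_def using m by (intro exI[of _ x] exI[of _ y] exI[of _ 1] exI[of _ 0]) (simp add: mult.commute)
  moreover have "0 < m"
  proof -
    have "0 < p * m" unfolding m[symmetric] by (simp add: add_nonneg_pos)
    then show ?thesis using p0 by (simp add: zero_less_mult_iff)
  qed
  \<comment> \<open>The descent has to start below \<open>p\<close>, which is what the bounds on
    \<open>x\<close> and \<open>y\<close> are for.\<close>
  moreover have "m < p"
  proof -
    have "(2 * x)^2 \<le> (p - 1)^2" "(2 * y)^2 \<le> (p - 1)^2" using xy by (intro power_mono; simp)+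
    then have "4 * (p * m) \<le> 2 * (p - 1)^2 + 4" unfolding m[symmetric] by (simp add: power_mult_distrib)
    also have "\<dots> < 4 * (p * p)"
    proof -
      have "p * p \<ge> 2 * p" using p0 by (intro mult_right_mono) auto
      moreover have "(p - 1)^2 = p * p - 2 * p + 1" by (simp add: power2_eq_square algebra_simps)
      ultimately show ?thesis using p0 by linarith
    qed
    finally show ?thesis using p0 by simp
  qed
  ultimately show ?thesis
  proof (induction "nat m" arbitrary: m rule: less_induct)
    case less
    show ?case
    proof (cases "m = 1")
      case True
      then show ?thesis using less.prems by simp
    next
      case False
      then obtain r where "0 < r" "r < m" "four_squares (r * p)"
        using four_squares_descent[OF assms, of m] less.prems by auto
      then show ?thesis using less.hyps[of r] less.prems by auto
    qed
  qed
next
  case False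
  then have "p = 2" using assms by (simp add: prime_int_iff) (metis even_iff_mod_2_eq_zero mod_0_imp_dvd numeral_eq_one_iff semiring_norm(85) zero_le_numeral)
  then show ?thesis
    unfolding four_squares_def by (intro exI[of _ 1] exI[of _ 0]) simp
qed

theorem four_squares_nat: "four_squares (int n)"
proof (induction n rule: less_induct)
  case (less n)
  consider "n = 0" | "n = 1" | "1 < n" by linarith
  then show ?case
  proof cases
    case 1
    then show ?thesis unfolding four_squares_def by (intro exI[of _ 0]) simp
  next
    case 2
    show ?thesis unfolding four_squares_def 2
      by (rule exI[of _ 1], rule exI[of _ 0], rule exI[of _ 0], rule exI[of _ 0]) simp
  next
    case 3
    then obtain p where p: "prime p" "p dvd n" using prime_factor_nat[of n] by auto
    then obtain m where m: "n = p * m" by blast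
    have "0 < m" using m 3 by (cases m) auto
    then have "m < n" using m prime_gt_1_nat[OF p(1)] by simp
    then have "four_squares (int m)" by (rule less)
    moreover have "four_squares (int p)" using p(1) by (intro four_squares_prime) simp
    ultimately show ?thesis unfolding m by (simp add: four_squares_mult)
  qed
qed

section \<open>An anisotropic system of quadratic equations that controls an integer\<close>

text \<open>
  Write \<open>\<phi>\<close> for the golden ratio. The equation \<open>\<Sum>\<^sub>t\<^sub><\<^sub>9 X\<^sub>t\<^sup>2 - \<phi> X\<^sub>9\<^sup>2 = 3\<close> over \<open>\<int>[\<phi>]\<close> is a pair of
  quadratic equations over \<open>\<int>\<close>. Its leading form is anisotropic, because the conjugate of \<open>\<phi>\<close> is negative. Still every
  integer occurs as the \<open>\<phi>\<close>-coordinate of \<open>X\<^sub>0\<close> in a solution: choose \<open>X\<^sub>0\<close> and \<open>X\<^sub>9\<close> with conjugates in \<open>[0, 1)\<close>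
  and \<open>X\<^sub>9\<close> large. Then \<open>3 + \<phi> X\<^sub>9\<^sup>2 - X\<^sub>0\<^sup>2\<close> is totally positive, hence a sum of eight squares: up to multiplication by
  a power of \<open>\<phi>\<^sup>2\<close> it is \<open>m + n \<phi>\<^sup>2\<close> with natural numbers \<open>m\<close>, \<open>n\<close>.
\<close>

definition eight_squares :: "int \<Rightarrow> int \<Rightarrow> bool" where
  "eight_squares A B \<longleftrightarrow> (\<exists>a b. A = (\<Sum>t<8::nat. a t ^ 2 + b t ^ 2) \<and> B = (\<Sum>t<8::nat. 2 * a t * b t + b t ^ 2))"

text \<open>\<open>A + B \<phi> = (A - B) + B \<phi>\<^sup>2\<close> is a sum of four squares of
  integers and four squares of multiples of \<open>\<phi>\<close>.\<close>

lemma eight_squares_natural: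
  assumes "0 \<le> B" "B \<le> A" shows "eight_squares A B"
proof -
  obtain p q r s where 1: "A - B = p^2 + q^2 + r^2 + s^2"
    using four_squares_nat[of "nat (A - B)"] assms by (auto simp: four_squares_def)
  obtain p' q' r' s' where 2: "B = p'^2 + q'^2 + r'^2 + s'^2"
    using four_squares_nat[of "nat B"] assms by (auto simp: four_squares_def)
  have 8: "{..<8::nat} = {0, 1, 2, 3, 4, 5, 6, 7}" by auto
  show ?thesis
    unfolding eight_squares_def 8
    by (rule exI[of _ "nth [p, q, r, s, 0, 0, 0, 0]"], rule exI[of _ "nth [0, 0, 0, 0, p', q', r', s']"])
      (use 1 2 in \<open>simp add: eval_nat_numeral\<close>)
qed

text \<open>Multiplication by \<open>\<phi>^2\<close> and \<open>\<phi>^(-2)\<close>; the new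
  entries are the old ones times \<open>\<phi>\<close> and \<open>1 / \<phi>\<close>.\<close>

lemma eight_squares_shift:
  assumes "eight_squares A B" shows "eight_squares (A + B) (A + 2 * B)" "eight_squares (2 * A - B) (B - A)"
proof -
  obtain a b where A: "A = (\<Sum>t<8::nat. a t ^ 2 + b t ^ 2)" and B: "B = (\<Sum>t<8::nat. 2 * a t * b t + b t ^ 2)"
    using assms by (auto simp: eight_squares_def)
  show "eight_squares (A + B) (A + 2 * B)"
    unfolding eight_squares_def A B sum.distrib[symmetric] sum_distrib_left
    by (rule exI[of _ b], rule exI[of _ "\<lambda>t. a t + b t"])
      (auto intro!: sum.cong simp: power2_eq_square algebra_simps)
  show "eight_squares (2 * A - B) (B - A)"
    unfolding eight_squares_def A B sum_subtractf[symmetric] sum_distrib_left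
    by (rule exI[of _ "\<lambda>t. b t - a t"], rule exI[of _ a])
      (auto intro!: sum.cong simp: power2_eq_square algebra_simps)
qed

text \<open>The second hypothesis is positivity of the norm. Multiplication by
  \<open>\<phi>^2\<close> if \<open>B < 0\<close> and by \<open>\<phi>^(-2)\<close> if
  \<open>A < B\<close> preserves it and decreases \<open>A\<close>, which stays positive, until
  \<open>0 \<le> B \<le> A\<close>.\<close>

lemma eight_squares_totally_positive:
  assumes "0 < A" "0 < A^2 + A * B - B^2"
  shows "eight_squares A B"
  using assms
proof (induction "nat A" arbitrary: A B rule: less_induct)
  case less
  consider "0 \<le> B" "B \<le> A" | "B < 0" | "A < B" by linarith
  then show ?case
  proof cases
    case 1
    then show ?thesis by (rule eight_squares_natural)
  next
    case 2
    have "0 < A * (A + B)"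
      using less.prems(2) zero_le_power2[of B] unfolding power2_eq_square distrib_left by linarith
    then have pos: "0 < A + B" using less.prems(1) by (simp add: zero_less_mult_iff)
    have "(A + B)^2 + (A + B) * (A + 2 * B) - (A + 2 * B)^2 = A^2 + A * B - B^2"
      by (simp add: power2_eq_square algebra_simps)
    then have "eight_squares (A + B) (A + 2 * B)"
      using pos 2 less.prems by (intro less.hyps) auto
    from eight_squares_shift(2)[OF this] show ?thesis by simp
  next
    case 3
    have pos: "0 < 2 * A - B"
    proof (rule ccontr)
      assume "\<not> 0 < 2 * A - B"
      then have "A * (2 * A) \<le> B * B - A * B"
        using 3 less.prems(1) mult_mono[of A "B - A" "2 * A" B] by (simp add: algebra_simps)
      moreover have "0 < A * A" using less.prems(1) by simp
      ultimately show False using less.prems(2) by (simp add: power2_eq_square)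
    qed
    have "(2 * A - B)^2 + (2 * A - B) * (B - A) - (B - A)^2 = A^2 + A * B - B^2"
      by (simp add: power2_eq_square algebra_simps)
    then have "eight_squares (2 * A - B) (B - A)"
      using pos 3 less.prems by (intro less.hyps) auto
    from eight_squares_shift(1)[OF this] show ?thesis by simp
  qed
qed

text \<open>Together with \<open>control2\<close>, the coordinates at \<open>1\<close> and
  \<open>\<phi>\<close> of the form in \<open>X\<^sub>t = a t + b t \<phi>\<close>.\<close>

definition control1 :: "(nat \<Rightarrow> int) \<Rightarrow> (nat \<Rightarrow> int) \<Rightarrow> int" where
  "control1 a b = (\<Sum>t<9. a t ^ 2 + b t ^ 2) - (2 * a 9 * b 9 + b 9 ^ 2)"

definition control2 :: "(nat \<Rightarrow> int) \<Rightarrow> (nat \<Rightarrow> int) \<Rightarrow> int" where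
  "control2 a b = (\<Sum>t<9. 2 * a t * b t + b t ^ 2) - (a 9 ^ 2 + 2 * a 9 * b 9 + 2 * b 9 ^ 2)"

definition phi :: real where "phi = (1 + sqrt 5) / 2"
definition psi :: real where "psi = (1 - sqrt 5) / 2"

lemma sqrt5: "2 < sqrt 5" "sqrt 5 < 3"
  by (simp_all add: real_less_rsqrt real_less_lsqrt)

lemma phi_psi: "phi^2 = phi + 1" "psi^2 = psi + 1" "1 < phi" "psi < 0" "- 1 < psi" "1 \<le> phi - psi" "phi + psi = 1" "phi * psi = - 1"
  using sqrt5 by (simp_all add: phi_def psi_def power2_eq_square field_simps)

lemma golden_square: "x^2 = x + 1 \<Longrightarrow> (a + b * x)^2 = (a^2 + b^2) + (2 * a * b + b^2) * x" for a b x :: real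
proof -
  assume "x^2 = x + 1"
  moreover have "(a + b * x)^2 = a^2 + 2 * a * b * x + b^2 * x^2" by (simp add: power2_eq_square algebra_simps)
  ultimately show ?thesis by (simp add: algebra_simps)
qed

lemma golden_times_square:
  "x^2 = x + 1 \<Longrightarrow> x * (a + b * x)^2 = (2 * a * b + b^2) + (a^2 + 2 * a * b + 2 * b^2) * x" for a b x :: real
proof -
  assume x: "x^2 = x + 1"
  have "x * (a + b * x)^2 = (a^2 + b^2) * x + (2 * a * b + b^2) * x^2"
    unfolding golden_square[OF x] by (simp add: power2_eq_square algebra_simps)
  then show ?thesis unfolding x by (simp add: algebra_simps)
qed

lemma no_sqrt5:
  fixes b c :: int
  assumes "c^2 = 5 * b^2" shows "b = 0"
  using assms
proof (induction "nat \<bar>b\<bar>" arbitrary: b c rule: less_induct)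
  case less
  have five: "prime (5 :: int)" by simp
  have "5 dvd c^2" using less.prems by simp
  then obtain c' where c: "c = 5 * c'" using five prime_dvd_power by blast
  have b: "b^2 = 5 * c'^2" using less.prems unfolding c by (simp add: power2_eq_square)
  then have "5 dvd b^2" by simp
  then obtain b' where b': "b = 5 * b'" using five prime_dvd_power by blast
  have "c'^2 = 5 * b'^2" using b unfolding b' by (simp add: power2_eq_square)
  show ?case
  proof (rule ccontr)
    assume "b \<noteq> 0"
    then have "b' = 0" using b' by (intro less.hyps[OF _ \<open>c'^2 = 5 * b'^2\<close>]) auto
    then show False using b' \<open>b \<noteq> 0\<close> by simp
  qed
qed

lemma golden_integer_zero:
  fixes a b :: int
  assumes "of_int a + of_int b * psi = 0" shows "a = 0 \<and> b = 0"
proof -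
  have "(of_int a + of_int b * psi) * (of_int a + of_int b * phi) =
      real_of_int a ^ 2 + of_int a * of_int b * (phi + psi) + of_int b ^ 2 * (phi * psi)"
    by (simp add: power2_eq_square algebra_simps)
  then have "real_of_int a ^ 2 + of_int a * of_int b - of_int b ^ 2 = 0"
    unfolding assms phi_psi by simp
  then have "real_of_int (a^2 + a * b - b^2) = 0" by simp
  then have "a^2 + a * b - b^2 = 0" by (simp only: of_int_eq_0_iff)
  then have "(2 * a + b)^2 = 5 * b^2" by (simp add: power2_eq_square algebra_simps)
  then have "b = 0" by (rule no_sqrt5)
  then show ?thesis using assms by simp
qed

lemma control_anisotropic:
  assumes "control1 a b = 0" "control2 a b = 0" "t < 10"
  shows "a t = 0 \<and> b t = 0"
proof -
  let ?z = "\<lambda>t. real_of_int (a t) + of_int (b t) * psi"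
  have "(\<Sum>t<9. ?z t ^ 2) - psi * ?z 9 ^ 2 = of_int (control1 a b) + of_int (control2 a b) * psi"
    unfolding golden_times_square[OF phi_psi(2)] unfolding golden_square[OF phi_psi(2)] control1_def control2_def
    by (simp add: sum.distrib sum_distrib_right distrib_right left_diff_distrib)
  then have eq: "(\<Sum>t<9. ?z t ^ 2) + (- psi) * ?z 9 ^ 2 = 0" using assms by simp
  have nn: "0 \<le> (\<Sum>t<9. ?z t ^ 2)" "0 \<le> (- psi) * ?z 9 ^ 2"
    using phi_psi(4) mult_nonneg_nonneg[of "- psi" "?z 9 ^ 2"] by (simp_all add: sum_nonneg)
  then have 0: "(\<Sum>t<9. ?z t ^ 2) = 0" "(- psi) * ?z 9 ^ 2 = 0" using eq by linarith+
  have "?z 9 = 0" using 0(2) phi_psi(4) by simp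
  moreover have "?z t = 0" if "t < 9" for t
    using 0(1) that by (subst (asm) sum_nonneg_eq_0_iff) auto
  ultimately have "?z t = 0" using assms(3) by (cases "t = 9") auto
  then show ?thesis by (rule golden_integer_zero)
qed

lemma control_solvable: "\<exists>a b. b 0 = x \<and> control1 a b = 3 \<and> control2 a b = 0"
proof -
  define a0 where "a0 = - \<lfloor>of_int x * psi\<rfloor>"
  let ?x = "real_of_int a0 + of_int x * phi" and ?x' = "real_of_int a0 + of_int x * psi"
  define k where "k = \<lceil>\<bar>?x\<bar>\<rceil>"
  define a9 where "a9 = - \<lfloor>of_int k * psi\<rfloor>"
  let ?y = "real_of_int a9 + of_int k * phi" and ?y' = "real_of_int a9 + of_int k * psi"
  have x': "0 \<le> ?x'" "?x' \<le> 1" unfolding a0_def by linarith+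
  have y': "0 \<le> ?y'" "?y' \<le> 1" unfolding a9_def by linarith+
  have k: "0 \<le> k" "\<bar>?x\<bar> \<le> of_int k" unfolding k_def by linarith+
  have y: "of_int k \<le> ?y"
  proof -
    have "real_of_int k * 1 \<le> of_int k * (phi - psi)" using k phi_psi(6) by (intro mult_left_mono) auto
    then show ?thesis using y'(1) by (simp add: right_diff_distrib)
  qed
  define A where "A = 3 + (2 * a9 * k + k^2) - (a0^2 + x^2)"
  define B where "B = (a9^2 + 2 * a9 * k + 2 * k^2) - (2 * a0 * x + x^2)"
  have h: "of_int A + of_int B * phi = 3 + phi * ?y^2 - ?x^2"
    unfolding golden_times_square[OF phi_psi(1)] unfolding golden_square[OF phi_psi(1)] A_def B_def
    by (simp add: algebra_simps)
  have h': "of_int A + of_int B * psi = 3 + psi * ?y'^2 - ?x'^2"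
    unfolding golden_times_square[OF phi_psi(2)] unfolding golden_square[OF phi_psi(2)] A_def B_def
    by (simp add: algebra_simps)
  have "?x^2 \<le> (of_int k)^2" using k by (intro abs_le_square_iff[THEN iffD1]) auto
  also have "\<dots> \<le> ?y^2" using y k by (intro power_mono) auto
  also have "\<dots> \<le> phi * ?y^2" using phi_psi(3) mult_right_mono[of 1 phi "?y^2"] by simp
  finally have hpos: "0 < of_int A + of_int B * phi" unfolding h by simp
  \<comment> \<open>Under the second embedding \<open>psi * ?y'^2\<close> and \<open>- ?x'^2\<close>
    cost at most \<open>1\<close> each; hence the constant \<open>3\<close> in the equation.\<close>
  have "?x'^2 \<le> 1" "?y'^2 \<le> 1" using x' y' by (simp_all add: power_le_one)
  moreover have "(- psi) * ?y'^2 \<le> 1 * 1"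
    using phi_psi(4,5) \<open>?y'^2 \<le> 1\<close> by (intro mult_mono) auto
  ultimately have hpos': "0 < of_int A + of_int B * psi" unfolding h' by simp
  have "(of_int A + of_int B * phi) * (of_int A + of_int B * psi) =
      real_of_int A ^ 2 + of_int A * of_int B * (phi + psi) + of_int B ^ 2 * (phi * psi)"
    by (simp add: power2_eq_square algebra_simps)
  then have "0 < real_of_int A ^ 2 + of_int A * of_int B - of_int B ^ 2"
    using mult_pos_pos[OF hpos hpos'] unfolding phi_psi by simp
  then have "0 < real_of_int (A^2 + A * B - B^2)" by simp
  then have norm: "0 < A^2 + A * B - B^2" by (simp only: of_int_0_less_iff)
  \<comment> \<open>Positivity of both conjugates passes to \<open>A\<close>, because
    \<open>psi < 0 < phi\<close>.\<close>
  have "phi * (of_int A + of_int B * psi) + (- psi) * (of_int A + of_int B * phi) = of_int A * (phi - psi)"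
    by (simp add: algebra_simps)
  moreover have "0 < phi * (of_int A + of_int B * psi)" "0 < (- psi) * (of_int A + of_int B * phi)"
    using mult_pos_pos[OF _ hpos', of phi] mult_pos_pos[OF _ hpos, of "- psi"] phi_psi(3,4) by simp_all
  ultimately have "0 < of_int A * (phi - psi)" by linarith
  then have "0 < A" using phi_psi(6) by (simp add: zero_less_mult_iff)
  then obtain a b where ab: "A = (\<Sum>t<8::nat. a t ^ 2 + b t ^ 2)" "B = (\<Sum>t<8::nat. 2 * a t * b t + b t ^ 2)"
    using eight_squares_totally_positive[OF _ norm] unfolding eight_squares_def by blast
  \<comment> \<open>\<open>X\<^sub>1, \<dots>, X\<^sub>8\<close> represent
    \<open>A + B \<phi>\<close>; with \<open>X\<^sub>0\<close> they make up the nine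
    squares.\<close>
  let ?a = "\<lambda>t. if t = 9 then a9 else case_nat a0 a t" and ?b = "\<lambda>t. if t = 9 then k else case_nat x b t"
  have 9: "(\<Sum>t<9. f t) = f 0 + (\<Sum>t<8. f (Suc t))" for f :: "nat \<Rightarrow> int"
    using sum.lessThan_Suc_shift[of f 8] by simp
  have "control1 ?a ?b = 3" unfolding control1_def 9 using ab(1) by (simp add: A_def)
  moreover have "control2 ?a ?b = 0" unfolding control2_def 9 using ab(2) by (simp add: B_def)
  ultimately show ?thesis by (intro exI[of _ ?a] exI[of _ ?b]) simp
qed

section \<open>The quadratic system of a polynomial\<close>

text \<open>
  The system has blocks of \<open>20\<close> variables. The variable \<open>b\<^sub>0\<close> of block \<open>i\<close> is the base variable number \<open>i\<close>;
  the rest of the block controls it. The base variables are the variables of the polynomial, followed by the intermediate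
  results of a straight line program that evaluates it.
\<close>

definition base_index :: "nat \<Rightarrow> nat" where
  "base_index i = 20 * i + 2"

text \<open>A state holds the number of base variables and their equations. The running product is
  always the last variable, so each step appends one quadratic equation.\<close>

definition mul_step :: "nat \<Rightarrow> nat \<times> equation list \<Rightarrow> nat \<times> equation list" where
  "mul_step i s = (Suc (fst s), [(1, 0, base_index (fst s)), (-1, base_index (fst s - 1), base_index i)] # snd s)"

definition power_step :: "nat \<times> nat \<times> equation list \<Rightarrow> nat \<Rightarrow> nat \<times> nat \<times> equation list" where
  "power_step s e = (Suc (fst s), (mul_step (fst s) ^^ e) (snd s))"

definition start_term :: "nat \<times> equation list \<Rightarrow> int \<Rightarrow> nat \<times> equation list" where
  "start_term s c = (Suc (fst s), [(1, 0, base_index (fst s)), (- c, 0, 0)] # snd s)"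

definition add_step :: "nat \<Rightarrow> nat \<times> equation list \<Rightarrow> nat \<times> nat \<times> equation list" where
  "add_step a s = (fst s, Suc (fst s),
     [(1, 0, base_index (fst s)), (-1, 0, base_index a), (-1, 0, base_index (fst s - 1))] # snd s)"

definition term_step :: "nat \<times> nat \<times> equation list \<Rightarrow> int \<times> nat list \<Rightarrow> nat \<times> nat \<times> equation list" where
  "term_step s t = add_step (fst s) (snd (foldl power_step (0, start_term (snd s) (fst t)) (snd t)))"

text \<open>Variable \<open>n\<close> has the value zero and starts the sum. The index of the
  current partial sum is kept in the state, since that variable is no longer the last one while a
  term is computed.\<close>

definition program :: "nat \<Rightarrow> (int \<times> nat list) list \<Rightarrow> nat \<times> nat \<times> equation list" where
  "program n ts = foldl term_step (n, Suc n, [[(1, 0, base_index n)]]) ts"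

definition num_base :: "nat \<Rightarrow> (int \<times> nat list) list \<Rightarrow> nat" where
  "num_base n ts = fst (snd (program n ts))"

definition base_eqs :: "nat \<Rightarrow> (int \<times> nat list) list \<Rightarrow> equation list" where
  "base_eqs n ts = [(1, 0, base_index (fst (program n ts)))] # snd (snd (program n ts))"

text \<open>Inside a block \<open>a t\<close> has index \<open>2 t + 1\<close> and
  \<open>b t\<close> has index \<open>2 t + 2\<close>; so \<open>19\<close> and \<open>20\<close>
  belong to \<open>X\<^sub>9\<close>, and \<open>b 0\<close> has index \<open>2\<close>, as in
  \<open>base_index\<close>.\<close>

definition control_eq1 :: equation where
  "control_eq1 = (-3, 0, 0) # concat (map (\<lambda>t. [(1, 2 * t + 1, 2 * t + 1), (1, 2 * t + 2, 2 * t + 2)]) [0..<9]) @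
     [(-2, 19, 20), (-1, 20, 20)]"

definition control_eq2 :: equation where
  "control_eq2 = concat (map (\<lambda>t. [(2, 2 * t + 1, 2 * t + 2), (1, 2 * t + 2, 2 * t + 2)]) [0..<9]) @
     [(-1, 19, 19), (-2, 19, 20), (-2, 20, 20)]"

definition shift_index :: "nat \<Rightarrow> nat \<Rightarrow> nat" where
  "shift_index i j = (if j = 0 then 0 else 20 * i + j)"

definition shift_eq :: "nat \<Rightarrow> equation \<Rightarrow> equation" where
  "shift_eq i E = map (\<lambda>t. (fst t, shift_index i (fst (snd t)), shift_index i (snd (snd t)))) E"

definition control_eqs :: "nat \<Rightarrow> equation list" where
  "control_eqs m = concat (map (\<lambda>i. [shift_eq i control_eq1, shift_eq i control_eq2]) [0..<m])"

definition poly_eqs :: "nat \<Rightarrow> (int \<times> nat list) list \<Rightarrow> equation list" where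
  "poly_eqs n ts = base_eqs n ts @ control_eqs (num_base n ts)"

section \<open>Correctness of the straight line program\<close>

definition bounded :: "nat \<Rightarrow> equation \<Rightarrow> bool" where
  "bounded m E \<longleftrightarrow> (\<forall>t \<in> set E. fst (snd t) \<le> 20 * m \<and> snd (snd t) \<le> 20 * m)"

definition satisfies :: "(nat \<Rightarrow> int) \<Rightarrow> equation list \<Rightarrow> bool" where
  "satisfies z Es \<longleftrightarrow> (\<forall>E \<in> set Es. eq_value z E = 0)"

text \<open>The equations \<open>Es\<close> express that the base variable \<open>i\<close> has the value \<open>g i\<close> for all \<open>i < m\<close>.\<close>

definition determines :: "nat \<Rightarrow> (nat \<Rightarrow> int) \<Rightarrow> nat \<times> equation list \<Rightarrow> (nat \<Rightarrow> int) \<Rightarrow> bool" where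
  "determines n y s g \<longleftrightarrow> n < fst s \<and> (\<forall>i<n. g i = y i) \<and> (\<forall>E \<in> set (snd s). bounded (fst s) E) \<and>
     (\<forall>z. z 0 = 1 \<longrightarrow> (\<forall>i<n. z (base_index i) = y i) \<longrightarrow>
       (satisfies z (snd s) \<longleftrightarrow> (\<forall>i<fst s. z (base_index i) = g i)))"

lemma determines_extend:
  assumes g: "determines n y (m, Es) g" and E: "bounded (Suc m) E"
    and v: "\<And>z. z 0 = 1 \<Longrightarrow> (\<And>i. i < m \<Longrightarrow> z (base_index i) = g i) \<Longrightarrow> eq_value z E = 0 \<longleftrightarrow> z (base_index m) = v"
  shows "determines n y (Suc m, E # Es) (g(m := v))"
proof -
  have "bounded (Suc m) F" if "bounded m F" for F using that by (force simp: bounded_def)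
  moreover have "satisfies z (E # Es) \<longleftrightarrow> (\<forall>i<Suc m. z (base_index i) = (g(m := v)) i)"
    if z: "z 0 = 1" "\<forall>i<n. z (base_index i) = y i" for z
  proof -
    have "satisfies z (E # Es) \<longleftrightarrow> eq_value z E = 0 \<and> (\<forall>i<m. z (base_index i) = g i)"
      using g z by (auto simp: determines_def satisfies_def)
    also have "\<dots> \<longleftrightarrow> z (base_index m) = v \<and> (\<forall>i<m. z (base_index i) = g i)"
      using v[of z, OF z(1)] by blast
    also have "\<dots> \<longleftrightarrow> (\<forall>i<Suc m. z (base_index i) = (g(m := v)) i)"
      by (auto simp: less_Suc_eq)
    finally show ?thesis .
  qed
  ultimately show ?thesis using g E by (auto simp: determines_def)
qed

text \<open>While a term is multiplied out, the partial sum \<open>v\<close> at index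
  \<open>a\<close> is remembered beside the product \<open>w\<close> in the last variable.\<close>

definition computes_last :: "nat \<Rightarrow> (nat \<Rightarrow> int) \<Rightarrow> nat \<Rightarrow> int \<Rightarrow> nat \<times> equation list \<Rightarrow> int \<Rightarrow> bool" where
  "computes_last n y a v s w \<longleftrightarrow> a < fst s \<and> (\<exists>g. determines n y s g \<and> g a = v \<and> g (fst s - 1) = w)"

definition computes_at_index :: "nat \<Rightarrow> (nat \<Rightarrow> int) \<Rightarrow> nat \<times> nat \<times> equation list \<Rightarrow> int \<Rightarrow> bool" where
  "computes_at_index n y s v \<longleftrightarrow> fst s < fst (snd s) \<and> (\<exists>g. determines n y (snd s) g \<and> g (fst s) = v)"

lemma mul_step_last:
  assumes "computes_last n y a v s w" "i < n"
  shows "computes_last n y a v (mul_step i s) (w * y i)"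
proof -
  obtain m Es where s: "s = (m, Es)" by (cases s)
  obtain g where g: "determines n y (m, Es) g" "g a = v" "g (m - 1) = w" and am: "a < m"
    using assms(1) by (auto simp: computes_last_def s)
  have nm: "n < m" and gi: "g i = y i" using g(1) assms(2) by (auto simp: determines_def)
  have "determines n y (Suc m, [(1, 0, base_index m), (-1, base_index (m - 1), base_index i)] # Es) (g(m := w * y i))"
    using nm assms(2) gi g(3) by (intro determines_extend[OF g(1)]) (auto simp: bounded_def base_index_def)
  then show ?thesis
    using am g nm by (auto simp: computes_last_def mul_step_def s intro!: exI[of _ "g(m := w * y i)"])
qed

lemma mul_steps_last:
  assumes "computes_last n y a v s w" "i < n"
  shows "computes_last n y a v ((mul_step i ^^ e) s) (w * y i ^ e)"
proof (induction e)
  case (Suc e)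
  then show ?case using mul_step_last[OF Suc assms(2)] by (simp add: ac_simps)
qed (use assms in simp)

lemma power_steps_last:
  assumes "computes_last n y a v s w" "i + length es \<le> n"
  shows "computes_last n y a v (snd (foldl power_step (i, s) es)) (w * (\<Prod>j<length es. y (i + j) ^ (es ! j)))"
  using assms
proof (induction es arbitrary: i s w)
  case (Cons e es)
  have "computes_last n y a v ((mul_step i ^^ e) s) (w * y i ^ e)"
    using Cons.prems by (intro mul_steps_last) auto
  then have "computes_last n y a v (snd (foldl power_step (Suc i, (mul_step i ^^ e) s) es))
      (w * y i ^ e * (\<Prod>j<length es. y (Suc i + j) ^ (es ! j)))"
    using Cons.prems by (intro Cons.IH) auto
  moreover have "power_step (i, s) e = (Suc i, (mul_step i ^^ e) s)" by (simp add: power_step_def)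
  ultimately show ?case by (simp add: prod.lessThan_Suc_shift mult.assoc del: prod.lessThan_Suc)
qed simp

lemma term_step_value:
  assumes "computes_at_index n y s v" "length (snd t) = n"
  shows "computes_at_index n y (term_step s t) (v + fst t * (\<Prod>j<n. y j ^ (snd t ! j)))"
proof -
  obtain a m Es where s: "s = (a, m, Es)" by (cases s)
  let ?c = "fst t"
  obtain g where g: "determines n y (m, Es) g" "g a = v" and am: "a < m"
    using assms(1) by (auto simp: computes_at_index_def s)
  have nm: "n < m" using g(1) by (auto simp: determines_def)
  have "determines n y (Suc m, [(1, 0, base_index m), (- ?c, 0, 0)] # Es) (g(m := ?c))"
    by (intro determines_extend[OF g(1)]) (auto simp: bounded_def base_index_def)
  then have "computes_last n y a v (start_term (m, Es) ?c) ?c"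
    using am g by (auto simp: computes_last_def start_term_def intro!: exI[of _ "g(m := ?c)"])
  from power_steps_last[OF this, of 0 "snd t"] assms(2)
  have last: "computes_last n y a v (snd (foldl power_step (0, start_term (m, Es) ?c) (snd t))) (?c * (\<Prod>j<n. y j ^ (snd t ! j)))"
    by simp
  obtain m' Es' where s': "snd (foldl power_step (0, start_term (m, Es) ?c) (snd t)) = (m', Es')" by fastforce
  let ?w = "?c * (\<Prod>j<n. y j ^ (snd t ! j))"
  obtain g' where g': "determines n y (m', Es') g'" "g' a = v" "g' (m' - 1) = ?w" and am': "a < m'"
    using last unfolding s' by (auto simp: computes_last_def)
  have "n < m'" using g'(1) by (auto simp: determines_def)
  then have "determines n y (Suc m', [(1, 0, base_index m'), (-1, 0, base_index a), (-1, 0, base_index (m' - 1))] # Es') (g'(m' := v + ?w))"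
    using g' am' by (intro determines_extend[OF g'(1)]) (auto simp: bounded_def base_index_def)
  then show ?thesis
    unfolding term_step_def s fst_conv snd_conv s'
    by (auto simp: computes_at_index_def add_step_def intro!: exI[of _ "g'(m' := v + ?w)"])
qed

definition terms_value :: "nat \<Rightarrow> (int \<times> nat list) list \<Rightarrow> (nat \<Rightarrow> int) \<Rightarrow> int" where
  "terms_value n ts y = (\<Sum>t \<leftarrow> ts. fst t * (\<Prod>j<n. y j ^ (snd t ! j)))"

lemma term_steps_value:
  assumes "computes_at_index n y s v" "\<forall>t \<in> set ts. length (snd t) = n"
  shows "computes_at_index n y (foldl term_step s ts) (v + terms_value n ts y)"
  using assms
proof (induction ts arbitrary: s v)
  case (Cons t ts)
  have "computes_at_index n y (foldl term_step (term_step s t) ts)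
     (v + fst t * (\<Prod>j<n. y j ^ (snd t ! j)) + terms_value n ts y)"
    using Cons.prems by (intro Cons.IH term_step_value) auto
  then show ?case by (simp add: terms_value_def add.assoc)
qed (simp add: terms_value_def)

lemma program_value:
  assumes "\<forall>t \<in> set ts. length (snd t) = n"
  shows "computes_at_index n y (program n ts) (terms_value n ts y)"
proof -
  have "determines n y (Suc n, [[(1, 0, base_index n)]]) (y(n := 0))"
    by (auto simp: determines_def bounded_def satisfies_def base_index_def less_Suc_eq)
  then have "computes_at_index n y (n, Suc n, [[(1, 0, base_index n)]]) 0"
    by (auto simp: computes_at_index_def intro!: exI[of _ "y(n := 0)"])
  from term_steps_value[OF this assms] show ?thesis unfolding program_def by simp
qed

section \<open>Anisotropy and solvability of the complete system\<close>

lemma eq_value_shift: "eq_value z (shift_eq i E) = eq_value (\<lambda>j. z (shift_index i j)) E"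
  by (induction E) (auto simp: shift_eq_def)

lemma eq_value_control:
  "eq_value z control_eq1 = control1 (\<lambda>t. z (2 * t + 1)) (\<lambda>t. z (2 * t + 2)) - 3 * z 0 * z 0"
  "eq_value z control_eq2 = control2 (\<lambda>t. z (2 * t + 1)) (\<lambda>t. z (2 * t + 2))"
proof -
  have 9: "{..<9::nat} = {0, 1, 2, 3, 4, 5, 6, 7, 8}" by auto
  show "eq_value z control_eq1 = control1 (\<lambda>t. z (2 * t + 1)) (\<lambda>t. z (2 * t + 2)) - 3 * z 0 * z 0"
    unfolding control_eq1_def control1_def 9 by (simp add: upt_rec power2_eq_square)
  show "eq_value z control_eq2 = control2 (\<lambda>t. z (2 * t + 1)) (\<lambda>t. z (2 * t + 2))"
    unfolding control_eq2_def control2_def 9 by (simp add: upt_rec power2_eq_square)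
qed

lemma control_eqs_mem: "E \<in> set (control_eqs m) \<longleftrightarrow> (\<exists>i<m. E = shift_eq i control_eq1 \<or> E = shift_eq i control_eq2)"
  by (auto simp: control_eqs_def)

lemma bounded_control:
  assumes "E \<in> set (control_eqs m)" shows "bounded m E"
proof -
  obtain i where i: "i < m" "E = shift_eq i control_eq1 \<or> E = shift_eq i control_eq2"
    using assms by (auto simp: control_eqs_mem)
  have "fst (snd t) \<le> 20 \<and> snd (snd t) \<le> 20" if "t \<in> set control_eq1 \<union> set control_eq2" for t
    using that by (auto simp: control_eq1_def control_eq2_def)
  moreover have "shift_index i j \<le> 20 * m" if "j \<le> 20" for j
    using that i(1) by (simp add: shift_index_def)
  ultimately have "\<forall>t \<in> set F. shift_index i (fst (snd t)) \<le> 20 * m \<and> shift_index i (snd (snd t)) \<le> 20 * m"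
    if "F = control_eq1 \<or> F = control_eq2" for F
    using that by blast
  then show ?thesis using i(2) unfolding bounded_def shift_eq_def by fastforce
qed

text \<open>The equations of the program may well be isotropic; but every variable lies in a block,
  and the control equations of that block alone force it to zero.\<close>

lemma poly_eqs_anisotropic:
  assumes "\<forall>t \<in> set ts. length (snd t) = n"
  shows "anisotropic_system (20 * num_base n ts) (poly_eqs n ts)"
proof
  fix E c i j assume E: "E \<in> set (poly_eqs n ts)" "(c, i, j) \<in> set E"
  obtain a m Es where s: "program n ts = (a, m, Es)" by (cases "program n ts")
  obtain g where "a < m" "determines n (\<lambda>i. 0) (m, Es) g"
    using program_value[OF assms, of "\<lambda>i. 0"] by (auto simp: computes_at_index_def s)
  then have "bounded m E"
    using E(1) bounded_control[of E m]
    by (auto simp: poly_eqs_def base_eqs_def num_base_def s determines_def) (simp add: bounded_def base_index_def)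
  then show "i \<le> 20 * num_base n ts \<and> j \<le> 20 * num_base n ts"
    using E(2) by (force simp: bounded_def num_base_def s)
next
  fix e :: "nat \<Rightarrow> int" and i
  assume e: "\<And>E. E \<in> set (poly_eqs n ts) \<Longrightarrow> eq_value (case_nat 0 e) E = 0" and i: "i < 20 * num_base n ts"
  let ?m = "num_base n ts" and ?z = "case_nat 0 e"
  define k where "k = i div 20"
  define l where "l = i mod 20"
  have kl: "i = 20 * k + l" "l < 20" "k < ?m" using i by (auto simp: k_def l_def)
  let ?a = "\<lambda>t. e (20 * k + 2 * t)" and ?b = "\<lambda>t. e (20 * k + 2 * t + 1)"
  have mem: "shift_eq k control_eq1 \<in> set (poly_eqs n ts)" "shift_eq k control_eq2 \<in> set (poly_eqs n ts)"
    using kl(3) by (auto simp: poly_eqs_def control_eqs_mem)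
  have "control1 ?a ?b = 0" "control2 ?a ?b = 0"
    using e[OF mem(1)] e[OF mem(2)] unfolding eq_value_shift eq_value_control by (simp_all add: shift_index_def)
  then have "?a (l div 2) = 0 \<and> ?b (l div 2) = 0" using kl(2) by (intro control_anisotropic) auto
  moreover have "i = 20 * k + 2 * (l div 2) \<or> i = 20 * k + 2 * (l div 2) + 1" using kl(1) by presburger
  ultimately show "e i = 0" by auto
qed

text \<open>The blocks are disjoint and meet the program only in their base variables, so any values
  forced by the program can be completed block by block.\<close>

lemma poly_eqs_solvable:
  assumes "\<forall>t \<in> set ts. length (snd t) = n"
  shows "(\<exists>y. \<forall>E \<in> set (poly_eqs n ts). eq_value (case_nat 1 y) E = 0) \<longleftrightarrow> (\<exists>y. terms_value n ts y = 0)"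
proof -
  obtain a m Es where s: "program n ts = (a, m, Es)" by (cases "program n ts")
  have det: "\<exists>g. a < m \<and> determines n y (m, Es) g \<and> g a = terms_value n ts y" for y
    using program_value[OF assms, of y] by (auto simp: computes_at_index_def s)
  have m: "num_base n ts = m" and base: "base_eqs n ts = [(1, 0, base_index a)] # Es"
    by (simp_all add: num_base_def base_eqs_def s)
  show ?thesis
  proof
    assume "\<exists>y. \<forall>E \<in> set (poly_eqs n ts). eq_value (case_nat 1 y) E = 0"
    then obtain y where y: "\<forall>E \<in> set (poly_eqs n ts). eq_value (case_nat 1 y) E = 0" by blast
    let ?z = "case_nat 1 y"
    let ?x = "\<lambda>i. ?z (base_index i)"
    obtain g where g: "a < m" "determines n ?x (m, Es) g" "g a = terms_value n ts ?x" using det by blast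
    have "satisfies ?z Es" "?z (base_index a) = 0" using y by (auto simp: poly_eqs_def base satisfies_def)
    then have "g a = 0" using g(1,2) by (auto simp: determines_def)
    then show "\<exists>y. terms_value n ts y = 0" using g(3) by metis
  next
    assume "\<exists>y. terms_value n ts y = 0"
    then obtain x where x: "terms_value n ts x = 0" by blast
    obtain g where g: "a < m" "determines n x (m, Es) g" "g a = 0" using det[of x] x by auto
    have "\<forall>i. \<exists>a b. b 0 = g i \<and> control1 a b = 3 \<and> control2 a b = 0"
      using control_solvable by blast
    then obtain A B where AB: "\<And>i. B i 0 = g i \<and> control1 (A i) (B i) = 3 \<and> control2 (A i) (B i) = 0"
      unfolding choice_iff by blast
    \<comment> \<open>Without the constant, positions are shifted by one: even ones hold
      \<open>a t\<close>, odd ones \<open>b t\<close>.\<close>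
    define y where "y j = (if even (j mod 20) then A (j div 20) (j mod 20 div 2) else B (j div 20) (j mod 20 div 2))" for j
    let ?z = "case_nat 1 y"
    have zA: "?z (20 * i + (2 * t + 1)) = A i t" and zB: "?z (20 * i + (2 * t + 2)) = B i t" if "t < 10" for i t
    proof -
      have "(20 * i + 2 * t) mod 20 = 2 * t" "(20 * i + 2 * t) div 20 = i"
        "Suc (20 * i + 2 * t) mod 20 = Suc (2 * t)" "Suc (20 * i + 2 * t) div 20 = i"
        using that by (auto simp: mod_Suc div_Suc)
      then show "?z (20 * i + (2 * t + 1)) = A i t" "?z (20 * i + (2 * t + 2)) = B i t"
        by (simp_all add: y_def)
    qed
    have zb: "?z (base_index i) = g i" for i
      using zB[of 0 i] AB[of i] by (simp add: base_index_def)
    have "eq_value ?z E = 0" if E: "E \<in> set (control_eqs m)" for E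
    proof -
      obtain i where i: "i < m" "E = shift_eq i control_eq1 \<or> E = shift_eq i control_eq2"
        using E unfolding control_eqs_mem by blast
      let ?w = "\<lambda>j. ?z (shift_index i j)"
      have w: "?w (2 * t + 1) = A i t" "?w (2 * t + 2) = B i t" if "t < 10" for t
        using zA[OF that, of i] zB[OF that, of i] by (simp_all add: shift_index_def)
      have "control1 (\<lambda>t. ?w (2 * t + 1)) (\<lambda>t. ?w (2 * t + 2)) = control1 (A i) (B i)"
        "control2 (\<lambda>t. ?w (2 * t + 1)) (\<lambda>t. ?w (2 * t + 2)) = control2 (A i) (B i)"
        unfolding control1_def control2_def using w[of 9] by (auto simp: w simp del: add_2_eq_Suc' Nat.add_0_right One_nat_def intro!: arg_cong2[of _ _ _ _ minus] sum.cong)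
      then have "eq_value ?w control_eq1 = 0" "eq_value ?w control_eq2 = 0"
        using AB[of i] unfolding eq_value_control by (simp_all add: shift_index_def)
      then show ?thesis using i(2) unfolding eq_value_shift[symmetric] by auto
    qed
    moreover have "satisfies ?z Es"
      using g(2) zb by (auto simp: determines_def)
    ultimately have "\<forall>E \<in> set (poly_eqs n ts). eq_value ?z E = 0"
      using zb[of a] g(3) by (auto simp: poly_eqs_def base m satisfies_def)
    then show "\<exists>y. \<forall>E \<in> set (poly_eqs n ts). eq_value (case_nat 1 y) E = 0" by blast
  qed
qed

section \<open>Polynomials as lists\<close>

text \<open>A term is a coefficient and the list of its variables with repetitions.\<close>

type_synonym lpoly = "(int \<times> nat list) list"

definition monom_of :: "nat list \<Rightarrow> nat \<Rightarrow>\<^sub>0 nat" where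
  "monom_of vs = (\<Sum>v \<leftarrow> vs. Poly_Mapping.single v 1)"

definition lpoly_val :: "lpoly \<Rightarrow> rat mpoly" where
  "lpoly_val L = (\<Sum>t \<leftarrow> L. Poly_Mapping.single (monom_of (snd t)) (of_int (fst t)))"

lemma monom_of_simps [simp]: "monom_of [] = 0" "monom_of (v # vs) = Poly_Mapping.single v 1 + monom_of vs" "monom_of (us @ vs) = monom_of us + monom_of vs"
  by (simp_all add: monom_of_def)

lemma lookup_monom_of: "Poly_Mapping.lookup (monom_of vs) i = count_list vs i"
  by (induction vs) (auto simp: lookup_add lookup_single when_def)

lemma keys_monom_of: "Poly_Mapping.keys (monom_of vs) = set vs"
  by (auto simp: in_keys_iff lookup_monom_of count_list_0_iff)

lemma lpoly_val_simps [simp]: "lpoly_val [] = 0"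
  "lpoly_val (t # L) = Poly_Mapping.single (monom_of (snd t)) (of_int (fst t)) + lpoly_val L"
  "lpoly_val (L @ L') = lpoly_val L + lpoly_val L'"
  by (simp_all add: lpoly_val_def)

lemma lpoly_val_concat: "lpoly_val (concat Ls) = (\<Sum>L \<leftarrow> Ls. lpoly_val L)"
  by (induction Ls) simp_all

definition lscale :: "int \<Rightarrow> lpoly \<Rightarrow> lpoly" where
  "lscale c L = map (\<lambda>t. (c * fst t, snd t)) L"

definition lmul :: "lpoly \<Rightarrow> lpoly \<Rightarrow> lpoly" where
  "lmul L L' = concat (map (\<lambda>s. map (\<lambda>t. (fst s * fst t, snd s @ snd t)) L') L)"

lemma lpoly_val_scale: "lpoly_val (lscale c L) = poly_const (of_int c) * lpoly_val L"
proof -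
  have "poly_const a * Poly_Mapping.single m b = Poly_Mapping.single m (a * b)" for a b m
    by (simp add: poly_const_def mult_single)
  then show ?thesis by (induction L) (auto simp: lscale_def distrib_left)
qed

lemma lpoly_val_mul: "lpoly_val (lmul L L') = lpoly_val L * lpoly_val L'"
proof -
  have *: "lpoly_val (map (\<lambda>t. (fst s * fst t, snd s @ snd t)) M) =
      Poly_Mapping.single (monom_of (snd s)) (of_int (fst s)) * lpoly_val M" for s M
    by (induction M) (auto simp: distrib_left mult_single)
  show ?thesis
    by (induction L) (auto simp: lmul_def * distrib_right)
qed

definition lpoly_bound :: "nat \<Rightarrow> nat \<Rightarrow> lpoly \<Rightarrow> bool" where
  "lpoly_bound d k L \<longleftrightarrow> (\<forall>t \<in> set L. length (snd t) \<le> d \<and> set (snd t) \<subseteq> {..<k})"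

lemma lpoly_bound_append: "lpoly_bound d k (L @ L') \<longleftrightarrow> lpoly_bound d k L \<and> lpoly_bound d k L'"
  by (auto simp: lpoly_bound_def)

lemma lpoly_bound_concat: "lpoly_bound d k (concat Ls) \<longleftrightarrow> (\<forall>L \<in> set Ls. lpoly_bound d k L)"
  by (auto simp: lpoly_bound_def)

lemma lpoly_bound_scale: "lpoly_bound d k (lscale c L) \<longleftrightarrow> lpoly_bound d k L"
  by (auto simp: lpoly_bound_def lscale_def)

lemma lpoly_bound_mono: "lpoly_bound d k L \<Longrightarrow> d \<le> d' \<Longrightarrow> lpoly_bound d' k L"
  by (force simp: lpoly_bound_def)

lemma lpoly_bound_mul: "lpoly_bound d k L \<Longrightarrow> lpoly_bound d' k L' \<Longrightarrow> lpoly_bound (d + d') k (lmul L L')"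
  by (auto simp: lpoly_bound_def lmul_def intro!: add_mono)

lemma keys_lpoly_val: "Poly_Mapping.keys (lpoly_val L) \<subseteq> monom_of ` snd ` set L"
proof (induction L)
  case (Cons t L)
  have "Poly_Mapping.keys (Poly_Mapping.single (monom_of (snd t)) (of_int (fst t) :: rat)) \<subseteq> {monom_of (snd t)}" by simp
  then show ?case
    using Cons Poly_Mapping.keys_add[of "Poly_Mapping.single (monom_of (snd t)) (of_int (fst t) :: rat)" "lpoly_val L"]
    unfolding lpoly_val_simps list.set image_insert by blast
qed simp

lemma lpoly_val_carrier: assumes "lpoly_bound d k L" shows "lpoly_val L \<in> carrier (mpoly_ring k)"
proof -
  have "Poly_Mapping.keys m \<subseteq> {..<k}" if "m \<in> Poly_Mapping.keys (lpoly_val L)" for m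
    using that keys_lpoly_val assms by (fastforce simp: lpoly_bound_def keys_monom_of)
  then show ?thesis by (auto simp: carrier_mpoly mvars_def)
qed

lemma total_degree_lpoly_val: assumes "lpoly_bound d k L" shows "total_degree (lpoly_val L) \<le> d"
proof -
  have "(\<Sum>i \<in> Poly_Mapping.keys m. Poly_Mapping.lookup m i) \<le> d" if m: "m \<in> Poly_Mapping.keys (lpoly_val L)" for m
  proof -
    obtain t where t: "t \<in> set L" "m = monom_of (snd t)" using m keys_lpoly_val by blast
    have "(\<Sum>i \<in> Poly_Mapping.keys m. Poly_Mapping.lookup m i) = length (snd t)"
      by (simp add: t(2) keys_monom_of lookup_monom_of sum_count_set)
    then show ?thesis using assms t(1) by (simp add: lpoly_bound_def)
  qed
  then show ?thesis by (auto simp: total_degree_def)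
qed

subsection \<open>Printing\<close>

definition exps :: "nat \<Rightarrow> nat list \<Rightarrow> nat list" where
  "exps k vs = map (\<lambda>i. length (filter (\<lambda>v. v = i) vs)) [0..<k]"

definition lcoeff :: "nat \<Rightarrow> lpoly \<Rightarrow> nat list \<Rightarrow> int" where
  "lcoeff k L m = sum_list (map fst (filter (\<lambda>t. exps k (snd t) = m) L))"

text \<open>The exponents that occur in the generators are at most \<open>5\<close>, so sorting the terms is done by running through all
  candidates in increasing order.\<close>

definition exp_step :: "nat list list \<Rightarrow> nat list list" where
  "exp_step ms = concat (map (\<lambda>e. map (\<lambda>m. e # m) ms) [0..<6])"

definition all_exps :: "nat \<Rightarrow> nat list list" where
  "all_exps k = (exp_step ^^ k) [[]]"

definition lpoly_exps :: "nat \<Rightarrow> lpoly \<Rightarrow> nat list list" where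
  "lpoly_exps k L = filter (\<lambda>m. lcoeff k L m \<noteq> 0) (all_exps k)"

definition lpoly_code :: "nat \<Rightarrow> lpoly \<Rightarrow> bool list" where
  "lpoly_code k L = code_nat (length (lpoly_exps k L)) @
     concat (map (\<lambda>m. (code_int (lcoeff k L m) @ code_int 1) @ concat (map code_nat m)) (lpoly_exps k L))"

lemma set_all_exps: "set (all_exps k) = {m. length m = k \<and> set m \<subseteq> {..<6}}"
proof (induction k)
  case (Suc k)
  have "set (all_exps (Suc k)) = (\<Union>e<6. (#) e ` set (all_exps k))"
    by (auto simp: all_exps_def exp_step_def)
  then show ?case unfolding Suc by (auto simp: length_Suc_conv)
qed (auto simp: all_exps_def)

lemma sorted_wrt_concat:
  "sorted_wrt R (concat xss) \<longleftrightarrow> (\<forall>xs \<in> set xss. sorted_wrt R xs) \<and>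
    sorted_wrt (\<lambda>xs ys. \<forall>x \<in> set xs. \<forall>y \<in> set ys. R x y) xss"
  by (induction xss) (auto simp: sorted_wrt_append)

text \<open>The order of exponents is decided at the least index where they differ, which is the
  head of the list.\<close>

lemma nth_Cons_less:
  "Poly_Mapping.nth (d # xs) < Poly_Mapping.nth (e # ys) \<longleftrightarrow> d < e \<or> d = e \<and> Poly_Mapping.nth xs < Poly_Mapping.nth ys"
  for d e :: nat
proof -
  have nth: "Poly_Mapping.lookup (Poly_Mapping.nth (a # zs)) i = (case i of 0 \<Rightarrow> a | Suc j \<Rightarrow> Poly_Mapping.lookup (Poly_Mapping.nth zs) j)"
    for a :: nat and zs i
    by (cases i) (simp_all add: nth.rep_eq)
  have ex: "(\<exists>k. F k) \<longleftrightarrow> F 0 \<or> (\<exists>k. F (Suc k))" for F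
    by (metis not0_implies_Suc)
  show ?thesis
    unfolding less_poly_mapping.rep_eq less_fun_def by (subst ex) (auto simp: nth All_less_Suc2)
qed

lemma sorted_all_exps: "sorted_wrt (\<lambda>m m'. Poly_Mapping.nth m < Poly_Mapping.nth m') (all_exps k)"
proof (induction k)
  case (Suc k)
  have "all_exps (Suc k) = concat (map (\<lambda>e. map (\<lambda>m. e # m) (all_exps k)) [0..<6])"
    by (simp add: all_exps_def exp_step_def)
  then show ?case
    using Suc by (simp add: sorted_wrt_concat sorted_wrt_map nth_Cons_less) (rule sorted_wrt_mono_rel[of _ "(<)"], auto)
qed (simp add: all_exps_def)

lemma length_exps [simp]: "length (exps k vs) = k"
  by (simp add: exps_def)

lemma nth_exps: assumes "set vs \<subseteq> {..<k}" shows "Poly_Mapping.nth (exps k vs) = monom_of vs"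
proof (rule poly_mapping_eqI)
  fix i
  have *: "length (filter (\<lambda>v. v = i) vs) = count_list vs i" for i
    by (induction vs) auto
  show "Poly_Mapping.lookup (Poly_Mapping.nth (exps k vs)) i = Poly_Mapping.lookup (monom_of vs) i"
    using assms by (auto simp: nth.rep_eq nth_default_def exps_def lookup_monom_of * count_list_0_iff)
qed

lemma nth_inject: "length m = length m' \<Longrightarrow> Poly_Mapping.nth m = Poly_Mapping.nth m' \<longleftrightarrow> m = m'"
  for m m' :: "nat list"
proof
  assume l: "length m = length m'" and eq: "Poly_Mapping.nth m = Poly_Mapping.nth m'"
  show "m = m'"
  proof (rule nth_equalityI[OF l])
    fix i assume "i < length m"
    then show "m ! i = m' ! i"
      using arg_cong[OF eq, of "\<lambda>p. Poly_Mapping.lookup p i"] l unfolding nth.rep_eq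
      by (simp only: nth_default_nth)
  qed
qed simp

lemma lookup_lpoly_val:
  assumes "lpoly_bound d k L" "length m = k"
  shows "Poly_Mapping.lookup (lpoly_val L) (Poly_Mapping.nth m) = of_int (lcoeff k L m)"
  using assms(1)
proof (induction L)
  case (Cons t L)
  have "monom_of (snd t) = Poly_Mapping.nth m \<longleftrightarrow> exps k (snd t) = m"
    using Cons.prems assms(2) nth_exps[of "snd t" k] nth_inject[of "exps k (snd t)" m] by (auto simp: lpoly_bound_def)
  then show ?case using Cons by (auto simp: lpoly_bound_def lcoeff_def lookup_add lookup_single when_def)
qed (simp add: lcoeff_def)

text \<open>Strictly increasing lists with the same elements are equal. Degree at most five puts
  every monomial among the candidates; terms that cancel are removed by the test for a zero
  coefficient.\<close>

lemma sorted_keys_lpoly_val: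
  assumes "lpoly_bound 5 k L"
  shows "sorted_list_of_set (Poly_Mapping.keys (lpoly_val L)) = map Poly_Mapping.nth (lpoly_exps k L)"
proof (rule strict_sorted_equal)
  have "sorted_wrt (\<lambda>m m'. Poly_Mapping.nth m < Poly_Mapping.nth m') (lpoly_exps k L)"
    unfolding lpoly_exps_def by (intro sorted_wrt_filter sorted_all_exps)
  then show "sorted_wrt (<) (map Poly_Mapping.nth (lpoly_exps k L))" by (simp add: sorted_wrt_map)
  have "m \<in> Poly_Mapping.nth ` {m. length m = k \<and> set m \<subseteq> {..<6}}" if m: "m \<in> Poly_Mapping.keys (lpoly_val L)" for m
  proof -
    obtain t where t: "t \<in> set L" "m = monom_of (snd t)" using m keys_lpoly_val by blast
    have "length (snd t) \<le> 5" using assms t(1) by (auto simp: lpoly_bound_def)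
    then have "length (filter (\<lambda>v. v = i) (snd t)) \<le> 5" for i
      by (rule le_trans[OF length_filter_le])
    then have "set (exps k (snd t)) \<subseteq> {..<6}" by (auto simp: exps_def less_Suc_eq_le eval_nat_numeral)
    moreover have "m = Poly_Mapping.nth (exps k (snd t))"
      using assms t nth_exps[of "snd t" k] by (auto simp: lpoly_bound_def)
    ultimately show ?thesis by auto
  qed
  then have "Poly_Mapping.keys (lpoly_val L) =
      {m \<in> Poly_Mapping.nth ` {m. length m = k \<and> set m \<subseteq> {..<6}}. Poly_Mapping.lookup (lpoly_val L) m \<noteq> 0}"
    by (auto simp: in_keys_iff)
  also have "\<dots> = Poly_Mapping.nth ` {m. length m = k \<and> set m \<subseteq> {..<6} \<and> lcoeff k L m \<noteq> 0}"
    using lookup_lpoly_val[OF assms] by auto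
  finally have keys: "Poly_Mapping.keys (lpoly_val L) =
      Poly_Mapping.nth ` {m. length m = k \<and> set m \<subseteq> {..<6} \<and> lcoeff k L m \<noteq> 0}" .
  show "set (sorted_list_of_set (Poly_Mapping.keys (lpoly_val L))) = set (map Poly_Mapping.nth (lpoly_exps k L))"
    unfolding set_sorted_list_of_set[OF finite_keys] unfolding keys by (auto simp: lpoly_exps_def set_all_exps)
qed simp

text \<open>All coefficients are integers, whence the constant denominator \<open>1\<close>.\<close>

lemma lpoly_code: assumes "lpoly_bound 5 k L" shows "lpoly_code k L = code_mpoly code_rat k (lpoly_val L)"
proof -
  have "code_rat (Poly_Mapping.lookup (lpoly_val L) (Poly_Mapping.nth m)) @
      concat (map (\<lambda>i. code_nat (Poly_Mapping.lookup (Poly_Mapping.nth m) i)) [0..<k]) =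
      (code_int (lcoeff k L m) @ code_int 1) @ concat (map code_nat m)" if "m \<in> set (lpoly_exps k L)" for m
  proof -
    have m: "length m = k" using that by (simp add: lpoly_exps_def set_all_exps)
    have "map (\<lambda>i. code_nat (Poly_Mapping.lookup (Poly_Mapping.nth m) i)) [0..<k] = map code_nat m"
      using m by (intro nth_equalityI) (auto simp: nth.rep_eq nth_default_nth)
    then show ?thesis using lookup_lpoly_val[OF assms m] by (simp add: code_rat_def quotient_of_int)
  qed
  then show ?thesis
    unfolding lpoly_code_def code_mpoly_def code_list_def sorted_keys_lpoly_val[OF assms]
    by (simp add: comp_def cong: map_cong)
qed

subsection \<open>The list of generators\<close>

definition lV :: lpoly where "lV = [(1, [0]), (-1, [1])]"
definition lX :: "nat \<Rightarrow> lpoly" where "lX i = [(1, [i + 2]), (-1, [])]"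

definition lhvar :: "nat \<Rightarrow> lpoly" where
  "lhvar i = (if i = 0 then lV else lX (i - 1))"

definition lpair :: "nat \<Rightarrow> nat \<Rightarrow> lpoly" where
  "lpair i j = (if i = 0 \<and> j = 0 then [(2, [0]), (2, [1]), (-2, [])] else lmul (lhvar i) (lhvar j))"

definition lpivot :: "nat \<Rightarrow> nat \<Rightarrow> nat \<Rightarrow> nat \<times> equation \<Rightarrow> lpoly" where
  "lpivot n i j E = lscale (- pair_coeff ((1, 0, Suc (n + fst E)) # snd E) i j) (lmul lV (lX (n + fst E)))"

definition lrel :: "nat \<Rightarrow> equation list \<Rightarrow> nat \<Rightarrow> nat \<Rightarrow> lpoly" where
  "lrel n eqs i j = lpair i j @ concat (map (lpivot n i j) (enumerate 0 eqs))"

definition lrels :: "nat \<Rightarrow> equation list \<Rightarrow> lpoly list" where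
  "lrels n eqs = concat (map (\<lambda>i. concat (map (\<lambda>j. if i = j \<and> n < i then [] else [lrel n eqs i j])
     [0..<Suc (n + length eqs)])) [0..<Suc (n + length eqs)])"

definition lcubics :: "nat \<Rightarrow> lpoly list" where
  "lcubics i = [lmul (lmul lV lV) (lX i), lmul lV (lmul (lX i) (lX i)), lmul (lX i) (lmul (lX i) (lX i))]"

definition lgens :: "nat \<Rightarrow> equation list \<Rightarrow> lpoly list" where
  "lgens n eqs = lrels n eqs @ concat (map (\<lambda>k. lcubics (n + k)) [0..<length eqs]) @
     [lmul (lmul (lmul lV lV) (lmul lV lV)) lV]"

lemma lpoly_val_V: "lpoly_val lV = polyV"
  by (simp add: lV_def polyV_def varS_def varT_def mvar_def single_uminus)

lemma single_0_neg1: "Poly_Mapping.single 0 (- 1) = - (1 :: rat mpoly)"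
  by (simp add: single_uminus)

lemma lpoly_val_X: "lpoly_val (lX i) = polyX i"
  by (simp add: lX_def polyX_def varD_def mvar_def single_0_neg1)

lemma lpoly_val_hvar: "lpoly_val (lhvar i) = hvar i"
  by (cases i) (simp_all add: lhvar_def hvar_def lpoly_val_V lpoly_val_X)

lemma lpoly_val_pair: "lpoly_val (lpair i j) = pair_poly i j"
proof -
  have "lpoly_val (lscale 2 [(1, [0]), (1, [1]), (-1, [])]) = 2 * polyU"
    unfolding lpoly_val_scale by (simp add: poly_const_numeral polyU_def varS_def varT_def mvar_def single_0_neg1)
  moreover have "lscale 2 [(1, [0]), (1, [1]), (-1, [])] = [(2, [0]), (2, [1]), (-2, [])]"
    by (simp add: lscale_def)
  ultimately show ?thesis by (simp add: lpair_def pair_poly_def lpoly_val_mul lpoly_val_hvar)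
qed

context quadratic_system
begin

lemma lpoly_val_rel: "lpoly_val (lrel n eqs i j) = rel_poly i j"
proof -
  have "(\<Sum>E \<leftarrow> enumerate 0 eqs. lpoly_val (lpivot n i j E)) = (\<Sum>k<r. lpoly_val (lpivot n i j (k, eqs ! k)))"
    by (simp add: enumerate_eq_zip sum_list_sum_nth atLeast0LessThan)
  also have "\<dots> = (\<Sum>k<r. - (poly_const (of_int (pair_coeff (extended n eqs k) i j)) * (polyV * polyX (n + k))))"
  proof (intro sum.cong refl)
    fix k
    have "poly_const (- c) = - poly_const c" for c by (simp add: poly_const_def single_uminus)
    then show "lpoly_val (lpivot n i j (k, eqs ! k)) =
        - (poly_const (of_int (pair_coeff (extended n eqs k) i j)) * (polyV * polyX (n + k)))"
      by (simp add: lpivot_def extended_def lpoly_val_scale lpoly_val_mul lpoly_val_V lpoly_val_X del: pair_coeff_simps)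
  qed
  finally show ?thesis
    by (simp add: lrel_def lpoly_val_pair lpoly_val_concat comp_def rel_poly_def sum_negf)
qed

lemma set_lgens: "lpoly_val ` set (lgens n eqs) = gens"
proof -
  have "set (lrels n eqs) = (\<Union>i\<in>{..N}. \<Union>j\<in>{..N}. if i = j \<and> n < i then {} else {lrel n eqs i j})"
    unfolding lrels_def set_concat set_map set_upt atLeast0LessThan lessThan_Suc_atMost image_image
    by (intro SUP_cong refl) simp
  then have "lpoly_val ` set (lrels n eqs) = (\<Union>i\<in>{..N}. \<Union>j\<in>{..N}. if i = j \<and> n < i then {} else {rel_poly i j})"
    by (simp only: image_UN if_distrib[of "image lpoly_val"] image_empty image_insert lpoly_val_rel)
  also have "\<dots> = {rel_poly i j | i j. i \<le> N \<and> j \<le> N \<and> \<not> (i = j \<and> n < i)}"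
    by (auto split: if_splits)
  finally have "lpoly_val ` set (lrels n eqs) = {rel_poly i j | i j. i \<le> N \<and> j \<le> N \<and> \<not> (i = j \<and> n < i)}" .
  moreover have "lpoly_val ` set (lcubics (n + k)) = {polyV ^ 2 * polyX (n + k), polyV * polyX (n + k) ^ 2, polyX (n + k) ^ 3}" for k
    by (simp add: lcubics_def lpoly_val_mul lpoly_val_V lpoly_val_X power2_eq_square power3_eq_cube mult.assoc)
  moreover have "lpoly_val (lmul (lmul (lmul lV lV) (lmul lV lV)) lV) = polyV ^ 5"
    by (simp add: lpoly_val_mul lpoly_val_V eval_nat_numeral mult.assoc)
  ultimately show ?thesis
    by (simp add: lgens_def gens_def image_Un image_UN atLeast0LessThan Un_assoc)
qed

lemma lgens_bound: assumes "L \<in> set (lgens n eqs)" shows "lpoly_bound 5 (N + 2) L"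
proof -
  let ?b = "\<lambda>d. lpoly_bound d (N + 2)"
  have V: "?b 1 lV" by (auto simp: lpoly_bound_def lV_def)
  have X: "?b 1 (lX i)" if "i < N" for i using that by (auto simp: lpoly_bound_def lX_def)
  have h: "?b 1 (lhvar i)" if "i \<le> N" for i using that V X by (auto simp: lhvar_def)
  have mul: "?b d (lmul L L')" if "?b d1 L" "?b d2 L'" "d1 + d2 \<le> d" for d d1 d2 L L'
    using lpoly_bound_mono[OF lpoly_bound_mul] that by blast
  have "?b 5 (lpair i j)" if "i \<le> N" "j \<le> N" for i j
  proof (cases "i = 0 \<and> j = 0")
    case True
    then show ?thesis by (auto simp: lpair_def lpoly_bound_def)
  next
    case False
    then show ?thesis using mul[OF h h, of i j 5] that by (auto simp: lpair_def)
  qed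
  moreover have "?b 5 (lpivot n i j E)" if "E \<in> set (enumerate 0 eqs)" for i j E
    using mul[OF V X, of "n + fst E" 5] that by (auto simp: lpivot_def lpoly_bound_scale in_set_enumerate_eq)
  ultimately have "?b 5 (lrel n eqs i j)" if "i \<le> N" "j \<le> N" for i j
    using that by (auto simp: lrel_def lpoly_bound_append lpoly_bound_concat)
  then have 1: "?b 5 L" if "L \<in> set (lrels n eqs)" for L
    using that by (auto simp: lrels_def less_Suc_eq_le split: if_splits)
  have 2: "?b 5 L" if "k < r" "L \<in> set (lcubics (n + k))" for k L
  proof -
    have x: "?b 1 (lX (n + k))" using X that(1) by simp
    show ?thesis
      using that(2) mul[OF mul[OF V V, of 2] x, of 5] mul[OF V mul[OF x x, of 2], of 5] mul[OF x mul[OF x x, of 2], of 5]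
      by (auto simp: lcubics_def)
  qed
  have 3: "?b 5 (lmul (lmul (lmul lV lV) (lmul lV lV)) lV)"
    by (rule mul[OF mul[OF mul[OF V V] mul[OF V V]] V, of 2 2 4 5]) auto
  show ?thesis using assms 1 2 3 by (auto simp: lgens_def)
qed

text \<open>A generous count: all ordered pairs of indices, three cubics for each dummy variable,
  and \<open>v^5\<close>.\<close>

lemma length_lgens: "length (lgens n eqs) \<le> (N + 1)\<^sup>2 + 3 * r + 1"
proof -
  have le: "sum_list (map f xs) \<le> length xs * c" if "\<And>x. f x \<le> c" for f :: "nat \<Rightarrow> nat" and xs c
    by (induction xs) (auto intro!: add_mono that)
  have "length (lrels n eqs) \<le> length [0..<Suc N] * (length [0..<Suc N] * 1)"
    unfolding lrels_def length_concat map_map comp_def by (intro le) auto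
  then show ?thesis
    by (simp add: lgens_def lcubics_def length_concat comp_def sum_list_triv power2_eq_square)
qed

end

section \<open>The algorithm\<close>

text \<open>Parsers return a value and the unread rest. They are total, because the machine has to
  halt on words that encode nothing as well.\<close>

definition parse_nat :: "bool list \<Rightarrow> nat \<times> bool list" where
  "parse_nat w = (length (takeWhile id w), drop (Suc (length (takeWhile id w))) w)"

definition parse_sign :: "bool list \<Rightarrow> bool" where
  "parse_sign w = (case w of [] \<Rightarrow> False | b # bs \<Rightarrow> b)"

definition parse_int :: "bool list \<Rightarrow> int \<times> bool list" where
  "parse_int w = (if parse_sign w then - int (fst (parse_nat (tl w))) else int (fst (parse_nat (tl w))), snd (parse_nat (tl w)))"

definition parse_many :: "(bool list \<Rightarrow> 'a \<times> bool list) \<Rightarrow> nat \<Rightarrow> bool list \<Rightarrow> 'a list \<times> bool list" where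
  "parse_many p l w = ((\<lambda>s. (fst s @ [fst (p (snd s))], snd (p (snd s)))) ^^ l) ([], w)"

definition parse_term :: "nat \<Rightarrow> bool list \<Rightarrow> (int \<times> nat list) \<times> bool list" where
  "parse_term n w = ((fst (parse_int w), fst (parse_many parse_nat n (snd (parse_int w)))),
     snd (parse_many parse_nat n (snd (parse_int w))))"

definition parse_terms :: "nat \<Rightarrow> bool list \<Rightarrow> (int \<times> nat list) list" where
  "parse_terms n w = fst (parse_many (parse_term n) (fst (parse_nat w)) (snd (parse_nat w)))"

definition num_vars :: "nat \<Rightarrow> (int \<times> nat list) list \<Rightarrow> nat" where
  "num_vars n ts = 20 * num_base n ts + length (poly_eqs n ts)"

definition poly_gens :: "nat \<Rightarrow> (int \<times> nat list) list \<Rightarrow> lpoly list" where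
  "poly_gens n ts = lgens (20 * num_base n ts) (poly_eqs n ts)"

definition gens_code :: "nat \<Rightarrow> (int \<times> nat list) list \<Rightarrow> bool list" where
  "gens_code n ts = code_nat (num_vars n ts) @ code_nat (length (poly_gens n ts)) @
     concat (map (lpoly_code (num_vars n ts + 2)) (poly_gens n ts))"

definition algorithm :: "bool list \<Rightarrow> bool list" where
  "algorithm w = gens_code (fst (parse_nat w)) (parse_terms (fst (parse_nat w)) (snd (parse_nat w)))"

definition poly_terms :: "nat \<Rightarrow> int mpoly \<Rightarrow> (int \<times> nat list) list" where
  "poly_terms n P = map (\<lambda>m. (Poly_Mapping.lookup P m, map (Poly_Mapping.lookup m) [0..<n]))
     (sorted_list_of_set (Poly_Mapping.keys P))"

lemma parse_nat: "parse_nat (code_nat a @ w) = (a, w)"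
proof -
  have "takeWhile id (code_nat a @ w) = replicate a True"
    by (induction a) (auto simp: code_nat_def)
  then show ?thesis by (simp add: parse_nat_def code_nat_def)
qed

lemma parse_int: "parse_int (code_int z @ w) = (z, w)"
  by (simp add: parse_int_def parse_sign_def code_int_def parse_nat)

lemma parse_many:
  assumes "\<And>x w. x \<in> set xs \<Longrightarrow> p (c x @ w) = (g x, w)"
  shows "parse_many p (length xs) (concat (map c xs) @ w) = (map g xs, w)"
proof -
  have "((\<lambda>s. (fst s @ [fst (p (snd s))], snd (p (snd s)))) ^^ length xs) (ys, concat (map c xs) @ w) = (ys @ map g xs, w)" for ys
    using assms
  proof (induction xs arbitrary: ys)
    case (Cons x xs)
    then show ?case by (simp add: funpow_Suc_right del: funpow.simps)
  qed simp
  then show ?thesis by (simp add: parse_many_def)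
qed

lemma parse_term:
  "parse_term n ((code_int c @ concat (map (\<lambda>i. code_nat (e i)) [0..<n])) @ w) = ((c, map e [0..<n]), w)"
proof -
  have "parse_many parse_nat (length [0..<n]) (concat (map (\<lambda>i. code_nat (e i)) [0..<n]) @ w) = (map e [0..<n], w)"
    by (intro parse_many) (simp add: parse_nat)
  then show ?thesis by (simp add: parse_term_def parse_int)
qed

lemma algorithm_code_input: "algorithm (code_input n P) = gens_code n (poly_terms n P)"
proof -
  let ?ms = "sorted_list_of_set (Poly_Mapping.keys P)"
  let ?c = "\<lambda>m. code_int (Poly_Mapping.lookup P m) @ concat (map (\<lambda>i. code_nat (Poly_Mapping.lookup m i)) [0..<n])"
  have "parse_many (parse_term n) (length ?ms) (concat (map ?c ?ms) @ []) = (poly_terms n P, [])"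
    unfolding poly_terms_def by (rule parse_many, rule parse_term)
  then have "parse_terms n (code_mpoly code_int n P) = poly_terms n P"
    unfolding parse_terms_def code_mpoly_def code_list_def parse_nat by simp
  then show ?thesis by (simp add: algorithm_def code_input_def parse_nat)
qed

lemma terms_value_poly_terms:
  assumes "P \<in> carrier (mpoly_ring n)"
  shows "terms_value n (poly_terms n P) y = meval y P"
proof -
  have "(\<Prod>j<n. y j ^ (map (Poly_Mapping.lookup m) [0..<n] ! j)) = (\<Prod>j \<in> Poly_Mapping.keys m. y j ^ Poly_Mapping.lookup m j)"
    if "m \<in> Poly_Mapping.keys P" for m
  proof -
    have "Poly_Mapping.keys m \<subseteq> {..<n}" using assms that by (auto simp: carrier_mpoly mvars_def)
    then show ?thesis
      by (intro prod.mono_neutral_cong_right) (auto simp: in_keys_iff subset_iff)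
  qed
  then show ?thesis
    by (simp add: terms_value_def poly_terms_def meval_def comp_def sum_list_distinct_conv_sum_set)
qed

lemma terms_value_cong: "(\<And>j. j < n \<Longrightarrow> y j = z j) \<Longrightarrow> terms_value n ts y = terms_value n ts z"
  unfolding terms_value_def by (intro arg_cong[of _ _ sum_list] map_cong refl arg_cong2[of _ _ _ _ times] prod.cong) auto

text \<open>The right hand side counts the monomials of degree at most five in \<open>m + 2\<close>
  variables. By Pascal's rule its increments have lower index, which reduces the quadratic bound to
  a linear and then to a constant one.\<close>

lemma binomial_bound: "(m + 1)\<^sup>2 + 3 * m + 1 \<le> (m + 7) choose 5"
proof -
  have step: "Suc m + 7 choose Suc k = (m + 7 choose k) + (m + 7 choose Suc k)" for m k :: nat
    by (simp only: add_Suc binomial_Suc_Suc)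
  have 3: "2 \<le> m + 7 choose 3" for m
    by (induction m) (use step[of _ 2] in \<open>auto simp: eval_nat_numeral\<close>)
  have 4: "2 * m + 6 \<le> m + 7 choose 4" for m
  proof (induction m)
    case (Suc m)
    then show ?case using 3[of m] step[of m 3] by simp
  qed (simp add: eval_nat_numeral)
  show ?thesis
  proof (induction m)
    case (Suc m)
    then show ?case using 4[of m] step[of m 4] by (simp add: power2_eq_square)
  qed (simp add: eval_nat_numeral)
qed

subsection \<open>Computability\<close>

lemma cmp_code_nat: "cmp f \<Longrightarrow> cmp (\<lambda>x. code_nat (f x))"
  unfolding code_nat_def by (intro cmp_rules)

lemma cmp_code_int: "cmp f \<Longrightarrow> cmp (\<lambda>x. code_int (f x))"
  unfolding code_int_def by (intro cmp_rules cmp_code_nat)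

lemma cmp_parse_nat: "cmp w \<Longrightarrow> cmp (\<lambda>x. parse_nat (w x))"
  unfolding parse_nat_def by (intro cmp_rules)

lemma cmp_parse_int: "cmp w \<Longrightarrow> cmp (\<lambda>x. parse_int (w x))"
  unfolding parse_int_def parse_sign_def by (intro cmp_rules cmp_parse_nat)

lemma cmp_parse_many:
  fixes p :: "'a::enc \<Rightarrow> bool list \<Rightarrow> 'b::enc \<times> bool list"
  assumes p: "cmp (\<lambda>z. p (fst z) (snd z))" and "cmp l" "cmp w"
  shows "cmp (\<lambda>x. parse_many (p x) (l x) (w x))"
  unfolding parse_many_def by (intro cmp_rules assms cmp_comp2[where h=p, OF p])

lemma cmp_parse_term:
  assumes "cmp n" "cmp w" shows "cmp (\<lambda>x. parse_term (n x) (w x))"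
  unfolding parse_term_def
  by (intro cmp_rules cmp_parse_int cmp_parse_nat cmp_parse_many assms)

lemma cmp_parse_terms:
  assumes n: "cmp n" and "cmp w" shows "cmp (\<lambda>x. parse_terms (n x) (w x))"
  unfolding parse_terms_def
  by (intro cmp_rules cmp_parse_nat cmp_parse_many cmp_parse_term cmp_comp[OF n] assms)

lemma cmp_mul_step: assumes "cmp i" "cmp s" shows "cmp (\<lambda>x. mul_step (i x) (s x))"
  unfolding mul_step_def base_index_def by (intro cmp_rules assms)

lemma cmp_power_step: assumes "cmp s" "cmp e" shows "cmp (\<lambda>x. power_step (s x) (e x))"
  unfolding power_step_def by (intro cmp_rules cmp_mul_step cmp_comp[OF assms(1)] assms)

lemma cmp_start_term: assumes "cmp s" "cmp c" shows "cmp (\<lambda>x. start_term (s x) (c x))"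
  unfolding start_term_def base_index_def by (intro cmp_rules assms)

lemma cmp_add_step: assumes "cmp a" "cmp s" shows "cmp (\<lambda>x. add_step (a x) (s x))"
  unfolding add_step_def base_index_def by (intro cmp_rules assms)

lemma cmp_term_step: assumes "cmp s" "cmp t" shows "cmp (\<lambda>x. term_step (s x) (t x))"
  unfolding term_step_def by (intro cmp_rules cmp_add_step cmp_power_step cmp_start_term assms)

lemma cmp_program: assumes "cmp n" "cmp ts" shows "cmp (\<lambda>x. program (n x) (ts x))"
  unfolding program_def base_index_def by (intro cmp_rules cmp_term_step assms)

lemma cmp_num_base: assumes "cmp n" "cmp ts" shows "cmp (\<lambda>x. num_base (n x) (ts x))"
  unfolding num_base_def by (intro cmp_rules cmp_program assms)

lemma cmp_base_eqs: assumes "cmp n" "cmp ts" shows "cmp (\<lambda>x. base_eqs (n x) (ts x))"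
  unfolding base_eqs_def base_index_def by (intro cmp_rules cmp_program assms)

lemma cmp_shift_eq: assumes i: "cmp i" and "cmp E" shows "cmp (\<lambda>x. shift_eq (i x) (E x))"
  unfolding shift_eq_def shift_index_def by (intro cmp_rules cmp_comp[OF i] assms)

lemma cmp_poly_eqs: assumes "cmp n" "cmp ts" shows "cmp (\<lambda>x. poly_eqs (n x) (ts x))"
  unfolding poly_eqs_def control_eqs_def by (intro cmp_rules cmp_base_eqs cmp_num_base cmp_shift_eq assms)

lemma cmp_lscale: assumes c: "cmp c" and "cmp L" shows "cmp (\<lambda>x. lscale (c x) (L x))"
  unfolding lscale_def by (intro cmp_rules cmp_comp[OF c] assms)

lemma cmp_lmul: assumes "cmp L" and L': "cmp L'" shows "cmp (\<lambda>x. lmul (L x) (L' x))"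
  unfolding lmul_def by (intro cmp_rules cmp_comp[OF L'] assms)

lemma cmp_exps: assumes "cmp k" and vs: "cmp vs" shows "cmp (\<lambda>x. exps (k x) (vs x))"
  unfolding exps_def by (intro cmp_rules cmp_comp[OF vs] assms)

lemma cmp_eq_nat_list: fixes f g :: "'a::enc \<Rightarrow> nat list" assumes "cmp f" "cmp g" shows "cmp (\<lambda>x. f x = g x)"
proof -
  have "cmp (\<lambda>x. list_encode (h x))" if "cmp h" for h :: "'a \<Rightarrow> nat list"
    by (rule cmp_via[OF pr_id that]) (simp add: map_idI)
  from cmp_eq_nat[OF this[OF assms(1)] this[OF assms(2)]] show ?thesis by (simp add: list_encode_eq)
qed

lemma cmp_lcoeff: assumes k: "cmp k" and L: "cmp L" and m: "cmp m" shows "cmp (\<lambda>x. lcoeff (k x) (L x) (m x))"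
  unfolding lcoeff_def by (intro cmp_rules cmp_eq_nat_list cmp_exps cmp_comp[OF k] cmp_comp[OF m] L)

lemma cmp_all_exps: assumes "cmp k" shows "cmp (\<lambda>x. all_exps (k x))"
  unfolding all_exps_def exp_step_def by (intro cmp_rules assms)

lemma cmp_lpoly_exps: assumes k: "cmp k" and L: "cmp L" shows "cmp (\<lambda>x. lpoly_exps (k x) (L x))"
  unfolding lpoly_exps_def by (intro cmp_rules cmp_lcoeff cmp_all_exps cmp_comp[OF k] cmp_comp[OF L])

lemma cmp_lpoly_code: assumes k: "cmp k" and L: "cmp L" shows "cmp (\<lambda>x. lpoly_code (k x) (L x))"
  unfolding lpoly_code_def
  by (intro cmp_rules cmp_code_nat cmp_code_int cmp_lpoly_exps cmp_lcoeff cmp_comp[OF k] cmp_comp[OF L])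

lemma cmp_lX: "cmp i \<Longrightarrow> cmp (\<lambda>x. lX (i x))"
  unfolding lX_def by (intro cmp_rules)

lemma cmp_lpair: assumes "cmp i" "cmp j" shows "cmp (\<lambda>x. lpair (i x) (j x))"
  unfolding lpair_def lhvar_def by (intro cmp_rules cmp_lmul cmp_lX assms)

lemma cmp_pair_coeff:
  assumes "cmp E" and i: "cmp i" and j: "cmp j" shows "cmp (\<lambda>x. pair_coeff (E x) (i x) (j x))"
  unfolding pair_coeff_def case_prod_unfold of_bool_def by (intro cmp_rules cmp_comp[OF i] cmp_comp[OF j] assms)

lemma cmp_lpivot:
  assumes "cmp n" "cmp i" "cmp j" "cmp E" shows "cmp (\<lambda>x. lpivot (n x) (i x) (j x) (E x))"
  unfolding lpivot_def by (intro cmp_rules cmp_lscale cmp_lmul cmp_pair_coeff cmp_lX assms)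

lemma cmp_lrel:
  assumes n: "cmp n" and "cmp eqs" and i: "cmp i" and j: "cmp j" shows "cmp (\<lambda>x. lrel (n x) (eqs x) (i x) (j x))"
  unfolding lrel_def
  by (intro cmp_rules cmp_lpair cmp_lpivot cmp_comp[OF n] cmp_comp[OF i] cmp_comp[OF j] assms)

lemma cmp_lrels: assumes n: "cmp n" and eqs: "cmp eqs" shows "cmp (\<lambda>x. lrels (n x) (eqs x))"
  unfolding lrels_def by (intro cmp_rules cmp_lrel cmp_comp[OF n] cmp_comp[OF eqs])

lemma cmp_lgens: assumes n: "cmp n" and eqs: "cmp eqs" shows "cmp (\<lambda>x. lgens (n x) (eqs x))"
  unfolding lgens_def lcubics_def
  by (intro cmp_rules cmp_lrels cmp_lmul cmp_lX cmp_comp[OF n] cmp_comp[OF eqs])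

lemma cmp_gens_code: assumes n: "cmp n" and ts: "cmp ts" shows "cmp (\<lambda>x. gens_code (n x) (ts x))"
  unfolding gens_code_def num_vars_def poly_gens_def
  by (intro cmp_rules cmp_code_nat cmp_lpoly_code cmp_lgens cmp_num_base cmp_poly_eqs cmp_comp[OF n] cmp_comp[OF ts])

lemma turing_computable_algorithm: "turing_computable algorithm"
proof (rule turing_computable_cmp)
  have "cmp (\<lambda>w. algorithm w)"
    unfolding algorithm_def by (intro cmp_rules cmp_gens_code cmp_parse_nat cmp_parse_terms)
  then show "cmp algorithm" by simp
qed

theorem theorem4p5:
  shows "\<exists>f. turing_computable f \<and>
    (\<forall>(n::nat) (P::int mpoly). P \<in> carrier (mpoly_ring n) \<longrightarrow>
      (\<exists>(N::nat) (gens::rat mpoly list) (I::rat mpoly set).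
         f (code_input n P) = code_output N gens \<and>
         length gens \<le> (N + 7) choose 5 \<and>
         (\<forall>g \<in> set gens. g \<in> carrier (STD_ring N) \<and> total_degree g \<le> 5) \<and>
         I = genideal (STD_ring N) (set gens) \<and>
         maximalideal (point_ideal N) (STD_ring N) \<and>
         primary_to (STD_ring N) I (point_ideal N) \<and>
         I \<noteq> carrier (STD_ring N) \<and>
         has_krull_dim (STD_ring N Quot I) 0 \<and>
         (\<forall>p \<in> I. num_terms p \<noteq> 1 \<and> num_terms p \<noteq> 2) \<and>
         num_terms (varS ^ 2 - varT ^ 2 - varS + varT) = 4 \<and>
         varS ^ 2 - varT ^ 2 - varS + varT \<in> I \<and>
         (\<forall>p \<in> I. num_terms p = 3 \<longrightarrow>
            (\<exists>t d. t \<in> carrier (STD_ring N) \<and> num_terms t = 1 \<and> length d = N \<and>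
                   p = t * affine_trinomial d)) \<and>
         ((\<exists>d::int list. length d = N \<and> affine_trinomial d \<in> I) \<longleftrightarrow>
          (\<exists>y::int list. length y = n \<and> meval (\<lambda>i. y ! i) P = 0))))"
proof (intro exI[of _ algorithm] conjI allI impI turing_computable_algorithm)
  fix n :: nat and P :: "int mpoly" assume P: "P \<in> carrier (mpoly_ring n)"
  let ?ts = "poly_terms n P"
  have ts: "\<forall>t \<in> set ?ts. length (snd t) = n" by (auto simp: poly_terms_def)
  interpret A: anisotropic_system "20 * num_base n ?ts" "poly_eqs n ?ts"
    by (rule poly_eqs_anisotropic[OF ts])
  let ?G = "map lpoly_val (poly_gens n ?ts)"
  have set: "set ?G = A.gens"
    using A.set_lgens by (simp add: poly_gens_def)
  have bound: "lpoly_bound 5 (num_vars n ?ts + 2) L" if "L \<in> set (poly_gens n ?ts)" for L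
    using A.lgens_bound that by (simp add: poly_gens_def num_vars_def)
  have out: "algorithm (code_input n P) = code_output (num_vars n ?ts) ?G"
    unfolding algorithm_code_input gens_code_def code_output_def code_list_def
    using lpoly_code[OF bound] by (simp add: comp_def cong: map_cong)
  \<comment> \<open>There are at most as many equations as variables, since each equation has a
    dummy variable of its own.\<close>
  have "length (poly_gens n ?ts) \<le> (num_vars n ?ts + 1)\<^sup>2 + 3 * num_vars n ?ts + 1"
    unfolding poly_gens_def num_vars_def by (rule order_trans[OF A.length_lgens]) simp
  then have len: "length ?G \<le> (num_vars n ?ts + 7) choose 5"
    using binomial_bound[of "num_vars n ?ts"] by simp
  have deg: "g \<in> carrier (STD_ring (num_vars n ?ts))" "total_degree g \<le> 5" if "g \<in> set ?G" for g
    using that lpoly_val_carrier[OF bound] total_degree_lpoly_val[OF bound] by auto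
  have "(\<exists>y. \<forall>E \<in> set (poly_eqs n ?ts). eq_value (case_nat 1 y) E = 0) \<longleftrightarrow>
      (\<exists>y. meval y P = 0)"
    unfolding poly_eqs_solvable[OF ts] terms_value_poly_terms[OF P] ..
  \<comment> \<open>\<open>P\<close> depends on the first \<open>n\<close> values only, so an
    assignment to all variables can be cut to a list.\<close>
  also have "\<dots> \<longleftrightarrow> (\<exists>y. length y = n \<and> meval (\<lambda>i. y ! i) P = 0)"
  proof
    assume "\<exists>y. meval y P = 0"
    then obtain y where "meval y P = 0" by blast
    then have "meval (\<lambda>i. map y [0..<n] ! i) P = 0"
      using terms_value_cong[of n "\<lambda>i. map y [0..<n] ! i" y ?ts] by (simp add: terms_value_poly_terms[OF P])
    then show "\<exists>y. length y = n \<and> meval (\<lambda>i. y ! i) P = 0" by (intro exI[of _ "map y [0..<n]"]) simp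
  qed blast
  finally have solv: "(\<exists>d. length d = num_vars n ?ts \<and> affine_trinomial d \<in> A.sys_ideal) \<longleftrightarrow>
      (\<exists>y. length y = n \<and> meval (\<lambda>i. y ! i) P = 0)"
    using A.affine_trinomial_solvable by (simp add: num_vars_def)
  have N: "20 * num_base n ?ts + length (poly_eqs n ?ts) = num_vars n ?ts" by (simp add: num_vars_def)
  have I: "A.sys_ideal = genideal (STD_ring (num_vars n ?ts)) (set ?G)"
    unfolding set N[symmetric] A.gen_ideal_eq[symmetric] A.gen_ideal_def ..
  show "\<exists>N gens I.
         algorithm (code_input n P) = code_output N gens \<and>
         length gens \<le> (N + 7) choose 5 \<and>
         (\<forall>g \<in> set gens. g \<in> carrier (STD_ring N) \<and> total_degree g \<le> 5) \<and>
         I = genideal (STD_ring N) (set gens) \<and>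
         maximalideal (point_ideal N) (STD_ring N) \<and>
         primary_to (STD_ring N) I (point_ideal N) \<and>
         I \<noteq> carrier (STD_ring N) \<and>
         has_krull_dim (STD_ring N Quot I) 0 \<and>
         (\<forall>p \<in> I. num_terms p \<noteq> 1 \<and> num_terms p \<noteq> 2) \<and>
         num_terms (varS ^ 2 - varT ^ 2 - varS + varT) = 4 \<and>
         varS ^ 2 - varT ^ 2 - varS + varT \<in> I \<and>
         (\<forall>p \<in> I. num_terms p = 3 \<longrightarrow>
            (\<exists>t d. t \<in> carrier (STD_ring N) \<and> num_terms t = 1 \<and> length d = N \<and>
                   p = t * affine_trinomial d)) \<and>
         ((\<exists>d::int list. length d = N \<and> affine_trinomial d \<in> I) \<longleftrightarrow>
          (\<exists>y::int list. length y = n \<and> meval (\<lambda>i. y ! i) P = 0))"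
    using out len deg I point_ideal_maximal A.sys_ideal_primary[unfolded N] A.sys_ideal_proper[unfolded N]
      A.sys_ideal_krull_dim[unfolded N] A.no_monomial A.no_binomial num_terms_quadrinomial A.quadrinomial_ideal
      A.trinomial_form[unfolded N] solv
    by (intro exI[of _ "num_vars n ?ts"] exI[of _ ?G] exI[of _ A.sys_ideal] conjI ballI impI) simp_all
qed

end
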